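(* Let $\Delta$ be an integral (lattice) polytope with non-singular fan in a finite-dimensional real vector space $V$ with a lattice $V_{\mathbb Z}$, with facets $\sigma_1,\dots,\sigma_d$. Let $f$ be a polynomial function on $V$. Then $$\sum_{x\in\Delta\cap V_{\mathbb Z}}f(x)=\int T(f),\qquad \sum_{x\in\operatorname{interior}(\Delta)\cap V_{\mathbb Z}}f(x)=\int\hat T(f),$$ and $$\sum_{x\in\Delta\cap V_{\mathbb Z}}f(x)-\frac12\sum_{x\in\partial\Delta\cap V_{\mathbb Z}}f(x)=\int\tfrac12(T+\hat T)(f),$$ where $$T=\sum_F\ \prod_{i\in I_F}\frac{[\sigma_i]}2\ \prod_{i\notin I_F}\frac{[\sigma_i]/2}{\tanh([\sigma_i]/2)},\qquad \hat T=\sum_F(-1)^{\operatorname{codim}F}\prod_{i\in I_F}\frac{[\sigma_i]}2\ \prod_{i\notin I_F}\frac{[\sigma_i]/2}{\tanh([\sigma_i]/2)},$$ the sums being over all faces $F$ of $\Delta$, and the functional $f\mapsto\int A(f)$ attached to a power series $A$ in $[\sigma_1],\dots,[\sigma_d]$ being as defined in the context.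
   Context: Polytopes (convex hulls of finite sets) are assumed to have nonempty interior; faces are nonempty and include $\Delta$ itself; facets are the codimension one faces. $\Delta$ is integral if its vertices lie in $V_{\mathbb Z}$. $\Delta$ has a non-singular fan if it is simple (exactly $n=\dim V$ edges emanate from each vertex) and, at each vertex, the edges lie along vectors that generate the lattice $V_{\mathbb Z}$. Write $\Delta=\bigcap_{i=1}^d\{x\mid\langle u_i,x\rangle+\lambda_i\ge0\}$, where $u_i$ is the inward normal to $\sigma_i$ that is a primitive element of the dual lattice $V_{\mathbb Z}^*$ and $\lambda_i\in\mathbb R$, and for $h\in\mathbb R^d$ put $\Delta(h)=\bigcap_{i=1}^d\{x\mid\langle u_i,x\rangle+\lambda_i+h_i\ge0\}$. For a face $F$, $I_F=\{i\mid F\subseteq\sigma_i\}$, so $F=\bigcap_{i\in I_F}\sigma_i$ and $|I_F|=\operatorname{codim}F$. Lebesgue measure on $V$ is normalized so that a fundamental domain of $V_{\mathbb Z}$ has measure one. $[\sigma_1],\dots,[\sigma_d]$ are commuting formal variables. For a formal power series $A=\sum_\alpha a_\alpha\prod_{i=1}^d[\sigma_i]^{\alpha(i)}$ with constant coefficients $a_\alpha$ ($\alpha\colon\{1,\dots,d\}\to\mathbb Z_{\ge0}$) and a polynomial $f$ on $V$, $$\int A(f):=\sum_\alpha a_\alpha\left.\prod_{i=1}^d\left(\frac{\partial}{\partial h_i}\right)^{\alpha(i)}\right|_{h=0}\int_{\Delta(h)}f(x)\,dx$$ (for $h$ near $0$ the integral is a polynomial in $h$, so the sum is finite). The expression $\frac{[\sigma_i]/2}{\tanh([\sigma_i]/2)}$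 denotes the Taylor series at $0$ of $\frac{s/2}{\tanh(s/2)}=1+\frac{s^2}{12}-\cdots$ with $s=[\sigma_i]$. *)

theory Defs
  imports "HOL-Analysis.Analysis" "HOL-Library.Poly_Mapping"
begin

typedef ('v, 'a) mfps = "UNIV :: (('v \<Rightarrow>\<^sub>0 nat) \<Rightarrow> 'a) set"
  morphisms mcoeff Abs_mfps ..

lemma mcoeff_Abs_mfps [simp]: "mcoeff (Abs_mfps c) = c"
  by (simp add: Abs_mfps_inverse)

lemma mfps_eqI: "(\<And>\<alpha>. mcoeff A \<alpha> = mcoeff B \<alpha>) \<Longrightarrow> A = B"
  by (metis ext mcoeff_inject)

lemma finite_exponents_below:
  fixes \<alpha> :: "'v \<Rightarrow>\<^sub>0 nat"
  shows "finite {\<beta>. \<forall>i. Poly_Mapping.lookup \<beta> i \<le> Poly_Mapping.lookup \<alpha> i}" (is "finite ?B")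
proof -
  let ?K = "Poly_Mapping.keys \<alpha>"
  have "Poly_Mapping.lookup ` ?B \<subseteq>
      {f. \<forall>i. (i \<in> ?K \<longrightarrow> f i \<in> {..Max (range (Poly_Mapping.lookup \<alpha>))})
            \<and> (i \<notin> ?K \<longrightarrow> f i = 0)}" (is "_ \<subseteq> ?F")
  proof safe
    fix \<beta> :: "'v \<Rightarrow>\<^sub>0 nat" and i :: 'v
    assume le: "\<forall>i. Poly_Mapping.lookup \<beta> i \<le> Poly_Mapping.lookup \<alpha> i"
    have "range (Poly_Mapping.lookup \<alpha>) \<subseteq> insert 0 (Poly_Mapping.lookup \<alpha> ` ?K)"
      by (auto simp: in_keys_iff)
    then have "finite (range (Poly_Mapping.lookup \<alpha>))"
      by (rule finite_subset) simp
    then have "Poly_Mapping.lookup \<alpha> i \<le> Max (range (Poly_Mapping.lookup \<alpha>))"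
      by (rule Max_ge) simp
    then show "Poly_Mapping.lookup \<beta> i \<le> Max (range (Poly_Mapping.lookup \<alpha>))"
      using le order_trans by blast
    assume "i \<notin> ?K"
    then show "Poly_Mapping.lookup \<beta> i = 0"
      using le by (metis in_keys_iff le_zero_eq)
  qed
  moreover have "finite ?F"
    by (rule finite_set_of_finite_funs) simp_all
  ultimately have "finite (Poly_Mapping.lookup ` ?B)"
    by (rule finite_subset)
  then show ?thesis
    by (rule finite_imageD) (simp add: inj_on_def poly_mapping_eqI)
qed

lemma finite_exponent_splits:
  "finite {(\<beta>, \<gamma>). \<beta> + \<gamma> = (\<alpha> :: 'v \<Rightarrow>\<^sub>0 nat)}"
proof -
  let ?B = "{\<beta>. \<forall>i. Poly_Mapping.lookup \<beta> i \<le> Poly_Mapping.lookup \<alpha> i}"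
  have "{(\<beta>, \<gamma>). \<beta> + \<gamma> = \<alpha>} \<subseteq> ?B \<times> ?B"
    by (auto simp: lookup_add)
  then show ?thesis
    by (rule finite_subset) (simp add: finite_exponents_below)
qed

lemma finite_exponent_splits' [simp]:
  "finite {p. fst p + snd p = (\<alpha> :: 'v \<Rightarrow>\<^sub>0 nat)}"
  using finite_exponent_splits[of \<alpha>] by (simp add: case_prod_unfold)

instantiation mfps :: (type, comm_ring_1) comm_ring_1
begin

definition "0 = Abs_mfps (\<lambda>_. 0)"

definition "1 = Abs_mfps (\<lambda>\<alpha>. if \<alpha> = 0 then 1 else 0)"

definition "A + B = Abs_mfps (\<lambda>\<alpha>. mcoeff A \<alpha> + mcoeff B \<alpha>)"

definition "A - B = Abs_mfps (\<lambda>\<alpha>. mcoeff A \<alpha> - mcoeff B \<alpha>)"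

definition "- A = Abs_mfps (\<lambda>\<alpha>. - mcoeff A \<alpha>)"

definition "A * B = Abs_mfps (\<lambda>\<alpha>.
  \<Sum>(\<beta>, \<gamma>) | \<beta> + \<gamma> = \<alpha>. mcoeff A \<beta> * mcoeff B \<gamma>)"

instance
proof
  fix A B C :: "('a, 'b) mfps"
  note defs = zero_mfps_def one_mfps_def plus_mfps_def minus_mfps_def uminus_mfps_def
  show "A + B + C = A + (B + C)" "A + B = B + A" "0 + A = A" "- A + A = 0" "A - B = A + - B"
    by (rule mfps_eqI, simp add: defs add_ac)+
  show "(A + B) * C = A * C + B * C"
    by (rule mfps_eqI)
      (simp add: times_mfps_def plus_mfps_def case_prod_unfold distrib_right sum.distrib)
  show "A * B = B * A"
  proof (rule mfps_eqI)
    fix \<alpha>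
    show "mcoeff (A * B) \<alpha> = mcoeff (B * A) \<alpha>"
      unfolding times_mfps_def mcoeff_Abs_mfps
      by (rule sum.reindex_bij_witness[where i = prod.swap and j = prod.swap])
        (auto simp: add.commute mult.commute)
  qed
  show "1 * A = A"
  proof (rule mfps_eqI)
    fix \<alpha>
    have "mcoeff (1 * A) \<alpha> =
        (\<Sum>p | fst p + snd p = \<alpha>. (if fst p = 0 then 1 else 0) * mcoeff A (snd p))"
      by (simp add: times_mfps_def one_mfps_def case_prod_unfold)
    also have "\<dots> = (\<Sum>p\<in>{(0 :: 'a \<Rightarrow>\<^sub>0 nat, \<alpha>)}. (if fst p = 0 then 1 else 0) * mcoeff A (snd p))"
      by (rule sum.mono_neutral_right) auto
    finally show "mcoeff (1 * A) \<alpha> = mcoeff A \<alpha>"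
      by simp
  qed
  show "A * B * C = A * (B * C)"
  proof (rule mfps_eqI)
    fix \<alpha>
    have "mcoeff (A * B * C) \<alpha> =
        (\<Sum>p | fst p + snd p = \<alpha>.
          (\<Sum>q | fst q + snd q = fst p. mcoeff A (fst q) * mcoeff B (snd q)) * mcoeff C (snd p))"
      by (simp only: times_mfps_def mcoeff_Abs_mfps case_prod_unfold)
    also have "\<dots> =
        (\<Sum>(p, q)\<in>Sigma {p. fst p + snd p = \<alpha>} (\<lambda>p. {q. fst q + snd q = fst p}).
          mcoeff A (fst q) * mcoeff B (snd q) * mcoeff C (snd p))"
      unfolding sum_distrib_right by (rule sum.Sigma) simp_all
    also have "\<dots> =
        (\<Sum>(p, q)\<in>Sigma {p. fst p + snd p = \<alpha>} (\<lambda>p. {q. fst q + snd q = snd p}).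
          mcoeff A (fst p) * (mcoeff B (fst q) * mcoeff C (snd q)))"
      by (rule sum.reindex_bij_witness[where
            i = "\<lambda>(p, q). ((fst p + fst q, snd q), (fst p, fst q))" and
            j = "\<lambda>(p, q). ((fst q, snd q + snd p), (snd q, snd p))"])
        (clarsimp simp: add.assoc mult.assoc)+
    also have "\<dots> =
        (\<Sum>p | fst p + snd p = \<alpha>.
          mcoeff A (fst p) * (\<Sum>q | fst q + snd q = snd p. mcoeff B (fst q) * mcoeff C (snd q)))"
      unfolding sum_distrib_left by (rule sum.Sigma[symmetric]) simp_all
    also have "\<dots> = mcoeff (A * (B * C)) \<alpha>"
      by (simp only: times_mfps_def mcoeff_Abs_mfps case_prod_unfold)
    finally show "mcoeff (A * B * C) \<alpha> = mcoeff (A * (B * C)) \<alpha>" .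
  qed
  show "(0 :: ('a, 'b) mfps) \<noteq> 1"
  proof
    assume "(0 :: ('a, 'b) mfps) = 1"
    then have "mcoeff (0 :: ('a, 'b) mfps) 0 = mcoeff 1 0"
      by simp
    then show False
      by (simp add: zero_mfps_def one_mfps_def)
  qed
qed

end

definition mfps_const :: "'a \<Rightarrow> ('v, 'a::comm_ring_1) mfps" where
  "mfps_const c = Abs_mfps (\<lambda>\<alpha>. if \<alpha> = 0 then c else 0)"

definition mfps_var :: "'v \<Rightarrow> ('v, 'a::comm_ring_1) mfps" where
  "mfps_var i = Abs_mfps (\<lambda>\<alpha>. if \<alpha> = Poly_Mapping.single i 1 then 1 else 0)"

text \<open>The univariate series \<open>\<Sum>k. c\<^sub>k s\<^sup>k\<close> with the \<open>i\<close>-th variable substituted for \<open>s\<close>.\<close>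

definition mfps_of_fps :: "'v \<Rightarrow> 'a fps \<Rightarrow> ('v, 'a::comm_ring_1) mfps" where
  "mfps_of_fps i c = Abs_mfps (\<lambda>\<alpha>.
    if Poly_Mapping.keys \<alpha> \<subseteq> {i} then fps_nth c (Poly_Mapping.lookup \<alpha> i) else 0)"

text \<open>
  The Taylor series at \<open>0\<close> of \<open>(s/2) / tanh (s/2)\<close>; the value \<open>1\<close> at \<open>s = 0\<close> is the continuous
  extension, since division by zero would give \<open>0\<close>.
\<close>

definition half_over_tanh_fps :: "real fps" where
  "half_over_tanh_fps = Abs_fps (\<lambda>k.
    (deriv ^^ k) (\<lambda>s. if s = 0 then 1 else (s / 2) / tanh (s / 2)) 0 / fact k)"

definition int_span :: "'a::real_vector set \<Rightarrow> 'a set" where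
  "int_span S = {\<Sum>a\<in>t. of_int (r a) *\<^sub>R a | t (r :: 'a \<Rightarrow> int). finite t \<and> t \<subseteq> S}"

definition lattice_basis :: "'a::euclidean_space set \<Rightarrow> 'a set \<Rightarrow> bool" where
  "lattice_basis L B \<longleftrightarrow> independent B \<and> span B = UNIV \<and> L = int_span B"

definition is_lattice :: "'a::euclidean_space set \<Rightarrow> bool" where
  "is_lattice L \<longleftrightarrow> (\<exists>B. lattice_basis L B)"

text \<open>The dual space is identified with the space itself by means of the inner product.\<close>

definition dual_lattice :: "'a::euclidean_space set \<Rightarrow> 'a set" where
  "dual_lattice L = {u. \<forall>x\<in>L. u \<bullet> x \<in> \<int>}"

definition primitive_in :: "'a::euclidean_space set \<Rightarrow> 'a \<Rightarrow> bool" where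
  "primitive_in M u \<longleftrightarrow> u \<in> M \<and> u \<noteq> 0 \<and>
    (\<forall>(k::int) w. w \<in> M \<and> u = of_int k *\<^sub>R w \<longrightarrow> \<bar>k\<bar> = 1)"

definition fundamental_domain :: "'a::euclidean_space set \<Rightarrow> 'a set" where
  "fundamental_domain B = {\<Sum>b\<in>B. t b *\<^sub>R b | t. \<forall>b\<in>B. 0 \<le> t b \<and> t b < 1}"

text \<open>
  Lebesgue measure normalized by the lattice. The choice of the basis is immaterial: any two
  bases differ by a unimodular transformation.
\<close>

definition lattice_measure :: "'a::euclidean_space set \<Rightarrow> 'a measure" where
  "lattice_measure L =
    scale_measure (1 / emeasure lborel (fundamental_domain (SOME B. lattice_basis L B))) lborel"

definition integral_polytope :: "'a::euclidean_space set \<Rightarrow> 'a set \<Rightarrow> bool" where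
  "integral_polytope L \<Delta> \<longleftrightarrow>
    polytope \<Delta> \<and> interior \<Delta> \<noteq> {} \<and> (\<forall>v. v extreme_point_of \<Delta> \<longrightarrow> v \<in> L)"

definition edges_at :: "'a::euclidean_space set \<Rightarrow> 'a \<Rightarrow> 'a set set" where
  "edges_at \<Delta> v = {e. e edge_of \<Delta> \<and> v \<in> e}"

definition nonsingular_fan :: "'a::euclidean_space set \<Rightarrow> 'a set \<Rightarrow> bool" where
  "nonsingular_fan L \<Delta> \<longleftrightarrow> (\<forall>v. v extreme_point_of \<Delta> \<longrightarrow>
    card (edges_at \<Delta> v) = DIM('a) \<and>
    (\<exists>w. (\<forall>e \<in> edges_at \<Delta> v. e \<subseteq> {v + t *\<^sub>R w e | t. 0 \<le> t}) \<and>
         int_span (w ` edges_at \<Delta> v) = L))"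

definition inward_normal :: "'a::euclidean_space set \<Rightarrow> 'a set \<Rightarrow> 'a \<Rightarrow> bool" where
  "inward_normal \<Delta> F u \<longleftrightarrow> u \<noteq> 0 \<and> (\<forall>x\<in>F. \<forall>y\<in>\<Delta>. u \<bullet> x \<le> u \<bullet> y)"

definition faces :: "'a::euclidean_space set \<Rightarrow> 'a set set" where
  "faces \<Delta> = {F. F face_of \<Delta> \<and> F \<noteq> {}}"

definition codim :: "'a::euclidean_space set \<Rightarrow> nat" where
  "codim F = nat (int DIM('a) - aff_dim F)"

text \<open>
  Below, \<open>d\<close> is the number of facets, \<open>\<sigma>\<close> enumerates them by the indices \<open>1, \<dots>, d\<close>, and
  \<open>u\<close>, \<open>\<kappa>\<close> are the normals and the constants of the defining inequalities.
\<close>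

definition facet_indices :: "nat \<Rightarrow> (nat \<Rightarrow> 'a set) \<Rightarrow> 'a set \<Rightarrow> nat set" where
  "facet_indices d \<sigma> F = {i \<in> {1..d}. F \<subseteq> \<sigma> i}"

definition shifted_polytope ::
    "nat \<Rightarrow> (nat \<Rightarrow> 'a::euclidean_space) \<Rightarrow> (nat \<Rightarrow> real) \<Rightarrow> (nat \<Rightarrow> real) \<Rightarrow> 'a set" where
  "shifted_polytope d u \<kappa> h = (\<Inter>i\<in>{1..d}. {x. u i \<bullet> x + \<kappa> i + h i \<ge> 0})"

definition partial_deriv :: "nat \<Rightarrow> ((nat \<Rightarrow> real) \<Rightarrow> real) \<Rightarrow> (nat \<Rightarrow> real) \<Rightarrow> real" where
  "partial_deriv i g = (\<lambda>h. deriv (\<lambda>t. g (h(i := t))) (h i))"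

text \<open>
  \<open>\<Prod>i=1..d. (\<partial>/\<partial>h\<^sub>i)\<^bsup>\<alpha>(i)\<^esup>\<close>, as a composition of operators; the order is immaterial
  on functions that are polynomial near the point of evaluation.
\<close>

definition mixed_deriv ::
    "nat \<Rightarrow> (nat \<Rightarrow>\<^sub>0 nat) \<Rightarrow> ((nat \<Rightarrow> real) \<Rightarrow> real) \<Rightarrow> (nat \<Rightarrow> real) \<Rightarrow> real" where
  "mixed_deriv d \<alpha> g =
    fold (\<lambda>i. partial_deriv i ^^ Poly_Mapping.lookup \<alpha> i) [1..<Suc d] g"

definition series_integral ::
    "'a::euclidean_space set \<Rightarrow> nat \<Rightarrow> (nat \<Rightarrow> 'a) \<Rightarrow> (nat \<Rightarrow> real) \<Rightarrow> (nat, real) mfps \<Rightarrow>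
     ('a \<Rightarrow> real) \<Rightarrow> real" where
  "series_integral L d u \<kappa> A f =
    (\<Sum>\<^sub>\<infinity>\<alpha> | Poly_Mapping.keys \<alpha> \<subseteq> {1..d}. mcoeff A \<alpha> *
      mixed_deriv d \<alpha> (\<lambda>h. LINT x:shifted_polytope d u \<kappa> h|lattice_measure L. f x) (\<lambda>_. 0))"

definition face_series ::
    "nat \<Rightarrow> (nat \<Rightarrow> 'a set) \<Rightarrow> 'a::euclidean_space set \<Rightarrow> (nat, real) mfps" where
  "face_series d \<sigma> F =
    (\<Prod>i\<in>facet_indices d \<sigma> F. mfps_const (1 / 2) * mfps_var i) *
    (\<Prod>i\<in>{1..d} - facet_indices d \<sigma> F. mfps_of_fps i half_over_tanh_fps)"

definition T_series ::
    "nat \<Rightarrow> (nat \<Rightarrow> 'a set) \<Rightarrow> 'a::euclidean_space set \<Rightarrow> (nat, real) mfps" where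
  "T_series d \<sigma> \<Delta> = (\<Sum>F\<in>faces \<Delta>. face_series d \<sigma> F)"

definition T_hat_series ::
    "nat \<Rightarrow> (nat \<Rightarrow> 'a set) \<Rightarrow> 'a::euclidean_space set \<Rightarrow> (nat, real) mfps" where
  "T_hat_series d \<sigma> \<Delta> = (\<Sum>F\<in>faces \<Delta>. (- 1) ^ codim F * face_series d \<sigma> F)"

end

theory Submission
  imports Defs
begin

text \<open>
  Flipping the cones at the vertices so that a generic linear form \<open>\<xi>\<close> is bounded above on each of
  them, the indicator function of a simple polytope becomes a signed sum of indicator functions of
  cones (Lawrence, Varchenko). The value at \<open>x\<close> of this sum depends only on the set \<open>N\<close> of
  inequalities violated by \<open>x\<close>: it is the sum of \<open>(-1)\<^bsup>|J|\<^esup>\<close> over the faces \<open>J \<subseteq> N\<close> of the dual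
  simplicial complex, as one sees by grouping the faces of the polytope according to the vertex at
  which \<open>\<xi>\<close> is maximal. In particular it does not depend on \<open>\<xi>\<close>, and for \<open>\<xi>\<close> separating
  \<open>x\<close> from the polytope no term survives.

  Integrating and summing \<open>e\<^sup>t\<^sup>\<xi>\<^sup>\<sqdot>\<^sup>x\<close> over the unimodular cones gives Brion's formulas for the volume
  of \<open>\<Delta>(h)\<close> and for the lattice points of \<open>\<Delta>\<close> and of its interior. Comparing coefficients of \<open>t\<close>,
  the integral of \<open>(\<xi>\<sqdot>x)\<^sup>k\<close> over \<open>\<Delta>(h)\<close> is a combination of powers of the affine functions
  \<open>\<xi>\<sqdot>v(h)\<close>, on which a power series in the \<open>\<partial>/\<partial>h\<^sub>i\<close> acts by \<open>[\<sigma>\<^sub>i] \<mapsto> -(\<xi>\<sqdot>w\<^sub>i) t\<close>. At the vertex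
  \<open>v\<close> only the faces containing \<open>v\<close> contribute to \<open>T\<close>, and they add up to the product of the
  Todd series \<open>s / (1 - e\<^sup>-\<^sup>s)\<close>, which turns the volume formula into the lattice point formula.
  Finally, the powers of generic linear forms span all polynomials.
\<close>

section \<open>Univariate power series\<close>

text \<open>No single \<open>\<xi>\<close> makes the exponential summable over all unflipped vertex
  cones, since it grows along the edges leaving its minimum. Flipping makes every term absolutely
  convergent, and the signs it costs are exactly those that restore the rational functions of the
  unflipped cones. Lattice points on the boundary forbid working up to null sets: flipping an
  inequality means negating it, so the cones are half-open and the decomposition holds at every
  point.

  Each vertex term has a pole of order \<open>DIM('a)\<close> at \<open>t = 0\<close> and only the
  whole sum is regular; hence the index shift by \<open>DIM('a)\<close> and the comparison of series
  away from \<open>0\<close>. For small \<open>h\<close> no vertex is lost, so one formula is valid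
  in a whole box around \<open>0\<close> and can be differentiated there.

  The hypotheses speak of edges and of facets separately. That \<open>\<kappa> i\<close> is the
  constant cutting out \<open>\<sigma> i\<close>, and that the primitive normals are dual to the
  edge generators, must both be derived from the geometry.\<close>

lemma fps_nth_eq_higher_deriv:
  fixes f :: "real \<Rightarrow> real"
  assumes "f has_fps_expansion F"
  shows "fps_nth F n = (deriv ^^ n) f 0 / fact n"
  using assms
proof (induction n arbitrary: f F)
  case 0
  then have "eval_fps F 0 = f 0"
    unfolding has_fps_expansion_def using eventually_nhds_x_imp_x by blast
  then show ?case
    by (simp add: eval_fps_at_0)
next
  case (Suc n)
  from Suc.IH[OF has_fps_expansion_deriv[OF Suc.prems]]
  have "fps_nth F (Suc n) * (1 + real n) = (deriv ^^ Suc n) f 0 / fact n"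
    by (simp add: fps_deriv_def funpow_Suc_right mult.commute add.commute del: funpow.simps)
  moreover have "(deriv ^^ Suc n) f 0 / fact (Suc n) = (deriv ^^ Suc n) f 0 / fact n / (1 + real n)"
    by simp
  moreover have "1 + real n \<noteq> 0"
    by linarith
  ultimately show ?case
    by (simp add: nonzero_eq_divide_eq)
qed

text \<open>Continuity fixes the value at \<open>0\<close>, and the derivatives then determine the
  coefficients. Formulas with removable poles thus need checking only where the division is
  genuine.\<close>

lemma has_fps_expansion_unique_punctured:
  fixes f g :: "real \<Rightarrow> real"
  assumes f: "f has_fps_expansion F" and g: "g has_fps_expansion G"
    and eq: "\<And>x. x \<noteq> 0 \<Longrightarrow> f x = g x"
  shows "F = G"
proof -
  have "(f \<longlongrightarrow> f 0) (at 0)" "(g \<longlongrightarrow> g 0) (at 0)"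
    using has_fps_expansion_imp_continuous[OF f] has_fps_expansion_imp_continuous[OF g]
    by (auto simp: continuous_within)
  moreover have "(f \<longlongrightarrow> l) (at 0) \<longleftrightarrow> (g \<longlongrightarrow> l) (at 0)" for l
    by (rule filterlim_cong) (auto simp: eventually_at_filter eq)
  ultimately have "f 0 = g 0"
    using tendsto_unique[OF trivial_limit_at] by blast
  then have "f = g"
    using eq by (metis ext)
  then show ?thesis
    by (intro fps_ext) (simp add: fps_nth_eq_higher_deriv[OF f] fps_nth_eq_higher_deriv[OF g])
qed

lemma has_fps_expansion_scale:
  fixes f :: "real \<Rightarrow> real"
  assumes "f has_fps_expansion F"
  shows "(\<lambda>x. f (c * x)) has_fps_expansion Abs_fps (\<lambda>n. c ^ n * fps_nth F n)"
proof (rule has_fps_expansionI)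
  have "eventually (\<lambda>z. ereal (norm z) < fps_conv_radius F) (nhds (0::real))"
    using assms eventually_nhds_in_open[of "eball 0 (fps_conv_radius F)" "0::real"]
    by (auto simp: has_fps_expansion_def zero_ereal_def in_eball_iff)
  moreover have "eventually (\<lambda>z. eval_fps F z = f z) (nhds 0)"
    using assms by (simp add: has_fps_expansion_def)
  ultimately have "eventually (\<lambda>u. (\<lambda>n. fps_nth F n * u ^ n) sums f u) (nhds 0)"
  proof eventually_elim
    case (elim z)
    then show ?case
      using sums_eval_fps[of z F] by simp
  qed
  moreover have "filterlim (\<lambda>x. c * x) (nhds 0) (nhds (0::real))"
    by (auto intro!: tendsto_eq_intros filterlim_ident)
  ultimately have "eventually (\<lambda>x. (\<lambda>n. fps_nth F n * (c * x) ^ n) sums f (c * x)) (nhds 0)"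
    by (rule eventually_compose_filterlim)
  then show "\<forall>\<^sub>F x in nhds 0. (\<lambda>n. fps_nth (Abs_fps (\<lambda>n. c ^ n * fps_nth F n)) n * x ^ n)
      sums f (c * x)"
    by (simp add: power_mult_distrib mult_ac)
qed

definition half_over_tanh :: "real \<Rightarrow> real" where
  "half_over_tanh s = (if s = 0 then 1 else (s / 2) / tanh (s / 2))"

lemma half_over_tanh_eq:
  assumes "s \<noteq> 0"
  shows "half_over_tanh s = s / 2 * (exp s + 1) / (exp s - 1)"
proof -
  have "exp s - 1 \<noteq> 0" "1 - exp (- s) \<noteq> 0" "1 + exp (- s) > 0"
    using assms by (auto intro: add_pos_pos)
  moreover have "tanh (s / 2) = (1 - exp (- s)) / (1 + exp (- s))"
    by (simp add: tanh_real_altdef)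
  ultimately show ?thesis
    using assms unfolding half_over_tanh_def by (simp add: field_simps exp_minus)
qed

text \<open>\<open>half_over_tanh\<close> is the Todd function \<open>s / (1 - exp (- s))\<close>
  with its only odd term \<open>s / 2\<close> removed; as it is even, \<open>todd_minus\<close> is
  the same identity at \<open>- s\<close>.\<close>

lemma todd_plus:
  assumes "s \<noteq> 0"
  shows "s / 2 + half_over_tanh s = s / (1 - exp (- s))"
proof -
  have "exp s - 1 \<noteq> 0" "1 - exp (- s) \<noteq> 0"
    using assms by auto
  then show ?thesis
    using assms unfolding half_over_tanh_eq[OF assms] by (simp add: field_simps exp_minus)
qed

lemma todd_minus:
  assumes "s \<noteq> 0"
  shows "- s / 2 + half_over_tanh s = s / (exp s - 1)"
proof -
  have "exp s - 1 \<noteq> 0"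
    using assms by auto
  then show ?thesis
    using assms unfolding half_over_tanh_eq[OF assms] by (simp add: field_simps)
qed

text \<open>Numerator and denominator both have subdegree \<open>1\<close>, so their quotient is
  again a power series; uniqueness of Taylor coefficients identifies it with the series defined by
  iterated derivatives.\<close>

lemma half_over_tanh_has_fps_expansion: "half_over_tanh has_fps_expansion half_over_tanh_fps"
proof -
  define F G :: "real fps"
    where "F = fps_const (1/2) * fps_X * (fps_exp 1 + 1)" and "G = fps_exp 1 - 1"
  have G: "fps_nth G 0 = 0" "fps_nth G 1 = 1" and F: "fps_nth F 0 = 0" "fps_nth F 1 = 1"
    by (simp_all add: F_def G_def mult.assoc fps_mult_nth)
  have sG: "subdegree G = 1"
    using G by (intro subdegreeI) auto
  have sF: "subdegree F = 1"
    using F by (intro subdegreeI) auto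
  have "(\<lambda>x. if x = 0 then 1 else (1 / 2 * x * (exp (1 * x) + 1)) / (exp (1 * x) - 1))
      has_fps_expansion F / G"
  proof (rule has_fps_expansion_divide)
    show "(\<lambda>x. 1 / 2 * x * (exp (1 * x) + 1)) has_fps_expansion F"
      unfolding F_def by (intro fps_expansion_intros)
    show "(\<lambda>x. exp (1 * x) - 1) has_fps_expansion G"
      unfolding G_def by (intro fps_expansion_intros)
    show "G \<noteq> 0"
      using G by auto
    show "1 = fps_nth F (subdegree G) / fps_nth G (subdegree G)"
      using F G sG by simp
  qed (use sF sG in simp)
  also have "(\<lambda>x. if x = 0 then 1 else (1 / 2 * x * (exp (1 * x) + 1)) / (exp (1 * x) - 1)) =
      half_over_tanh"
    using half_over_tanh_eq by (auto simp: half_over_tanh_def fun_eq_iff)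
  finally have *: "half_over_tanh has_fps_expansion F / G" .
  have "(\<lambda>s. if s = 0 then 1 else (s / 2) / tanh (s / 2)) = half_over_tanh"
    by (simp add: half_over_tanh_def fun_eq_iff)
  then have "half_over_tanh_fps = F / G"
    by (intro fps_ext) (simp add: half_over_tanh_fps_def fps_nth_eq_higher_deriv[OF *])
  with * show ?thesis
    by simp
qed

section \<open>Restricting a multivariate series to a line\<close>

definition exponents_of_degree :: "'v set \<Rightarrow> nat \<Rightarrow> ('v \<Rightarrow>\<^sub>0 nat) set" where
  "exponents_of_degree K n =
    {\<alpha>. Poly_Mapping.keys \<alpha> \<subseteq> K \<and> (\<Sum>i\<in>K. Poly_Mapping.lookup \<alpha> i) = n}"

definition monomial_value :: "'v set \<Rightarrow> ('v \<Rightarrow> 'a) \<Rightarrow> ('v \<Rightarrow>\<^sub>0 nat) \<Rightarrow> 'a::comm_ring_1" where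
  "monomial_value K b \<alpha> = (\<Prod>i\<in>K. b i ^ Poly_Mapping.lookup \<alpha> i)"

text \<open>The series in \<open>t\<close> obtained from \<open>A\<close> by \<open>[\<sigma>\<^sub>i] \<mapsto> b\<^sub>i t\<close> for \<open>i \<in> K\<close>.\<close>

definition mfps_line :: "'v set \<Rightarrow> ('v \<Rightarrow> 'a) \<Rightarrow> ('v, 'a::comm_ring_1) mfps \<Rightarrow> 'a fps" where
  "mfps_line K b A =
    Abs_fps (\<lambda>n. \<Sum>\<alpha>\<in>exponents_of_degree K n. mcoeff A \<alpha> * monomial_value K b \<alpha>)"

lemma finite_exponents_of_degree [simp]:
  assumes "finite K"
  shows "finite (exponents_of_degree K n)"
proof -
  define \<gamma> where "\<gamma> = (\<Sum>i\<in>K. Poly_Mapping.single i n)"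
  have lookup_sum: "Poly_Mapping.lookup (sum g S) j = (\<Sum>i\<in>S. Poly_Mapping.lookup (g i) j)"
    if "finite S" for g :: "'a \<Rightarrow> 'a \<Rightarrow>\<^sub>0 nat" and S j
    using that by (induction S) (auto simp: lookup_add)
  have \<gamma>: "Poly_Mapping.lookup \<gamma> j = (if j \<in> K then n else 0)" for j
    unfolding \<gamma>_def lookup_sum[OF assms] using assms
    by (simp add: lookup_single when_def)
  have "exponents_of_degree K n \<subseteq> {\<beta>. \<forall>i. Poly_Mapping.lookup \<beta> i \<le> Poly_Mapping.lookup \<gamma> i}"
  proof safe
    fix \<beta> i
    assume *: "\<beta> \<in> exponents_of_degree K n"
    show "Poly_Mapping.lookup \<beta> i \<le> Poly_Mapping.lookup \<gamma> i"
    proof (cases "i \<in> K")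
      case True
      then have "Poly_Mapping.lookup \<beta> i \<le> n"
        using * assms member_le_sum[of i K "Poly_Mapping.lookup \<beta>"]
        by (auto simp: exponents_of_degree_def)
      then show ?thesis
        by (simp add: \<gamma> True)
    next
      case False
      then have "Poly_Mapping.lookup \<beta> i = 0"
        using * by (auto simp: exponents_of_degree_def in_keys_iff)
      then show ?thesis
        by simp
    qed
  qed
  then show ?thesis
    using finite_exponents_below by (rule finite_subset)
qed

lemma keys_add_nat:
  "Poly_Mapping.keys (\<beta> + \<gamma>) = Poly_Mapping.keys \<beta> \<union> Poly_Mapping.keys (\<gamma> :: 'v \<Rightarrow>\<^sub>0 nat)"
  by (auto simp: in_keys_iff lookup_add)

lemma mfps_line_add: "mfps_line K b (A + B) = mfps_line K b A + mfps_line K b B"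
  by (rule fps_ext) (simp add: mfps_line_def plus_mfps_def distrib_right sum.distrib)

lemma mfps_line_uminus: "mfps_line K b (- A) = - mfps_line K b A"
  by (rule fps_ext) (simp add: mfps_line_def uminus_mfps_def sum_negf)

lemma mfps_line_0 [simp]: "mfps_line K b 0 = 0"
  by (rule fps_ext) (simp add: mfps_line_def zero_mfps_def)

lemma mfps_line_sum: "mfps_line K b (\<Sum>i\<in>S. A i) = (\<Sum>i\<in>S. mfps_line K b (A i))"
  by (induction S rule: infinite_finite_induct) (simp_all add: mfps_line_add)

lemma exponents_of_degree_single:
  assumes "finite K" "i \<in> K" "Poly_Mapping.keys \<alpha> \<subseteq> {i}"
  shows "\<alpha> \<in> exponents_of_degree K n \<longleftrightarrow> Poly_Mapping.lookup \<alpha> i = n"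
    and "monomial_value K b \<alpha> = b i ^ Poly_Mapping.lookup \<alpha> i"
proof -
  have 0: "Poly_Mapping.lookup \<alpha> j = 0" if "j \<noteq> i" for j
    using assms(3) that by (auto simp: in_keys_iff)
  have "(\<Sum>j\<in>K. Poly_Mapping.lookup \<alpha> j) = (\<Sum>j\<in>{i}. Poly_Mapping.lookup \<alpha> j)"
    using assms 0 by (intro sum.mono_neutral_right) auto
  then show "\<alpha> \<in> exponents_of_degree K n \<longleftrightarrow> Poly_Mapping.lookup \<alpha> i = n"
    using assms by (auto simp: exponents_of_degree_def)
  have "(\<Prod>j\<in>K. b j ^ Poly_Mapping.lookup \<alpha> j) = (\<Prod>j\<in>{i}. b j ^ Poly_Mapping.lookup \<alpha> j)"
    using assms 0 by (intro prod.mono_neutral_right) auto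
  then show "monomial_value K b \<alpha> = b i ^ Poly_Mapping.lookup \<alpha> i"
    by (simp add: monomial_value_def)
qed

text \<open>Among the exponents of degree \<open>n\<close> only
  \<open>Poly_Mapping.single i n\<close> is supported in \<open>{i}\<close>.\<close>

lemma mfps_line_of_fps:
  assumes "finite K" "i \<in> K"
  shows "mfps_line K b (mfps_of_fps i F) = Abs_fps (\<lambda>n. b i ^ n * fps_nth F n)"
proof (rule fps_ext)
  fix n :: nat
  let ?s = "Poly_Mapping.single i n"
  have keys_s: "Poly_Mapping.keys ?s \<subseteq> {i}"
    by simp
  have "(\<Sum>\<alpha>\<in>exponents_of_degree K n. mcoeff (mfps_of_fps i F) \<alpha> * monomial_value K b \<alpha>) =
      (\<Sum>\<alpha>\<in>{?s}. mcoeff (mfps_of_fps i F) \<alpha> * monomial_value K b \<alpha>)"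
  proof (rule sum.mono_neutral_right)
    show "{?s} \<subseteq> exponents_of_degree K n"
      using exponents_of_degree_single(1)[OF assms keys_s] by simp
    show "\<forall>\<alpha>\<in>exponents_of_degree K n - {?s}. mcoeff (mfps_of_fps i F) \<alpha> * monomial_value K b \<alpha> = 0"
    proof
      fix \<alpha> assume \<alpha>: "\<alpha> \<in> exponents_of_degree K n - {?s}"
      have "\<not> Poly_Mapping.keys \<alpha> \<subseteq> {i}"
      proof
        assume k: "Poly_Mapping.keys \<alpha> \<subseteq> {i}"
        then have "Poly_Mapping.lookup \<alpha> i = n"
          using exponents_of_degree_single(1)[OF assms k] \<alpha> by simp
        moreover have "Poly_Mapping.lookup \<alpha> j = 0" if "j \<noteq> i" for j
          using k that by (auto simp: in_keys_iff)
        ultimately have "\<alpha> = ?s"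
          by (intro poly_mapping_eqI) (auto simp: lookup_single when_def)
        with \<alpha> show False
          by simp
      qed
      then show "mcoeff (mfps_of_fps i F) \<alpha> * monomial_value K b \<alpha> = 0"
        by (simp add: mfps_of_fps_def)
    qed
  qed (use assms in simp)
  also have "\<dots> = fps_nth F n * monomial_value K b ?s"
    using keys_s by (simp add: mfps_of_fps_def)
  also have "\<dots> = fps_nth F n * b i ^ n"
    unfolding exponents_of_degree_single(2)[OF assms keys_s]
    by simp
  finally show "fps_nth (mfps_line K b (mfps_of_fps i F)) n =
      fps_nth (Abs_fps (\<lambda>n. b i ^ n * fps_nth F n)) n"
    by (simp add: mfps_line_def mult.commute)
qed

lemma mfps_var_eq_of_fps: "mfps_var i = mfps_of_fps i fps_X"
proof (rule mfps_eqI)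
  fix \<alpha> :: "'a \<Rightarrow>\<^sub>0 nat"
  have "\<alpha> = Poly_Mapping.single i 1 \<longleftrightarrow>
      Poly_Mapping.keys \<alpha> \<subseteq> {i} \<and> Poly_Mapping.lookup \<alpha> i = 1"
  proof safe
    assume k: "Poly_Mapping.keys \<alpha> \<subseteq> {i}" and l: "Poly_Mapping.lookup \<alpha> i = 1"
    have "Poly_Mapping.lookup \<alpha> j = 0" if "j \<noteq> i" for j
      using k that by (auto simp: in_keys_iff)
    then show "\<alpha> = Poly_Mapping.single i 1"
      using l by (intro poly_mapping_eqI) (auto simp: lookup_single when_def)
  qed (auto split: if_splits)
  then show "mcoeff (mfps_var i) \<alpha> = mcoeff (mfps_of_fps i fps_X) \<alpha>"
    by (simp add: mfps_var_def mfps_of_fps_def)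
qed

lemma mfps_line_var:
  assumes "finite K" "i \<in> K"
  shows "mfps_line K b (mfps_var i) = fps_const (b i) * fps_X"
  unfolding mfps_var_eq_of_fps mfps_line_of_fps[OF assms]
  by (rule fps_ext) (simp add: le_Suc_eq)

lemma mfps_line_const:
  assumes "finite K"
  shows "mfps_line K b (mfps_const c) = fps_const c"
proof (rule fps_ext)
  fix n :: nat
  have "(0 :: 'a \<Rightarrow>\<^sub>0 nat) \<in> exponents_of_degree K n \<longleftrightarrow> n = 0"
    by (auto simp: exponents_of_degree_def)
  moreover have "monomial_value K b (0 :: 'a \<Rightarrow>\<^sub>0 nat) = 1"
    by (simp add: monomial_value_def)
  moreover have "(\<Sum>\<alpha>\<in>exponents_of_degree K n. mcoeff (mfps_const c) \<alpha> * monomial_value K b \<alpha>) =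
      (\<Sum>\<alpha>\<in>exponents_of_degree K n \<inter> {0}. mcoeff (mfps_const c) \<alpha> * monomial_value K b \<alpha>)"
    using assms by (intro sum.mono_neutral_right) (auto simp: mfps_const_def)
  ultimately show "fps_nth (mfps_line K b (mfps_const c)) n = fps_nth (fps_const c) n"
    by (cases "n = 0") (auto simp: mfps_line_def mfps_const_def)
qed

lemma mfps_const_1: "mfps_const 1 = 1"
  by (simp add: mfps_const_def one_mfps_def)

text \<open>Both sides run over the pairs of exponents of total degree \<open>n\<close>, grouped on
  the left by their sum and on the right by the degree of the first. As degrees add and monomial
  values multiply, restriction to a line is a ring homomorphism.\<close>

lemma mfps_line_mult:
  assumes "finite K"
  shows "mfps_line K b (A * B) = mfps_line K b A * mfps_line K b B"
proof (rule fps_ext)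
  fix n
  let ?X = "exponents_of_degree K"
  let ?m = "monomial_value K b"
  let ?t = "\<lambda>\<beta> \<gamma>. (mcoeff A \<beta> * ?m \<beta>) * (mcoeff B \<gamma> * ?m \<gamma>)"
  have m: "?m (\<beta> + \<gamma>) = ?m \<beta> * ?m \<gamma>" for \<beta> \<gamma>
    by (simp add: monomial_value_def lookup_add power_add prod.distrib)
  have "fps_nth (mfps_line K b (A * B)) n =
      (\<Sum>\<alpha>\<in>?X n. \<Sum>p | fst p + snd p = \<alpha>. ?t (fst p) (snd p))"
    unfolding mfps_line_def times_mfps_def fps_nth_Abs_fps mcoeff_Abs_mfps sum_distrib_right
    by (intro sum.cong refl) (auto simp: m mult_ac)
  also have "\<dots> = (\<Sum>(\<alpha>, p)\<in>Sigma (?X n) (\<lambda>\<alpha>. {p. fst p + snd p = \<alpha>}). ?t (fst p) (snd p))"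
    using assms by (intro sum.Sigma) auto
  also have "\<dots> = (\<Sum>(i, p)\<in>Sigma {0..n} (\<lambda>i. ?X i \<times> ?X (n - i)). ?t (fst p) (snd p))"
    by (rule sum.reindex_bij_witness[where
          i = "\<lambda>(i, p). (fst p + snd p, p)" and
          j = "\<lambda>(\<alpha>, p). (\<Sum>i\<in>K. Poly_Mapping.lookup (fst p) i, p)"])
      (auto simp: exponents_of_degree_def keys_add_nat lookup_add sum.distrib)
  also have "\<dots> = (\<Sum>i=0..n. \<Sum>p\<in>?X i \<times> ?X (n - i). ?t (fst p) (snd p))"
    using assms by (intro sum.Sigma[symmetric]) auto
  also have "\<dots> = fps_nth (mfps_line K b A * mfps_line K b B) n"
    by (simp add: fps_mult_nth mfps_line_def sum_product sum.cartesian_product case_prod_unfold)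
  finally show "fps_nth (mfps_line K b (A * B)) n =
      fps_nth (mfps_line K b A * mfps_line K b B) n" .
qed

lemma mfps_line_1: "finite K \<Longrightarrow> mfps_line K b 1 = 1"
  using mfps_line_const[of K b 1] by (simp add: mfps_const_1)

lemma mfps_line_prod:
  "finite K \<Longrightarrow> mfps_line K b (\<Prod>i\<in>S. A i) = (\<Prod>i\<in>S. mfps_line K b (A i))"
  by (induction S rule: infinite_finite_induct) (simp_all add: mfps_line_mult mfps_line_1)

lemma mfps_line_power: "finite K \<Longrightarrow> mfps_line K b (A ^ n) = mfps_line K b A ^ n"
  by (induction n) (simp_all add: mfps_line_mult mfps_line_1)

section \<open>Mixed derivatives of powers of affine functions\<close>

text \<open>The \<open>j\<close>-th derivative of \<open>x\<^sup>N / N!\<close>.\<close>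

definition divided_power :: "nat \<Rightarrow> nat \<Rightarrow> real \<Rightarrow> real" where
  "divided_power N j x = (if j \<le> N then x ^ (N - j) / fact (N - j) else 0)"

definition affine_form :: "nat set \<Rightarrow> real \<Rightarrow> (nat \<Rightarrow> real) \<Rightarrow> (nat \<Rightarrow> real) \<Rightarrow> real" where
  "affine_form K a b h = a + (\<Sum>i\<in>K. b i * h i)"

lemma divided_power_has_derivative:
  "(divided_power N j has_real_derivative divided_power N (Suc j) x) (at x)"
proof (cases "j < N")
  case True
  define k where "k = N - Suc j"
  have k: "N - j = Suc k" "N - Suc j = k"
    using True by (auto simp: k_def)
  have "((\<lambda>x. x ^ Suc k / fact (Suc k)) has_real_derivative x ^ k / fact k) (at x)"
  proof -
    have "((\<lambda>x. x ^ Suc k / fact (Suc k)) has_real_derivative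
        real (Suc k) * x ^ k / fact (Suc k)) (at x)"
      by (rule DERIV_cdivide) (use DERIV_pow[of "Suc k" x] in simp)
    also have "real (Suc k) * x ^ k / fact (Suc k) = x ^ k / fact k"
      by (simp add: fact_Suc del: of_nat_Suc)
    finally show ?thesis .
  qed
  then show ?thesis
    using True k by (simp add: divided_power_def[abs_def])
next
  case False
  then have "divided_power N j = (\<lambda>x. if j \<le> N then 1 else 0)" "divided_power N (Suc j) x = 0"
    by (auto simp: divided_power_def fun_eq_iff)
  then show ?thesis
    by auto
qed

text \<open>Along the \<open>i\<close>-th coordinate each affine form has slope
  \<open>b m i\<close>. Combinations of divided powers of affine forms are thus closed under
  differentiation, with \<open>j\<close> counting the derivatives already taken.\<close>

lemma partial_deriv_divided_powers:
  assumes "finite K" "i \<in> K"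
  shows "partial_deriv i (\<lambda>h. \<Sum>m\<in>M. c m * divided_power (N m) j (affine_form K (a m) (b m) h)) =
    (\<lambda>h. \<Sum>m\<in>M. c m * b m i * divided_power (N m) (Suc j) (affine_form K (a m) (b m) h))"
proof
  fix h :: "nat \<Rightarrow> real"
  have lin: "affine_form K (a m) (b m) (h(i := t)) =
      b m i * t + affine_form (K - {i}) (a m) (b m) h" for t m
  proof -
    have "(\<Sum>k\<in>K - {i}. b m k * (h(i := t)) k) = (\<Sum>k\<in>K - {i}. b m k * h k)"
      by (intro sum.cong) auto
    then show ?thesis
      using assms by (simp add: affine_form_def sum.remove[of K i])
  qed
  have "((\<lambda>t. \<Sum>m\<in>M. c m * divided_power (N m) j (affine_form K (a m) (b m) (h(i := t))))
      has_real_derivative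
      (\<Sum>m\<in>M. c m * (divided_power (N m) (Suc j) (affine_form K (a m) (b m) (h(i := h i))) * b m i)))
      (at (h i))"
    unfolding lin
    by (intro DERIV_sum DERIV_cmult DERIV_chain2[OF divided_power_has_derivative])
      (auto intro!: derivative_eq_intros)
  then show "partial_deriv i
        (\<lambda>h. \<Sum>m\<in>M. c m * divided_power (N m) j (affine_form K (a m) (b m) h)) h =
      (\<Sum>m\<in>M. c m * b m i * divided_power (N m) (Suc j) (affine_form K (a m) (b m) h))"
    unfolding partial_deriv_def by (simp add: DERIV_imp_deriv mult_ac)
qed

lemma partial_deriv_funpow_divided_powers:
  assumes "finite K" "i \<in> K"
  shows "(partial_deriv i ^^ n)
      (\<lambda>h. \<Sum>m\<in>M. c m * divided_power (N m) j (affine_form K (a m) (b m) h)) =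
    (\<lambda>h. \<Sum>m\<in>M. c m * b m i ^ n * divided_power (N m) (j + n) (affine_form K (a m) (b m) h))"
proof (induction n)
  case (Suc n)
  then show ?case
    using partial_deriv_divided_powers[OF assms, where c = "\<lambda>m. c m * b m i ^ n" and j = "j + n"]
    by (simp add: mult_ac)
qed simp

lemma fold_partial_deriv_divided_powers:
  assumes "finite K" "set is \<subseteq> K" "distinct is"
  shows "fold (\<lambda>i. partial_deriv i ^^ \<alpha> i) is
      (\<lambda>h. \<Sum>m\<in>M. c m * divided_power (N m) j (affine_form K (a m) (b m) h)) =
    (\<lambda>h. \<Sum>m\<in>M. c m * (\<Prod>i\<in>set is. b m i ^ \<alpha> i) *
      divided_power (N m) (j + (\<Sum>i\<in>set is. \<alpha> i)) (affine_form K (a m) (b m) h))"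
  using assms(2,3)
proof (induction "is" arbitrary: c j)
  case (Cons i "is")
  then have "i \<in> K" "i \<notin> set is" "set is \<subseteq> K" "distinct is"
    by auto
  then show ?case
    using Cons.IH[where c = "\<lambda>m. c m * b m i ^ \<alpha> i" and j = "j + \<alpha> i"]
    by (simp add: partial_deriv_funpow_divided_powers[OF assms(1) \<open>i \<in> K\<close>] mult.assoc add.assoc)
qed simp

lemma mixed_deriv_divided_powers:
  "mixed_deriv d \<alpha> (\<lambda>h. \<Sum>m\<in>M. c m * divided_power (N m) 0 (affine_form {1..d} (a m) (b m) h)) h =
    (\<Sum>m\<in>M. c m * monomial_value {1..d} (b m) \<alpha> *
      divided_power (N m) (\<Sum>i=1..d. Poly_Mapping.lookup \<alpha> i) (affine_form {1..d} (a m) (b m) h))"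
proof -
  have s: "set [1..<Suc d] = {1..d}"
    by auto
  have "set [1..<Suc d] \<subseteq> {1..d}"
    by auto
  from fold_partial_deriv_divided_powers[OF _ this, where \<alpha> = "Poly_Mapping.lookup \<alpha>" and j = 0
      and c = c and M = M and N = N and a = a and b = b]
  show ?thesis
    unfolding mixed_deriv_def s monomial_value_def by (simp del: upt_Suc)
qed

text \<open>A neighbourhood of \<open>0\<close> in the relevant coordinates only. The others are
  unrestricted, so a small change of any single coordinate stays in the set.\<close>

definition parameter_box :: "nat \<Rightarrow> real \<Rightarrow> (nat \<Rightarrow> real) set" where
  "parameter_box d \<epsilon> = {h. \<forall>i\<in>{1..d}. \<bar>h i\<bar> < \<epsilon>}"

lemma partial_deriv_cong_box:
  assumes "\<And>h. h \<in> parameter_box d \<epsilon> \<Longrightarrow> g h = g' h" "h \<in> parameter_box d \<epsilon>"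
  shows "partial_deriv i g h = partial_deriv i g' h"
proof -
  have "h i \<in> (if i \<in> {1..d} then {-\<epsilon><..<\<epsilon>} else UNIV)"
    using assms(2) by (auto simp: parameter_box_def abs_less_iff minus_less_iff)
  moreover have "open (if i \<in> {1..d} then {-\<epsilon><..<\<epsilon>} else UNIV)"
    by simp
  ultimately have "eventually (\<lambda>t. t \<in> (if i \<in> {1..d} then {-\<epsilon><..<\<epsilon>} else UNIV)) (nhds (h i))"
    by (intro eventually_nhds_in_open)
  then have "eventually (\<lambda>t. g (h(i := t)) = g' (h(i := t))) (nhds (h i))"
  proof eventually_elim
    case (elim t)
    then have "h(i := t) \<in> parameter_box d \<epsilon>"
      using assms(2) by (auto simp: parameter_box_def split: if_splits)
    then show ?case
      by (rule assms(1))
  qed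
  then show ?thesis
    unfolding partial_deriv_def by (rule deriv_cong_ev) simp
qed

text \<open>A partial derivative at a point of the box sees only nearby points of the box, so it is
  equality on the whole box that is carried through the successive derivatives.\<close>

lemma mixed_deriv_cong_box:
  assumes "\<And>h. h \<in> parameter_box d \<epsilon> \<Longrightarrow> g h = g' h" "h \<in> parameter_box d \<epsilon>"
  shows "mixed_deriv d \<alpha> g h = mixed_deriv d \<alpha> g' h"
proof -
  have pow: "\<forall>h\<in>parameter_box d \<epsilon>. (partial_deriv i ^^ n) g h = (partial_deriv i ^^ n) g' h"
    if "\<forall>h\<in>parameter_box d \<epsilon>. g h = g' h" for i n g g'
    using that by (induction n) (auto intro: partial_deriv_cong_box)
  have "\<forall>h\<in>parameter_box d \<epsilon>. fold (\<lambda>i. partial_deriv i ^^ Poly_Mapping.lookup \<alpha> i) is g h =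
      fold (\<lambda>i. partial_deriv i ^^ Poly_Mapping.lookup \<alpha> i) is g' h"
    if "\<forall>h\<in>parameter_box d \<epsilon>. g h = g' h" for "is" g g'
    using that by (induction "is" arbitrary: g g') (simp_all add: pow)
  then show ?thesis
    using assms unfolding mixed_deriv_def by blast
qed

text \<open>The exponential of \<open>t\<close> times an affine form is a common eigenfunction of
  the partial derivatives, with eigenvalues \<open>b m i * t\<close>, so a series in them multiplies
  it by the restriction of the series to a line. The formula is the coefficient of
  \<open>t ^ N m\<close> at \<open>h = 0\<close>.\<close>

lemma series_integral_divided_powers:
  fixes L :: "'a::euclidean_space set"
  assumes "\<epsilon> > 0" "finite M"
    and eq: "\<And>h. h \<in> parameter_box d \<epsilon> \<Longrightarrow>
      (LINT x:shifted_polytope d u \<kappa> h|lattice_measure L. f x) =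
      (\<Sum>m\<in>M. c m * divided_power (N m) 0 (affine_form {1..d} (a m) (b m) h))"
  shows "series_integral L d u \<kappa> A f =
    (\<Sum>m\<in>M. c m * fps_nth (mfps_line {1..d} (b m) A * fps_exp (a m)) (N m))"
proof -
  let ?K = "{1..d}"
  let ?deg = "\<lambda>\<alpha>. \<Sum>i\<in>?K. Poly_Mapping.lookup \<alpha> i"
  let ?t = "\<lambda>m \<alpha>. mcoeff A \<alpha> * monomial_value ?K (b m) \<alpha> * divided_power (N m) (?deg \<alpha>) (a m)"
  define S where "S = {\<alpha> :: nat \<Rightarrow>\<^sub>0 nat. Poly_Mapping.keys \<alpha> \<subseteq> ?K}"
  \<comment> \<open>Derivatives of order above every \<open>N m\<close> vanish, so the infinite sum
    lives on this finite set; \<open>0\<close> is inserted for the case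
    \<open>M = {}\<close>.\<close>
  define S' where "S' = (\<Union>j\<le>Max (insert 0 (N ` M)). exponents_of_degree ?K j)"
  have fin: "finite S'"
    by (auto simp: S'_def)
  have "S' \<subseteq> S"
    by (auto simp: S_def S'_def exponents_of_degree_def)
  have N_le: "N m \<le> Max (insert 0 (N ` M))" if "m \<in> M" for m
    using that assms(2) by (intro Max_ge) auto
  have out: "?t m \<alpha> = 0" if "m \<in> M" "\<alpha> \<in> S - S'" for m \<alpha>
  proof -
    have "?deg \<alpha> > Max (insert 0 (N ` M))"
      using that(2) by (auto simp: S_def S'_def exponents_of_degree_def not_le[symmetric])
    then show ?thesis
      using N_le[OF that(1)] by (simp add: divided_power_def)
  qed
  have md: "mixed_deriv d \<alpha> (\<lambda>h. LINT x:shifted_polytope d u \<kappa> h|lattice_measure L. f x) (\<lambda>_. 0) =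
     (\<Sum>m\<in>M. c m * monomial_value ?K (b m) \<alpha> * divided_power (N m) (?deg \<alpha>) (a m))" for \<alpha>
  proof -
    have 0: "(\<lambda>_. 0) \<in> parameter_box d \<epsilon>"
      using assms(1) by (simp add: parameter_box_def)
    have "mixed_deriv d \<alpha> (\<lambda>h. LINT x:shifted_polytope d u \<kappa> h|lattice_measure L. f x) (\<lambda>_. 0) =
      mixed_deriv d \<alpha>
        (\<lambda>h. \<Sum>m\<in>M. c m * divided_power (N m) 0 (affine_form ?K (a m) (b m) h)) (\<lambda>_. 0)"
      by (rule mixed_deriv_cong_box[OF eq 0])
    then show ?thesis
      unfolding mixed_deriv_divided_powers by (simp add: affine_form_def)
  qed
  have "series_integral L d u \<kappa> A f = (\<Sum>\<^sub>\<infinity>\<alpha>\<in>S. \<Sum>m\<in>M. c m * ?t m \<alpha>)"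
    unfolding series_integral_def md S_def sum_distrib_left
    by (intro infsum_cong sum.cong refl) (simp add: mult_ac)
  also have "\<dots> = (\<Sum>\<^sub>\<infinity>\<alpha>\<in>S'. \<Sum>m\<in>M. c m * ?t m \<alpha>)"
  proof (rule infsum_cong_neutral)
    fix \<alpha> assume "\<alpha> \<in> S - S'"
    then have "?t m \<alpha> = 0" if "m \<in> M" for m
      using out that by blast
    then show "(\<Sum>m\<in>M. c m * ?t m \<alpha>) = 0"
      by (intro sum.neutral ballI) (simp only: mult_zero_right)
  qed (use \<open>S' \<subseteq> S\<close> in auto)
  also have "\<dots> = (\<Sum>m\<in>M. c m * (\<Sum>\<alpha>\<in>S'. ?t m \<alpha>))"
    unfolding infsum_finite[OF fin] sum_distrib_left by (rule sum.swap)
  also have "\<dots> = (\<Sum>m\<in>M. c m * fps_nth (mfps_line ?K (b m) A * fps_exp (a m)) (N m))"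
  proof (rule sum.cong[OF refl])
    fix m assume m: "m \<in> M"
    have "(\<Sum>\<alpha>\<in>S'. ?t m \<alpha>) = (\<Sum>\<alpha>\<in>(\<Union>j\<le>N m. exponents_of_degree ?K j). ?t m \<alpha>)"
    proof (rule sum.mono_neutral_right[OF fin])
      show "(\<Union>j\<le>N m. exponents_of_degree ?K j) \<subseteq> S'"
        unfolding S'_def using N_le[OF m] by (intro UN_mono) (auto simp del: Max_insert)
      show "\<forall>\<alpha>\<in>S' - (\<Union>j\<le>N m. exponents_of_degree ?K j). ?t m \<alpha> = 0"
        unfolding S'_def exponents_of_degree_def divided_power_def by (auto simp del: Max_insert)
    qed
    also have "\<dots> = (\<Sum>j\<le>N m. \<Sum>\<alpha>\<in>exponents_of_degree ?K j. ?t m \<alpha>)"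
      by (rule sum.UNION_disjoint) (simp_all, auto simp: exponents_of_degree_def)
    also have "\<dots> = (\<Sum>j\<le>N m. fps_nth (mfps_line ?K (b m) A) j * (a m ^ (N m - j) / fact (N m - j)))"
    proof (rule sum.cong[OF refl])
      fix j assume j: "j \<in> {..N m}"
      have "(\<Sum>\<alpha>\<in>exponents_of_degree ?K j. ?t m \<alpha>) = (\<Sum>\<alpha>\<in>exponents_of_degree ?K j.
          mcoeff A \<alpha> * monomial_value ?K (b m) \<alpha> * (a m ^ (N m - j) / fact (N m - j)))"
        using j by (intro sum.cong refl) (simp add: divided_power_def exponents_of_degree_def)
      then show "(\<Sum>\<alpha>\<in>exponents_of_degree ?K j. ?t m \<alpha>) =
          fps_nth (mfps_line ?K (b m) A) j * (a m ^ (N m - j) / fact (N m - j))"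
        by (simp only: mfps_line_def fps_nth_Abs_fps sum_distrib_right)
    qed
    also have "\<dots> = fps_nth (mfps_line ?K (b m) A * fps_exp (a m)) (N m)"
      by (simp add: fps_mult_nth atMost_atLeast0)
    finally show "c m * (\<Sum>\<alpha>\<in>S'. ?t m \<alpha>) =
        c m * fps_nth (mfps_line ?K (b m) A * fps_exp (a m)) (N m)"
      by simp
  qed
  finally show ?thesis .
qed

section \<open>Signed decomposition of a simple polytope into cones\<close>

text \<open>This is the expansion of \<open>(- 1 + 1) ^ card (B - A)\<close> over the subsets of
  \<open>B - A\<close>.\<close>

lemma alternating_sum_between:
  assumes "finite B"
  shows "(\<Sum>J | A \<subseteq> J \<and> J \<subseteq> B. (- 1 :: real) ^ card J) = (if A = B then (- 1) ^ card A else 0)"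
proof (cases "A \<subseteq> B")
  case False
  then have "{J. A \<subseteq> J \<and> J \<subseteq> B} = {}" "A \<noteq> B"
    by auto
  then show ?thesis
    by (simp only: sum.empty if_False)
next
  case True
  then have fin: "finite A" "finite (B - A)"
    using assms finite_subset by auto
  have "(\<Sum>J | A \<subseteq> J \<and> J \<subseteq> B. (- 1 :: real) ^ card J) =
      (\<Sum>J\<in>Pow (B - A). (- 1) ^ card (A \<union> J))"
    by (rule sum.reindex_bij_witness[where i = "\<lambda>J. A \<union> J" and j = "\<lambda>J. J - A"])
      (use True in \<open>auto simp: Un_absorb1\<close>)
  also have "\<dots> = (\<Sum>J\<in>Pow (B - A). (- 1) ^ card A * (\<Prod>i\<in>J. - 1) * (\<Prod>i\<in>B - A - J. 1))"
  proof (rule sum.cong[OF refl])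
    fix J assume "J \<in> Pow (B - A)"
    then have "card (A \<union> J) = card A + card J"
      using fin finite_subset by (intro card_Un_disjoint) auto
    then show "(- 1 :: real) ^ card (A \<union> J) = (- 1) ^ card A * (\<Prod>i\<in>J. - 1) * (\<Prod>i\<in>B - A - J. 1)"
      by (simp add: power_add)
  qed
  also have "\<dots> = (- 1) ^ card A * (\<Prod>i\<in>B - A. - 1 + 1)"
    unfolding prod_add[OF fin(2)] by (simp only: sum_distrib_left mult.assoc)
  also have "\<dots> = (if A = B then (- 1) ^ card A else 0)"
    using True fin by (auto simp: power_0_left card_eq_0_iff)
  finally show ?thesis .
qed

text \<open>A hyperplane has empty interior, so removing the hyperplanes orthogonal to the elements
  of \<open>W\<close> one at a time leaves a nonempty open set at each stage.\<close>

lemma exists_nonorthogonal: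
  fixes W :: "'a::euclidean_space set"
  assumes "finite W" "0 \<notin> W" "open U" "U \<noteq> {}"
  shows "\<exists>\<xi>\<in>U. \<forall>a\<in>W. \<xi> \<bullet> a \<noteq> 0"
  using assms
proof (induction W arbitrary: U)
  case empty
  then show ?case
    by auto
next
  case (insert a W)
  have a: "a \<noteq> 0"
    using insert.prems by auto
  define U' where "U' = U \<inter> {\<xi>. a \<bullet> \<xi> \<noteq> 0}"
  have "open {\<xi>. a \<bullet> \<xi> \<noteq> 0}"
    by (intro open_Collect_neq continuous_intros)
  then have "open U'"
    using insert.prems by (auto simp: U'_def)
  moreover have "U' \<noteq> {}"
  proof
    assume "U' = {}"
    then have "U \<subseteq> {\<xi>. a \<bullet> \<xi> = 0}"
      by (auto simp: U'_def)
    then have "U \<subseteq> interior {\<xi>. a \<bullet> \<xi> = 0}"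
      using insert.prems by (intro interior_maximal)
    then show False
      using a insert.prems by (simp add: interior_hyperplane)
  qed
  ultimately obtain \<xi> where "\<xi> \<in> U'" "\<forall>b\<in>W. \<xi> \<bullet> b \<noteq> 0"
    using insert.IH[of U'] insert.prems by auto
  then show ?case
    by (intro bexI[of _ \<xi>]) (auto simp: U'_def inner_commute)
qed

definition halfspace_polyhedron ::
    "'i set \<Rightarrow> ('i \<Rightarrow> 'a::euclidean_space) \<Rightarrow> ('i \<Rightarrow> real) \<Rightarrow> 'a set" where
  "halfspace_polyhedron I u \<kappa> = {x. \<forall>i\<in>I. 0 \<le> u i \<bullet> x + \<kappa> i}"

lemma polyhedron_halfspace_polyhedron:
  assumes "finite I"
  shows "polyhedron (halfspace_polyhedron I u \<kappa>)"
proof -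
  have "halfspace_polyhedron I u \<kappa> = \<Inter>((\<lambda>i. {x. u i \<bullet> x \<ge> - \<kappa> i}) ` I)"
    by (auto simp: halfspace_polyhedron_def) (smt (verit))+
  then show ?thesis
    using assms by (auto intro!: polyhedron_Inter polyhedron_halfspace_ge)
qed

lemma halfspace_slack_direction:
  assumes "finite I" "z \<in> halfspace_polyhedron I u \<kappa>"
  shows "\<exists>\<epsilon>>0. \<forall>i\<in>I - {i. u i \<bullet> z + \<kappa> i = 0}. 0 < u i \<bullet> (z + \<epsilon> *\<^sub>R y) + \<kappa> i"
proof -
  let ?S = "I - {i. u i \<bullet> z + \<kappa> i = 0}"
  have "\<forall>\<^sub>F \<epsilon> in at_right (0::real). 0 < u i \<bullet> (z + \<epsilon> *\<^sub>R y) + \<kappa> i" if "i \<in> ?S" for i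
  proof -
    have "((\<lambda>\<epsilon>. u i \<bullet> (z + \<epsilon> *\<^sub>R y) + \<kappa> i) \<longlongrightarrow> u i \<bullet> (z + 0 *\<^sub>R y) + \<kappa> i) (at_right 0)"
      by (intro tendsto_intros)
    moreover have "0 < u i \<bullet> (z + 0 *\<^sub>R y) + \<kappa> i"
      using assms that by (auto simp: halfspace_polyhedron_def less_le)
    ultimately show ?thesis
      by (rule order_tendstoD)
  qed
  then have "\<forall>\<^sub>F \<epsilon> in at_right (0::real). \<forall>i\<in>?S. 0 < u i \<bullet> (z + \<epsilon> *\<^sub>R y) + \<kappa> i"
    using assms(1) by (intro eventually_ball_finite) auto
  then have "\<forall>\<^sub>F \<epsilon> in at_right (0::real). 0 < \<epsilon> \<and> (\<forall>i\<in>?S. 0 < u i \<bullet> (z + \<epsilon> *\<^sub>R y) + \<kappa> i)"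
    using eventually_at_right_less by (rule eventually_conj[rotated])
  then show ?thesis
    using eventually_happens' trivial_limit_at_right_real by blast
qed

text \<open>\<open>w z\<close> is the basis dual to the normals active at \<open>z\<close>: moving
  along \<open>w z i\<close> leaves the \<open>i\<close>-th facet and stays on the other facets
  through \<open>z\<close>, so these vectors are the edge directions.\<close>

locale simple_polytope =
  fixes I :: "'i set"
    and u :: "'i \<Rightarrow> 'a::euclidean_space"
    and \<kappa> :: "'i \<Rightarrow> real"
    and w :: "'a \<Rightarrow> 'i \<Rightarrow> 'a"
    and P V active
  defines "P \<equiv> halfspace_polyhedron I u \<kappa>"
    and "V \<equiv> {z. z extreme_point_of P}"
    and "active \<equiv> \<lambda>z. {i \<in> I. u i \<bullet> z + \<kappa> i = 0}"
  assumes finite_I: "finite I"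
    and bounded_P: "bounded P"
    and P_nonempty: "P \<noteq> {}"
    and card_active: "z \<in> V \<Longrightarrow> card (active z) = DIM('a)"
    and dual: "z \<in> V \<Longrightarrow> i \<in> active z \<Longrightarrow> j \<in> active z \<Longrightarrow> u i \<bullet> w z j = (if i = j then 1 else 0)"
begin

lemma polyhedron_P: "polyhedron P"
  unfolding P_def by (rule polyhedron_halfspace_polyhedron[OF finite_I])

lemma compact_P: "compact P"
  using polyhedron_imp_closed[OF polyhedron_P] bounded_P by (simp add: compact_eq_bounded_closed)

lemma convex_P: "convex P"
  by (rule polyhedron_imp_convex[OF polyhedron_P])

lemma finite_V: "finite V"
  unfolding V_def by (rule finite_polyhedron_extreme_points[OF polyhedron_P])

lemma V_nonempty: "V \<noteq> {}"
  using extreme_point_exists_convex[OF compact_P convex_P P_nonempty] by (auto simp: V_def)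

lemma V_subset: "V \<subseteq> P"
  by (auto simp: V_def extreme_point_of_def)

lemma finite_active [simp]: "finite (active z)"
  using finite_I by (simp add: active_def)

lemma active_subset: "active z \<subseteq> I"
  by (auto simp: active_def)

lemma activeD: "i \<in> active z \<Longrightarrow> u i \<bullet> z = - \<kappa> i"
  by (simp add: active_def)

lemma in_P_iff: "x \<in> P \<longleftrightarrow> (\<forall>i\<in>I. 0 \<le> u i \<bullet> x + \<kappa> i)"
  by (simp add: P_def halfspace_polyhedron_def)

section \<open>Dual bases at the vertices\<close>

lemma inj_on_w:
  assumes "z \<in> V"
  shows "inj_on (w z) (active z)"
  using dual[OF assms] by (intro inj_onI) (metis zero_neq_one)

lemma inner_w_combination:
  assumes "z \<in> V" "i \<in> active z"
  shows "u i \<bullet> (\<Sum>j\<in>active z. c j *\<^sub>R w z j) = c i"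
proof -
  have "u i \<bullet> (\<Sum>j\<in>active z. c j *\<^sub>R w z j) = (\<Sum>j\<in>active z. if i = j then c j else 0)"
    using assms unfolding inner_sum_right
    by (intro sum.cong refl) (simp add: dual)
  also have "\<dots> = c i"
    using assms by simp
  finally show ?thesis .
qed

lemma w_basis:
  assumes "z \<in> V"
  shows "independent (w z ` active z)" "span (w z ` active z) = UNIV"
proof -
  show ind: "independent (w z ` active z)"
  proof (rule independent_if_scalars_zero)
    fix f b
    assume sum0: "(\<Sum>a\<in>w z ` active z. f a *\<^sub>R a) = 0" and "b \<in> w z ` active z"
    then obtain i where i: "i \<in> active z" "b = w z i"
      by auto
    have "(\<Sum>j\<in>active z. f (w z j) *\<^sub>R w z j) = 0"
      using sum0 by (simp add: sum.reindex[OF inj_on_w[OF assms]])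
    then show "f b = 0"
      using inner_w_combination[OF assms i(1), of "\<lambda>j. f (w z j)"] i(2) by simp
  qed simp
  have "card (w z ` active z) = DIM('a)"
    using card_image[OF inj_on_w[OF assms]] card_active[OF assms] by simp
  then have "UNIV \<subseteq> span (w z ` active z)"
    by (intro card_ge_dim_independent ind) auto
  then show "span (w z ` active z) = UNIV"
    by auto
qed

lemma expand:
  assumes "z \<in> V"
  shows "y = (\<Sum>i\<in>active z. (u i \<bullet> y) *\<^sub>R w z i)"
proof -
  have "y \<in> span (w z ` active z)"
    using w_basis[OF assms] by simp
  then obtain c where "y = (\<Sum>a\<in>w z ` active z. c a *\<^sub>R a)"
    unfolding span_finite[OF finite_imageI[OF finite_active]] by auto
  then have y: "y = (\<Sum>i\<in>active z. c (w z i) *\<^sub>R w z i)"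
    by (simp add: sum.reindex[OF inj_on_w[OF assms]])
  have "u i \<bullet> y = c (w z i)" if "i \<in> active z" for i
    unfolding y using inner_w_combination[OF assms that, of "\<lambda>i. c (w z i)"] by simp
  then show ?thesis
    using y by simp
qed

lemma w_nonzero: "z \<in> V \<Longrightarrow> i \<in> active z \<Longrightarrow> w z i \<noteq> 0"
  using dual[of z i i] by auto

lemma slack_direction:
  assumes "z \<in> P"
  shows "\<exists>\<epsilon>>0. \<forall>i\<in>I - active z. 0 < u i \<bullet> (z + \<epsilon> *\<^sub>R y) + \<kappa> i"
proof -
  have "I - active z = I - {i. u i \<bullet> z + \<kappa> i = 0}"
    by (auto simp: active_def)
  then show ?thesis
    using halfspace_slack_direction[OF finite_I] assms by (simp add: P_def)
qed

lemma edge_direction: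
  assumes "z \<in> V" "i \<in> active z"
  obtains \<epsilon> where "\<epsilon> > 0" "z + \<epsilon> *\<^sub>R w z i \<in> P"
    "\<And>j. j \<in> active z - {i} \<Longrightarrow> u j \<bullet> (z + \<epsilon> *\<^sub>R w z i) + \<kappa> j = 0"
    "u i \<bullet> (z + \<epsilon> *\<^sub>R w z i) + \<kappa> i > 0"
proof -
  obtain \<epsilon> where \<epsilon>: "\<epsilon> > 0" "\<forall>j\<in>I - active z. 0 < u j \<bullet> (z + \<epsilon> *\<^sub>R w z i) + \<kappa> j"
    using slack_direction V_subset assms(1) by blast
  have act: "u j \<bullet> (z + \<epsilon> *\<^sub>R w z i) + \<kappa> j = (if i = j then \<epsilon> else 0)" if "j \<in> active z" for j
    using that assms dual[OF assms(1) that assms(2)] activeD[OF that]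
    by (auto simp: inner_add_right)
  have "0 \<le> u j \<bullet> (z + \<epsilon> *\<^sub>R w z i) + \<kappa> j" if "j \<in> I" for j
  proof (cases "j \<in> active z")
    case True
    then show ?thesis
      using act \<epsilon>(1) by simp
  next
    case False
    then show ?thesis
      using \<epsilon>(2) that by (simp add: less_imp_le)
  qed
  then have "z + \<epsilon> *\<^sub>R w z i \<in> P"
    by (simp add: in_P_iff)
  then show thesis
    using that[of \<epsilon>] \<epsilon>(1) act assms(2) by (metis DiffD1 DiffD2 insertCI)
qed

section \<open>Generic linear forms and their maxima on faces\<close>

definition generic :: "'a \<Rightarrow> bool" where
  "generic \<xi> \<longleftrightarrow> (\<forall>z\<in>V. \<forall>i\<in>active z. \<xi> \<bullet> w z i \<noteq> 0)"

text \<open>The edges to be flipped: along them \<open>exp (\<xi> \<bullet> x)\<close>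
  grows.\<close>

definition increasing :: "'a \<Rightarrow> 'a \<Rightarrow> 'i set" where
  "increasing \<xi> z = {i \<in> active z. \<xi> \<bullet> w z i > 0}"

lemma exists_generic:
  assumes "open U" "U \<noteq> {}"
  shows "\<exists>\<xi>\<in>U. generic \<xi>"
proof -
  have "\<exists>\<xi>\<in>U. \<forall>a\<in>(\<Union>z\<in>V. w z ` active z). \<xi> \<bullet> a \<noteq> 0"
    using assms finite_V w_nonzero by (intro exists_nonorthogonal) auto
  then show ?thesis
    by (auto simp: generic_def)
qed

text \<open>In the coordinates \<open>s i\<close> at \<open>z\<close>, the value
  \<open>\<xi> \<bullet> (y - z)\<close> is a sum of terms that are at most \<open>0\<close>: the
  slack vanishes for \<open>i\<close> in \<open>J\<close>, and for the other indices the edge is not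
  increasing. By genericity, equality forces every slack to vanish.\<close>

lemma face_maximum:
  assumes "generic \<xi>" "z \<in> V" "increasing \<xi> z \<subseteq> J" "J \<subseteq> active z"
    and y: "y \<in> P" "\<And>j. j \<in> J \<Longrightarrow> u j \<bullet> y + \<kappa> j = 0"
  shows "\<xi> \<bullet> y \<le> \<xi> \<bullet> z" "\<xi> \<bullet> y = \<xi> \<bullet> z \<Longrightarrow> y = z"
proof -
  define s where "s i = u i \<bullet> y + \<kappa> i" for i
  have s: "u i \<bullet> (y - z) = s i" if "i \<in> active z" for i
    using activeD[OF that] by (simp add: s_def inner_diff_right)
  have yz: "y - z = (\<Sum>i\<in>active z. s i *\<^sub>R w z i)"
    using expand[OF assms(2), of "y - z"] s by simp
  have "\<xi> \<bullet> (y - z) = (\<Sum>i\<in>active z. s i * (\<xi> \<bullet> w z i))"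
    unfolding yz by (simp add: inner_sum_right)
  moreover have nonpos: "s i * (\<xi> \<bullet> w z i) \<le> 0" if "i \<in> active z" for i
  proof (cases "i \<in> J")
    case True
    then show ?thesis
      using y(2) by (simp add: s_def)
  next
    case False
    then have "\<xi> \<bullet> w z i \<le> 0" "0 \<le> s i"
      using assms(3) that y(1) active_subset by (auto simp: increasing_def in_P_iff s_def)
    then show ?thesis
      by (simp add: mult_nonneg_nonpos)
  qed
  ultimately have eq: "\<xi> \<bullet> y - \<xi> \<bullet> z = (\<Sum>i\<in>active z. s i * (\<xi> \<bullet> w z i))"
    by (simp add: inner_diff_right)
  show "\<xi> \<bullet> y \<le> \<xi> \<bullet> z"
    using eq sum_nonpos[of "active z" "\<lambda>i. s i * (\<xi> \<bullet> w z i)"] nonpos by simp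
  assume "\<xi> \<bullet> y = \<xi> \<bullet> z"
  then have "(\<Sum>i\<in>active z. - (s i * (\<xi> \<bullet> w z i))) = 0"
    using eq by (simp add: sum_negf)
  then have "\<forall>i\<in>active z. - (s i * (\<xi> \<bullet> w z i)) = 0"
    by (subst (asm) sum_nonneg_eq_0_iff) (use nonpos in auto)
  then have "\<forall>i\<in>active z. s i = 0"
    using assms(1,2) by (auto simp: generic_def)
  then show "y = z"
    using yz by simp
qed

text \<open>On \<open>P\<close> the slacks are nonnegative, so they vanish together exactly when
  their sum does, and the sum of the inequalities gives one supporting hyperplane.\<close>

lemma tight_face:
  assumes "J \<subseteq> I"
  shows "{x \<in> P. \<forall>j\<in>J. u j \<bullet> x + \<kappa> j = 0} face_of P"
proof -
  have J: "finite J"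
    using assms finite_I finite_subset by blast
  have sum_eq: "(\<Sum>j\<in>J. u j) \<bullet> x + (\<Sum>j\<in>J. \<kappa> j) = (\<Sum>j\<in>J. u j \<bullet> x + \<kappa> j)" for x
    by (simp add: inner_sum_left sum.distrib)
  have "P \<inter> {x. (\<Sum>j\<in>J. u j) \<bullet> x = - (\<Sum>j\<in>J. \<kappa> j)} face_of P"
  proof (rule face_of_Int_supporting_hyperplane_ge[OF convex_P])
    fix x assume "x \<in> P"
    then have "0 \<le> (\<Sum>j\<in>J. u j \<bullet> x + \<kappa> j)"
      using assms by (intro sum_nonneg) (auto simp: in_P_iff)
    then show "(\<Sum>j\<in>J. u j) \<bullet> x \<ge> - (\<Sum>j\<in>J. \<kappa> j)"
      using sum_eq[of x] by simp
  qed
  also have "P \<inter> {x. (\<Sum>j\<in>J. u j) \<bullet> x = - (\<Sum>j\<in>J. \<kappa> j)} = {x \<in> P. \<forall>j\<in>J. u j \<bullet> x + \<kappa> j = 0}"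
  proof (rule set_eqI)
    fix x
    show "x \<in> P \<inter> {x. (\<Sum>j\<in>J. u j) \<bullet> x = - (\<Sum>j\<in>J. \<kappa> j)} \<longleftrightarrow>
        x \<in> {x \<in> P. \<forall>j\<in>J. u j \<bullet> x + \<kappa> j = 0}"
    proof (cases "x \<in> P")
      case True
      then have "(\<Sum>j\<in>J. u j \<bullet> x + \<kappa> j) = 0 \<longleftrightarrow> (\<forall>j\<in>J. u j \<bullet> x + \<kappa> j = 0)"
        using J assms by (intro sum_nonneg_eq_0_iff) (auto simp: in_P_iff)
      then show ?thesis
        using sum_eq[of x] True by (auto simp: add_eq_0_iff2)
    qed simp
  qed
  finally show ?thesis .
qed

text \<open>\<open>J\<close> cuts out a face, nonempty since it contains \<open>z\<^sub>0\<close>,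
  and the vertex sought is where \<open>\<xi>\<close> is maximal on it. The two inclusions say that
  \<open>z\<close> lies on this face and that no edge of the face goes up from
  \<open>z\<close>.\<close>

lemma unique_face_maximum:
  assumes "generic \<xi>" "z\<^sub>0 \<in> V" "J \<subseteq> active z\<^sub>0"
  shows "\<exists>!z. z \<in> V \<and> increasing \<xi> z \<subseteq> J \<and> J \<subseteq> active z"
proof -
  have J: "finite J" "J \<subseteq> I"
    using assms(3) active_subset finite_subset[OF _ finite_active] by blast+
  define F where "F = {x \<in> P. \<forall>j\<in>J. u j \<bullet> x + \<kappa> j = 0}"
  have F_iff: "x \<in> F \<longleftrightarrow> x \<in> P \<and> (\<forall>j\<in>J. u j \<bullet> x + \<kappa> j = 0)" for x
    by (simp add: F_def)
  have "F face_of P"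
    unfolding F_def by (rule tight_face[OF J(2)])
  then have F: "compact F" "convex F"
    using face_of_imp_compact[OF convex_P compact_P] face_of_imp_convex by blast+
  have "z\<^sub>0 \<in> F"
    using assms V_subset activeD by (fastforce simp: F_iff)
  then obtain y where y: "y \<in> F" "\<And>x. x \<in> F \<Longrightarrow> \<xi> \<bullet> x \<le> \<xi> \<bullet> y"
    using continuous_attains_sup[OF F(1), of "\<lambda>x. \<xi> \<bullet> x"] continuous_on_inner[OF continuous_on_const continuous_on_id]
    by blast
  \<comment> \<open>The maximizers form a face of a face, so an extreme point of \<open>G\<close> is
    a vertex of \<open>P\<close>.\<close>
  define G where "G = F \<inter> {x. \<xi> \<bullet> x = \<xi> \<bullet> y}"
  have "G face_of F"
    unfolding G_def by (rule face_of_Int_supporting_hyperplane_le[OF F(2)]) (use y in auto)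
  then have G: "G face_of P" "compact G" "convex G"
    using \<open>F face_of P\<close> face_of_trans face_of_imp_compact[OF F(2) F(1)] face_of_imp_convex
    by blast+
  obtain z where "z extreme_point_of G"
    using extreme_point_exists_convex[OF G(2,3)] y(1) by (auto simp: G_def)
  then have z: "z \<in> G" "z \<in> V"
    using extreme_point_of_face[OF G(1)] by (auto simp: V_def extreme_point_of_def)
  have "J \<subseteq> active z"
    using z(1) J by (auto simp: G_def F_iff active_def)
  moreover have "i \<in> J" if i: "i \<in> increasing \<xi> z" for i
  proof (rule ccontr)
    assume "i \<notin> J"
    from i have ia: "i \<in> active z" "\<xi> \<bullet> w z i > 0"
      by (auto simp: increasing_def)
    obtain \<epsilon> where \<epsilon>: "\<epsilon> > 0" "z + \<epsilon> *\<^sub>R w z i \<in> P"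
      "\<And>j. j \<in> active z - {i} \<Longrightarrow> u j \<bullet> (z + \<epsilon> *\<^sub>R w z i) + \<kappa> j = 0"
      using edge_direction[OF z(2) ia(1)] by metis
    have "z + \<epsilon> *\<^sub>R w z i \<in> F"
      using \<epsilon> \<open>i \<notin> J\<close> \<open>J \<subseteq> active z\<close> by (auto simp: F_iff)
    then have "\<xi> \<bullet> (z + \<epsilon> *\<^sub>R w z i) \<le> \<xi> \<bullet> z"
      using y(2) z(1) by (auto simp: G_def)
    then show False
      using \<epsilon>(1) ia(2) by (simp add: inner_add_right mult_le_0_iff)
  qed
  ultimately have ex: "z \<in> V \<and> increasing \<xi> z \<subseteq> J \<and> J \<subseteq> active z"
    using z by auto
  moreover have "z' = z"
    if z': "z' \<in> V \<and> increasing \<xi> z' \<subseteq> J \<and> J \<subseteq> active z'" for z'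
  proof -
    have "z' \<in> P" "z \<in> P" "\<And>j. j \<in> J \<Longrightarrow> u j \<bullet> z' + \<kappa> j = 0" "\<And>j. j \<in> J \<Longrightarrow> u j \<bullet> z + \<kappa> j = 0"
      using z' ex V_subset by (auto simp: active_def)
    then show ?thesis
      using face_maximum[OF assms(1), of z J z'] face_maximum[OF assms(1), of z' J z] ex z'
      by (metis order_antisym)
  qed
  ultimately show ?thesis
    by blast
qed

text \<open>Minus the reduced Euler characteristic of the subcomplex induced on \<open>N\<close> by
  the complex whose simplices are the subsets of the sets \<open>active z\<close>; the empty simplex
  contributes \<open>1\<close>.\<close>

definition euler :: "'i set \<Rightarrow> real" where
  "euler N = (\<Sum>J | J \<subseteq> N \<and> (\<exists>z\<in>V. J \<subseteq> active z). (- 1) ^ card J)"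

text \<open>The left-hand side does not depend on \<open>\<xi>\<close>, so the direction of flipping may be adapted to
  the point at which the signed sum is evaluated.\<close>

lemma euler_eq:
  assumes "generic \<xi>" "N \<subseteq> I"
  shows "euler N = (\<Sum>z\<in>V. if increasing \<xi> z = N \<inter> active z then (- 1) ^ card (increasing \<xi> z) else 0)"
proof -
  let ?S = "\<lambda>z. {J. increasing \<xi> z \<subseteq> J \<and> J \<subseteq> N \<inter> active z}"
  have fin: "finite (?S z)" for z
    by (rule finite_subset[of _ "Pow (active z)"]) auto
  have "{J. J \<subseteq> N \<and> (\<exists>z\<in>V. J \<subseteq> active z)} = (\<Union>z\<in>V. ?S z)"
    using unique_face_maximum[OF assms(1)] by auto (metis)
  then have "euler N = (\<Sum>J\<in>(\<Union>z\<in>V. ?S z). (- 1) ^ card J)"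
    by (simp add: euler_def)
  also have "\<dots> = (\<Sum>z\<in>V. \<Sum>J\<in>?S z. (- 1) ^ card J)"
    using finite_V fin unique_face_maximum[OF assms(1)]
    by (intro sum.UNION_disjoint) (auto, metis)
  also have "\<dots> = (\<Sum>z\<in>V. if increasing \<xi> z = N \<inter> active z then (- 1) ^ card (increasing \<xi> z) else 0)"
    by (intro sum.cong refl alternating_sum_between) simp
  finally show ?thesis .
qed

section \<open>Shifted polytopes as signed sums of flipped cones\<close>

definition shifted :: "('i \<Rightarrow> real) \<Rightarrow> 'a set" where
  "shifted h = halfspace_polyhedron I u (\<lambda>i. \<kappa> i + h i)"

text \<open>The point where the shifted inequalities in \<open>active z\<close> are all tight: by
  duality the displacement solving these equations has coordinates \<open>- h i\<close>.\<close>

definition shifted_vertex :: "('i \<Rightarrow> real) \<Rightarrow> 'a \<Rightarrow> 'a" where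
  "shifted_vertex h z = z - (\<Sum>i\<in>active z. h i *\<^sub>R w z i)"

definition violated :: "('i \<Rightarrow> real) \<Rightarrow> 'a \<Rightarrow> 'i set" where
  "violated h x = {i \<in> I. u i \<bullet> x + \<kappa> i + h i < 0}"

lemma in_shifted_iff: "x \<in> shifted h \<longleftrightarrow> (\<forall>i\<in>I. 0 \<le> u i \<bullet> x + \<kappa> i + h i)"
  by (simp add: shifted_def halfspace_polyhedron_def add.assoc)

lemma inner_shifted_vertex:
  assumes "z \<in> V" "i \<in> active z"
  shows "u i \<bullet> shifted_vertex h z = - \<kappa> i - h i"
  using inner_w_combination[OF assms, of h] activeD[OF assms(2)]
  by (simp add: shifted_vertex_def inner_diff_right)

lemma euler_violated:
  assumes "\<And>z. z \<in> V \<Longrightarrow> shifted_vertex h z \<in> shifted h"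
  shows "euler (violated h x) = (if x \<in> shifted h then 1 else 0)"
proof (cases "x \<in> shifted h")
  case True
  then have "violated h x = {}"
    by (force simp: violated_def in_shifted_iff)
  moreover have "{J. J \<subseteq> {} \<and> (\<exists>z\<in>V. J \<subseteq> active z)} = {{}}"
    using V_nonempty by auto
  ultimately have "euler (violated h x) = 1"
    by (simp add: euler_def)
  then show ?thesis
    using True by simp
next
  case False
  have "polyhedron (shifted h)"
    unfolding shifted_def by (rule polyhedron_halfspace_polyhedron[OF finite_I])
  then have "convex (shifted h)" "closed (shifted h)"
    by (simp_all add: polyhedron_imp_convex polyhedron_imp_closed)
  then obtain a b where ab: "a \<bullet> x < b" "\<forall>y\<in>shifted h. a \<bullet> y > b"
    using separating_hyperplane_closed_point False by blast
  \<comment> \<open>An open condition satisfied by \<open>- a\<close>, so some generic form takes a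
    larger value at \<open>x\<close> than at every shifted vertex.\<close>
  define U where "U = (\<Inter>z\<in>V. {\<xi>. \<xi> \<bullet> shifted_vertex h z < \<xi> \<bullet> x})"
  have "open U"
    unfolding U_def using finite_V
    by (intro open_INT ballI open_Collect_less continuous_intros)
  moreover have "- a \<in> U"
    using ab assms by (force simp: U_def)
  ultimately obtain \<xi> where \<xi>: "\<xi> \<in> U" "generic \<xi>"
    using exists_generic by blast
  \<comment> \<open>If the inequalities violated at \<open>z\<close> were those of the increasing
    edges, every term in the expansion of \<open>x\<close> at the shifted vertex would contribute at
    most \<open>0\<close>, and \<open>\<xi>\<close> would not be larger at \<open>x\<close>.\<close>
  have "increasing \<xi> z \<noteq> violated h x \<inter> active z" if z: "z \<in> V" for z
  proof
    assume eq: "increasing \<xi> z = violated h x \<inter> active z"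
    define s where "s i = u i \<bullet> x + \<kappa> i + h i" for i
    have "x - shifted_vertex h z = (\<Sum>i\<in>active z. s i *\<^sub>R w z i)"
      by (subst expand[OF z, of "x - shifted_vertex h z"], intro sum.cong refl)
        (simp add: inner_shifted_vertex[OF z] inner_diff_right s_def)
    then have "\<xi> \<bullet> (x - shifted_vertex h z) = (\<Sum>i\<in>active z. s i * (\<xi> \<bullet> w z i))"
      by (simp add: inner_sum_right)
    also have "\<dots> \<le> 0"
    proof (rule sum_nonpos)
      fix i assume i: "i \<in> active z"
      show "s i * (\<xi> \<bullet> w z i) \<le> 0"
      proof (cases "i \<in> increasing \<xi> z")
        case True
        then have "s i < 0" "\<xi> \<bullet> w z i > 0"
          using eq by (auto simp: increasing_def violated_def s_def)
        then show ?thesis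
          by (simp add: mult_neg_pos less_imp_le)
      next
        case False
        then have "i \<notin> violated h x" "i \<in> I"
          using eq i active_subset by blast+
        then have "s i \<ge> 0" "\<xi> \<bullet> w z i \<le> 0"
          using False i by (auto simp: increasing_def violated_def s_def)
        then show ?thesis
          by (simp add: mult_nonneg_nonpos)
      qed
    qed
    finally show False
      using \<xi>(1) z by (auto simp: U_def inner_diff_right)
  qed
  moreover have "violated h x \<subseteq> I"
    by (auto simp: violated_def)
  ultimately show ?thesis
    using euler_eq[OF \<xi>(2)] False by simp
qed

lemma increasing_eq_Int_iff:
  assumes "N \<subseteq> I"
  shows "increasing \<xi> z = N \<inter> active z \<longleftrightarrow> (\<forall>i\<in>active z. i \<in> N \<longleftrightarrow> i \<in> increasing \<xi> z)"
  by (auto simp: increasing_def)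

text \<open>The cone at \<open>z\<close> is half-open, since flipping replaces
  \<open>0 \<le>\<close> by its negation. This makes the identity hold pointwise, boundary included,
  as counting lattice points requires.\<close>

theorem signed_cones_shifted:
  assumes "generic \<xi>" "\<And>z. z \<in> V \<Longrightarrow> shifted_vertex h z \<in> shifted h"
  shows "indicator (shifted h) x = (\<Sum>z\<in>V. (- 1) ^ card (increasing \<xi> z) *
    indicator {x. \<forall>i\<in>active z. u i \<bullet> x + \<kappa> i + h i < 0 \<longleftrightarrow> i \<in> increasing \<xi> z} x :: real)"
proof -
  have sub: "violated h x \<subseteq> I"
    by (auto simp: violated_def)
  have "indicator (shifted h) x = euler (violated h x)"
    using euler_violated[OF assms(2)] by (simp add: indicator_def)
  also have "\<dots> = (\<Sum>z\<in>V. (- 1) ^ card (increasing \<xi> z) *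
    indicator {x. \<forall>i\<in>active z. u i \<bullet> x + \<kappa> i + h i < 0 \<longleftrightarrow> i \<in> increasing \<xi> z} x)"
    unfolding euler_eq[OF assms(1) sub] increasing_eq_Int_iff[OF sub]
    using active_subset by (intro sum.cong refl) (auto simp: violated_def indicator_def)
  finally show ?thesis .
qed

text \<open>Inactive inequalities have positive slack at a vertex, and there are finitely many of
  them, so a small shift of the facets cannot push a moved vertex out of the moved polytope.\<close>

lemma shifted_vertices_in_shifted:
  obtains \<epsilon> where "\<epsilon> > 0"
    "\<And>h z. (\<And>i. i \<in> I \<Longrightarrow> \<bar>h i\<bar> < \<epsilon>) \<Longrightarrow> z \<in> V \<Longrightarrow> shifted_vertex h z \<in> shifted h"
proof -
  \<comment> \<open>The sum bounds the effect of the displacement of the vertex, the summand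
    \<open>1\<close> the shift \<open>h i\<close> of the inequality itself.\<close>
  define C where "C z i = (\<Sum>j\<in>active z. \<bar>u i \<bullet> w z j\<bar>) + 1" for z i
  have "\<forall>\<^sub>F \<epsilon> in at_right (0::real). \<epsilon> * C z i < u i \<bullet> z + \<kappa> i" if "z \<in> V" "i \<in> I - active z" for z i
  proof -
    have "((\<lambda>\<epsilon>. \<epsilon> * C z i) \<longlongrightarrow> 0 * C z i) (at_right 0)"
      by (intro tendsto_intros)
    moreover have "0 * C z i < u i \<bullet> z + \<kappa> i"
      using that V_subset by (auto simp: active_def in_P_iff less_le)
    ultimately show ?thesis
      by (rule order_tendstoD)
  qed
  then have "\<forall>\<^sub>F \<epsilon> in at_right (0::real). \<forall>z\<in>V. \<forall>i\<in>I - active z. \<epsilon> * C z i < u i \<bullet> z + \<kappa> i"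
    using finite_I finite_V by (intro eventually_ball_finite ballI) auto
  then have "\<forall>\<^sub>F \<epsilon> in at_right (0::real).
      0 < \<epsilon> \<and> (\<forall>z\<in>V. \<forall>i\<in>I - active z. \<epsilon> * C z i < u i \<bullet> z + \<kappa> i)"
    using eventually_at_right_less by (rule eventually_conj[rotated])
  then obtain \<epsilon> where \<epsilon>: "0 < \<epsilon>" "\<forall>z\<in>V. \<forall>i\<in>I - active z. \<epsilon> * C z i < u i \<bullet> z + \<kappa> i"
    using eventually_happens' trivial_limit_at_right_real by blast
  show thesis
  proof (rule that[OF \<epsilon>(1)])
    fix h z assume h: "\<And>i. i \<in> I \<Longrightarrow> \<bar>h i\<bar> < \<epsilon>" and z: "z \<in> V"
    show "shifted_vertex h z \<in> shifted h"
      unfolding in_shifted_iff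
    proof
      fix i assume i: "i \<in> I"
      show "0 \<le> u i \<bullet> shifted_vertex h z + \<kappa> i + h i"
      proof (cases "i \<in> active z")
        case True
        then show ?thesis
          using inner_shifted_vertex[OF z True] by simp
      next
        case False
        have "(\<Sum>j\<in>active z. h j * (u i \<bullet> w z j)) \<le> (\<Sum>j\<in>active z. \<epsilon> * \<bar>u i \<bullet> w z j\<bar>)"
        proof (rule sum_mono)
          fix j assume "j \<in> active z"
          then have "\<bar>h j\<bar> \<le> \<epsilon>"
            using h active_subset by (auto intro: less_imp_le)
          then have "\<bar>h j\<bar> * \<bar>u i \<bullet> w z j\<bar> \<le> \<epsilon> * \<bar>u i \<bullet> w z j\<bar>"
            by (intro mult_right_mono) auto
          then show "h j * (u i \<bullet> w z j) \<le> \<epsilon> * \<bar>u i \<bullet> w z j\<bar>"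
            using abs_ge_self[of "h j * (u i \<bullet> w z j)"] by (simp add: abs_mult)
        qed
        moreover have "\<epsilon> * C z i < u i \<bullet> z + \<kappa> i" "- \<epsilon> < h i"
          using \<epsilon>(2) z i False h[OF i] by auto
        ultimately show ?thesis
          by (simp add: shifted_vertex_def inner_diff_right inner_sum_right C_def distrib_left
              sum_distrib_left)
      qed
    qed
  qed
qed

text \<open>At a fixed \<open>x\<close> the open polytope agrees with
  \<open>shifted (\<lambda>_. - \<delta>)\<close> once \<open>\<delta>\<close> is below all positive
  slacks at \<open>x\<close>. The choice of \<open>\<delta>\<close> depends on \<open>x\<close>, but
  the resulting identity does not mention it; the inward shift turns \<open><\<close> into
  \<open>\<le>\<close> in the flipped conditions.\<close>

theorem signed_cones_interior:
  assumes "generic \<xi>"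
  shows "indicator {x. \<forall>i\<in>I. 0 < u i \<bullet> x + \<kappa> i} x = (\<Sum>z\<in>V. (- 1) ^ card (increasing \<xi> z) *
    indicator {x. \<forall>i\<in>active z. u i \<bullet> x + \<kappa> i \<le> 0 \<longleftrightarrow> i \<in> increasing \<xi> z} x :: real)"
proof -
  obtain \<epsilon> where \<epsilon>: "\<epsilon> > 0"
    "\<And>h z. (\<And>i. i \<in> I \<Longrightarrow> \<bar>h i\<bar> < \<epsilon>) \<Longrightarrow> z \<in> V \<Longrightarrow> shifted_vertex h z \<in> shifted h"
    using shifted_vertices_in_shifted by blast
  have "\<forall>\<^sub>F \<delta> in at_right (0::real). 0 < u i \<bullet> x + \<kappa> i \<longrightarrow> \<delta> < u i \<bullet> x + \<kappa> i" if "i \<in> I" for i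
    by (cases "0 < u i \<bullet> x + \<kappa> i") (auto intro: order_tendstoD[OF tendsto_ident_at])
  then have "\<forall>\<^sub>F \<delta> in at_right (0::real). \<forall>i\<in>I. 0 < u i \<bullet> x + \<kappa> i \<longrightarrow> \<delta> < u i \<bullet> x + \<kappa> i"
    using finite_I by (intro eventually_ball_finite ballI) auto
  moreover have "\<forall>\<^sub>F \<delta> in at_right (0::real). \<delta> < \<epsilon>"
    using \<epsilon>(1) by (rule order_tendstoD[OF tendsto_ident_at])
  ultimately have "\<forall>\<^sub>F \<delta> in at_right (0::real).
      0 < \<delta> \<and> \<delta> < \<epsilon> \<and> (\<forall>i\<in>I. 0 < u i \<bullet> x + \<kappa> i \<longrightarrow> \<delta> < u i \<bullet> x + \<kappa> i)"
    using eventually_at_right_less[of 0] by (auto intro: eventually_conj)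
  then obtain \<delta> where \<delta>: "0 < \<delta>" "\<delta> < \<epsilon>" "\<forall>i\<in>I. 0 < u i \<bullet> x + \<kappa> i \<longrightarrow> \<delta> < u i \<bullet> x + \<kappa> i"
    using eventually_happens' trivial_limit_at_right_real by blast
  have iff: "u i \<bullet> x + \<kappa> i + - \<delta> < 0 \<longleftrightarrow> u i \<bullet> x + \<kappa> i \<le> 0"
    "0 \<le> u i \<bullet> x + \<kappa> i + - \<delta> \<longleftrightarrow> 0 < u i \<bullet> x + \<kappa> i" if "i \<in> I" for i
    using \<delta> that by (smt (verit))+
  have "indicator {x. \<forall>i\<in>I. 0 < u i \<bullet> x + \<kappa> i} x = (indicator (shifted (\<lambda>_. - \<delta>)) x :: real)"
    using iff(2) by (auto simp: indicator_def in_shifted_iff)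
  also have "\<dots> = (\<Sum>z\<in>V. (- 1) ^ card (increasing \<xi> z) *
    indicator {x. \<forall>i\<in>active z. u i \<bullet> x + \<kappa> i + - \<delta> < 0 \<longleftrightarrow> i \<in> increasing \<xi> z} x)"
    by (rule signed_cones_shifted[OF assms]) (use \<delta> \<epsilon> in auto)
  also have "\<dots> = (\<Sum>z\<in>V. (- 1) ^ card (increasing \<xi> z) *
    indicator {x. \<forall>i\<in>active z. u i \<bullet> x + \<kappa> i \<le> 0 \<longleftrightarrow> i \<in> increasing \<xi> z} x)"
  proof (rule sum.cong[OF refl])
    fix z
    have "(\<forall>i\<in>active z. u i \<bullet> x + \<kappa> i + - \<delta> < 0 \<longleftrightarrow> i \<in> increasing \<xi> z) \<longleftrightarrow>
        (\<forall>i\<in>active z. u i \<bullet> x + \<kappa> i \<le> 0 \<longleftrightarrow> i \<in> increasing \<xi> z)"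
      using iff(1) active_subset by blast
    then show "(- 1) ^ card (increasing \<xi> z) *
        indicator {x. \<forall>i\<in>active z. u i \<bullet> x + \<kappa> i + - \<delta> < 0 \<longleftrightarrow> i \<in> increasing \<xi> z} x =
        ((- 1) ^ card (increasing \<xi> z) *
        indicator {x. \<forall>i\<in>active z. u i \<bullet> x + \<kappa> i \<le> 0 \<longleftrightarrow> i \<in> increasing \<xi> z} x :: real)"
      by (simp add: indicator_def)
  qed
  finally show ?thesis .
qed

end

section \<open>Lebesgue measure normalized by a lattice\<close>

lemma lborel_distr_reflect: "distr lborel borel (\<lambda>y. x - y) = (lborel :: 'a::euclidean_space measure)"
  using lborel_affine[of "- 1" x] by (simp add: density_1)

text \<open>Uniqueness of Haar measure: by Tonelli and invariance, the double integral of
  \<open>f(x) g(x + y)\<close> is symmetric in the two measures.\<close>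

lemma translation_invariant_eq_lborel:
  fixes M :: "'a::euclidean_space measure"
  assumes sets_M: "sets M = sets borel" and "sigma_finite_measure M"
    and inv: "\<And>a. distr M borel (\<lambda>x. a + x) = M"
    and A: "A \<in> sets borel"
  shows "emeasure M A = emeasure M (cbox 0 One) * emeasure lborel A"
proof -
  interpret M: sigma_finite_measure M
    by fact
  interpret pair_sigma_finite lborel M ..
  note [measurable_cong] = sets_M
  let ?C = "cbox 0 (One :: 'a)"
  define f g :: "'a \<Rightarrow> ennreal" where "f = indicator A" and "g = indicator ?C"
  have [measurable]: "f \<in> borel_measurable borel" "g \<in> borel_measurable borel"
    using A by (simp_all add: f_def g_def)
  have inv_M: "(\<integral>\<^sup>+x. h x \<partial>M) = (\<integral>\<^sup>+x. h (a + x) \<partial>M)"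
    if [measurable]: "h \<in> borel_measurable borel" for h :: "'a \<Rightarrow> ennreal" and a
    by (subst inv[symmetric, of a], subst nn_integral_distr) auto
  have inv_L: "(\<integral>\<^sup>+x. h x \<partial>lborel) = (\<integral>\<^sup>+x. h (a + x) \<partial>lborel)"
    if [measurable]: "h \<in> borel_measurable borel" for h :: "'a \<Rightarrow> ennreal" and a
    by (subst lborel_distr_plus[symmetric, of a], subst nn_integral_distr) auto
  have refl_L: "(\<integral>\<^sup>+x. h x \<partial>lborel) = (\<integral>\<^sup>+x. h (a - x) \<partial>lborel)"
    if [measurable]: "h \<in> borel_measurable borel" for h :: "'a \<Rightarrow> ennreal" and a
    by (subst lborel_distr_reflect[symmetric, of a], subst nn_integral_distr) auto
  have "emeasure M A * emeasure lborel ?C = (\<integral>\<^sup>+x. f x \<partial>M) * (\<integral>\<^sup>+y. g y \<partial>lborel)"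
    using A sets_M by (simp add: f_def g_def)
  also have "\<dots> = (\<integral>\<^sup>+x. f x * (\<integral>\<^sup>+y. g y \<partial>lborel) \<partial>M)"
    by (subst nn_integral_multc) auto
  also have "\<dots> = (\<integral>\<^sup>+x. \<integral>\<^sup>+y. f x * g (x + y) \<partial>lborel \<partial>M)"
  proof (rule nn_integral_cong)
    fix x
    show "f x * (\<integral>\<^sup>+y. g y \<partial>lborel) = (\<integral>\<^sup>+y. f x * g (x + y) \<partial>lborel)"
      by (subst inv_L[of g x]) (auto simp: nn_integral_cmult)
  qed
  also have "\<dots> = (\<integral>\<^sup>+y. \<integral>\<^sup>+x. f x * g (x + y) \<partial>M \<partial>lborel)"
    by (rule Fubini') measurable
  also have "\<dots> = (\<integral>\<^sup>+y. \<integral>\<^sup>+x. f (- y + x) * g x \<partial>M \<partial>lborel)"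
  proof (rule nn_integral_cong)
    fix y
    show "(\<integral>\<^sup>+x. f x * g (x + y) \<partial>M) = (\<integral>\<^sup>+x. f (- y + x) * g x \<partial>M)"
      by (subst inv_M[of "\<lambda>x. f x * g (x + y)" "- y"]) auto
  qed
  also have "\<dots> = (\<integral>\<^sup>+x. \<integral>\<^sup>+y. f (- y + x) * g x \<partial>lborel \<partial>M)"
    by (rule Fubini'[symmetric]) measurable
  also have "\<dots> = (\<integral>\<^sup>+x. (\<integral>\<^sup>+y. f y \<partial>lborel) * g x \<partial>M)"
  proof (rule nn_integral_cong)
    fix x
    show "(\<integral>\<^sup>+y. f (- y + x) * g x \<partial>lborel) = (\<integral>\<^sup>+y. f y \<partial>lborel) * g x"
      by (subst refl_L[of f x]) (auto simp: nn_integral_multc)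
  qed
  also have "\<dots> = emeasure lborel A * emeasure M ?C"
    using A sets_M by (subst nn_integral_cmult) (auto simp: f_def g_def)
  also have "emeasure lborel ?C = 1"
    by (subst emeasure_lborel_cbox) auto
  finally show ?thesis
    by (simp add: mult.commute)
qed

section \<open>Lattice frames and their fundamental cells\<close>

definition frame_map :: "('a::euclidean_space \<Rightarrow> 'a) \<Rightarrow> 'a \<Rightarrow> 'a" where
  "frame_map \<pi> y = (\<Sum>b\<in>Basis. (y \<bullet> b) *\<^sub>R \<pi> b)"

text \<open>The lattice basis is indexed by \<open>Basis\<close>, so that
  \<open>frame_map \<pi>\<close> carries the standard lattice and \<open>lborel\<close> to
  \<open>L\<close> and its normalized measure.\<close>

definition lattice_frame :: "'a::euclidean_space set \<Rightarrow> ('a \<Rightarrow> 'a) \<Rightarrow> bool" where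
  "lattice_frame L \<pi> \<longleftrightarrow> inj_on \<pi> Basis \<and> lattice_basis L (\<pi> ` Basis)"

definition unit_cell :: "'a::euclidean_space set" where
  "unit_cell = {y. \<forall>b\<in>Basis. 0 \<le> y \<bullet> b \<and> y \<bullet> b < 1}"

lemma linear_frame_map: "linear (frame_map \<pi>)"
  by (rule linearI)
    (simp_all add: frame_map_def inner_add_left scaleR_add_left sum.distrib scaleR_sum_right)

lemma int_span_finite:
  assumes "finite B"
  shows "int_span B = {\<Sum>b\<in>B. of_int (r b) *\<^sub>R b | r. True}"
proof safe
  fix x assume "x \<in> int_span B"
  then obtain t r where t: "x = (\<Sum>a\<in>t. of_int (r a) *\<^sub>R a)" "finite t" "t \<subseteq> B"
    by (auto simp: int_span_def)
  have "x = (\<Sum>b\<in>B. of_int (if b \<in> t then r b else 0) *\<^sub>R b)"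
    unfolding t(1) using assms t(3) by (intro sum.mono_neutral_cong_left) auto
  then show "\<exists>r. x = (\<Sum>b\<in>B. real_of_int (r b) *\<^sub>R b) \<and> True"
    by (intro exI[of _ "\<lambda>b. if b \<in> t then r b else 0"] conjI TrueI)
next
  fix r :: "'a \<Rightarrow> int"
  show "(\<Sum>b\<in>B. of_int (r b) *\<^sub>R b) \<in> int_span B"
    using assms by (auto simp: int_span_def)
qed

lemma sum_image_frame:
  assumes "inj_on \<pi> Basis"
  shows "(\<Sum>b\<in>\<pi> ` Basis. c b *\<^sub>R b) = frame_map \<pi> (\<Sum>b\<in>Basis. c (\<pi> b) *\<^sub>R b)"
proof -
  have "(\<Sum>b'\<in>Basis. c (\<pi> b') *\<^sub>R b') \<bullet> b = c (\<pi> b)" if "b \<in> Basis" for b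
    using that by (simp add: inner_sum_left_Basis)
  then show ?thesis
    unfolding frame_map_def sum.reindex[OF assms] o_def by (intro sum.cong refl) simp
qed

lemma bij_frame_map:
  assumes "lattice_frame L \<pi>"
  shows "bij (frame_map \<pi>)"
proof -
  have inj: "inj_on \<pi> Basis" and "span (\<pi> ` Basis) = UNIV"
    using assms by (auto simp: lattice_frame_def lattice_basis_def)
  have "surj (frame_map \<pi>)"
    unfolding surj_def
  proof
    fix y
    have "y \<in> span (\<pi> ` Basis)"
      using \<open>span (\<pi> ` Basis) = UNIV\<close> by simp
    then obtain c where "y = (\<Sum>b\<in>\<pi> ` Basis. c b *\<^sub>R b)"
      unfolding span_finite[OF finite_imageI[OF finite_Basis]] by auto
    then show "\<exists>x. y = frame_map \<pi> x"
      using sum_image_frame[OF inj] by blast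
  qed
  then show ?thesis
    using linear_frame_map linear_surjective_imp_injective by (metis bijI)
qed

lemma lattice_eq_frame_map:
  assumes "lattice_frame L \<pi>"
  shows "frame_map \<pi> y \<in> L \<longleftrightarrow> (\<forall>b\<in>Basis. y \<bullet> b \<in> \<int>)"
proof -
  have inj: "inj_on \<pi> Basis" and L: "L = int_span (\<pi> ` Basis)"
    using assms by (auto simp: lattice_frame_def lattice_basis_def)
  show ?thesis
  proof
    assume "frame_map \<pi> y \<in> L"
    then obtain r :: "'a \<Rightarrow> int" where "frame_map \<pi> y = (\<Sum>b\<in>\<pi> ` Basis. of_int (r b) *\<^sub>R b)"
      unfolding L int_span_finite[OF finite_imageI[OF finite_Basis]] by auto
    also have "\<dots> = frame_map \<pi> (\<Sum>b\<in>Basis. of_int (r (\<pi> b)) *\<^sub>R b)"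
      by (rule sum_image_frame[OF inj])
    finally have "y = (\<Sum>b\<in>Basis. of_int (r (\<pi> b)) *\<^sub>R b)"
      using bij_frame_map[OF assms] by (simp add: bij_def inj_eq)
    then show "\<forall>b\<in>Basis. y \<bullet> b \<in> \<int>"
      by (simp add: inner_sum_left_Basis)
  next
    assume "\<forall>b\<in>Basis. y \<bullet> b \<in> \<int>"
    then have int: "of_int \<lfloor>y \<bullet> b\<rfloor> = y \<bullet> b" if "b \<in> Basis" for b
      using that by auto
    have "frame_map \<pi> y = (\<Sum>b\<in>\<pi> ` Basis. of_int \<lfloor>y \<bullet> inv_into Basis \<pi> b\<rfloor> *\<^sub>R b)"
      unfolding sum.reindex[OF inj] o_def frame_map_def
      by (intro sum.cong refl) (simp add: inv_into_f_f[OF inj] int)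
    then show "frame_map \<pi> y \<in> L"
      unfolding L int_span_finite[OF finite_imageI[OF finite_Basis]] by auto
  qed
qed

lemma fundamental_domain_eq:
  assumes "lattice_frame L \<pi>"
  shows "fundamental_domain (\<pi> ` Basis) = frame_map \<pi> ` unit_cell"
proof -
  have inj: "inj_on \<pi> Basis"
    using assms by (simp add: lattice_frame_def)
  show ?thesis
  proof safe
    fix x assume "x \<in> fundamental_domain (\<pi> ` Basis)"
    then obtain t where t: "x = (\<Sum>b\<in>\<pi> ` Basis. t b *\<^sub>R b)" "\<forall>b\<in>\<pi> ` Basis. 0 \<le> t b \<and> t b < 1"
      by (auto simp: fundamental_domain_def)
    then show "x \<in> frame_map \<pi> ` unit_cell"
      unfolding t(1) sum_image_frame[OF inj]
      by (intro imageI) (auto simp: unit_cell_def inner_sum_left_Basis)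
  next
    fix y :: 'a assume y: "y \<in> unit_cell"
    have "frame_map \<pi> y = (\<Sum>b\<in>\<pi> ` Basis. (y \<bullet> inv_into Basis \<pi> b) *\<^sub>R b)"
      unfolding sum.reindex[OF inj] o_def frame_map_def
      by (intro sum.cong refl) (simp add: inv_into_f_f[OF inj])
    then show "frame_map \<pi> y \<in> fundamental_domain (\<pi> ` Basis)"
      using y unfolding fundamental_domain_def unit_cell_def
      by (auto simp: inv_into_f_f[OF inj] intro!: exI[of _ "\<lambda>b. y \<bullet> inv_into Basis \<pi> b"])
  qed
qed

lemma lattice_basis_imp_frame:
  assumes "lattice_basis L (B :: 'a::euclidean_space set)"
  obtains \<pi> where "lattice_frame L \<pi>" "\<pi> ` Basis = B"
proof -
  have "independent B" "span B = UNIV"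
    using assms by (auto simp: lattice_basis_def)
  then have "card B = DIM('a)" "finite B"
    using dim_span_eq_card_independent[of B] finiteI_independent by auto
  then obtain \<pi> where "bij_betw \<pi> (Basis :: 'a set) B"
    using finite_same_card_bij[OF finite_Basis] by metis
  then show thesis
    using assms that by (auto simp: lattice_frame_def bij_betw_def)
qed

lemma borel_measurable_frame_map [measurable]: "frame_map \<pi> \<in> borel_measurable borel"
  by (intro borel_measurable_continuous_onI linear_continuous_on)
    (simp add: linear_frame_map flip: linear_conv_bounded_linear)

lemma unit_cell_measurable [measurable]: "(unit_cell :: 'a::euclidean_space set) \<in> sets borel"
  unfolding unit_cell_def by measurable

lemma emeasure_unit_cell: "emeasure lborel (unit_cell :: 'a::euclidean_space set) = 1"
proof (rule antisym)
  have "emeasure lborel (unit_cell :: 'a set) \<le> emeasure lborel (cbox 0 (One :: 'a))"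
    by (intro emeasure_mono) (auto simp: unit_cell_def mem_box less_imp_le)
  also have "\<dots> = 1"
    by (subst emeasure_lborel_cbox) auto
  finally show "emeasure lborel (unit_cell :: 'a set) \<le> 1" .
  have "1 = emeasure lborel (box 0 (One :: 'a))"
    by (subst emeasure_lborel_box) auto
  also have "\<dots> \<le> emeasure lborel (unit_cell :: 'a set)"
    by (intro emeasure_mono) (auto simp: unit_cell_def mem_box less_imp_le)
  finally show "1 \<le> emeasure lborel (unit_cell :: 'a set)" .
qed

lemma frame_map_inverse:
  assumes "lattice_frame L \<pi>"
  obtains \<psi> where "linear \<psi>" "\<And>x. frame_map \<pi> (\<psi> x) = x" "\<And>y. \<psi> (frame_map \<pi> y) = y"
proof -
  have bij: "bij (frame_map \<pi>)"
    by (rule bij_frame_map[OF assms])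
  then obtain \<psi> where \<psi>: "linear \<psi>" "\<psi> \<circ> frame_map \<pi> = id"
    using linear_injective_left_inverse[OF linear_frame_map] bij_is_inj by blast
  have "frame_map \<pi> (\<psi> x) = x" for x
    using \<psi>(2) bij by (metis bij_def comp_apply id_apply surjE)
  moreover have "\<psi> (frame_map \<pi> y) = y" for y
    using \<psi>(2) by (metis comp_apply id_apply)
  ultimately show thesis
    using that \<psi>(1) by blast
qed

lemma frame_image_measurable:
  assumes "lattice_frame L \<pi>" "A \<in> sets borel"
  shows "frame_map \<pi> ` A \<in> sets borel"
proof -
  obtain \<psi> where \<psi>: "linear \<psi>" "\<And>x. frame_map \<pi> (\<psi> x) = x" "\<And>y. \<psi> (frame_map \<pi> y) = y"
    using frame_map_inverse[OF assms(1)] by metis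
  have "\<psi> \<in> borel_measurable borel"
    using \<psi>(1) by (intro borel_measurable_continuous_onI linear_continuous_on)
      (simp flip: linear_conv_bounded_linear)
  moreover have "frame_map \<pi> ` A = \<psi> -` A \<inter> space borel"
    using \<psi>(2,3) by (auto simp: image_iff) (metis)
  ultimately show ?thesis
    using assms(2) by (auto simp: measurable_def)
qed

lemma emeasure_distr_frame_image:
  assumes "lattice_frame L \<pi>" "A \<in> sets borel"
  shows "emeasure (distr lborel borel (frame_map \<pi>)) (frame_map \<pi> ` A) = emeasure lborel A"
proof -
  have "frame_map \<pi> -` frame_map \<pi> ` A = A"
    using bij_frame_map[OF assms(1)] by (simp add: bij_def inj_vimage_image_eq)
  then show ?thesis
    using frame_image_measurable[OF assms] by (simp add: emeasure_distr)
qed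

text \<open>By linearity and surjectivity a translation of the image comes from a translation of the
  source, where \<open>lborel\<close> is invariant.\<close>

lemma distr_frame_map_invariant:
  assumes "lattice_frame L \<pi>"
  shows "distr (distr lborel borel (frame_map \<pi>)) borel (\<lambda>x. a + x) = distr lborel borel (frame_map \<pi>)"
proof -
  obtain c where c: "a = frame_map \<pi> c"
    using bij_frame_map[OF assms] by (metis bij_def surjE)
  have "distr (distr lborel borel (frame_map \<pi>)) borel (\<lambda>x. a + x) =
      distr lborel borel (\<lambda>y. frame_map \<pi> (c + y))"
    by (subst distr_distr) (auto simp: c o_def linear_add[OF linear_frame_map])
  also have "\<dots> = distr (distr lborel borel (\<lambda>y. c + y)) borel (frame_map \<pi>)"
    by (subst distr_distr) (auto simp: o_def)
  also have "\<dots> = distr lborel borel (frame_map \<pi>)"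
    by (simp add: lborel_distr_plus)
  finally show ?thesis .
qed

text \<open>A translation invariant measure is a multiple of \<open>lborel\<close>; the factor is
  read off on the fundamental domain, the image of \<open>unit_cell\<close>, whose pushed-forward
  measure is \<open>1\<close>.\<close>

lemma distr_frame_map_eq:
  fixes L :: "'a::euclidean_space set"
  assumes "lattice_frame L \<pi>"
  shows "distr lborel borel (frame_map \<pi>) =
    scale_measure (1 / emeasure lborel (fundamental_domain (\<pi> ` Basis))) lborel"
proof -
  define M where "M = distr lborel borel (frame_map \<pi>)"
  have sets_M: "sets M = sets borel"
    by (simp add: M_def)
  have "sigma_finite_measure M"
  proof
    let ?A = "(\<lambda>n::nat. frame_map \<pi> ` cball 0 (real n)) ` UNIV"
    have "\<Union>?A = frame_map \<pi> ` (\<Union>n. cball 0 (real n))"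
      by auto
    also have "(\<Union>n. cball (0::'a) (real n)) = UNIV"
      using real_arch_simple by (auto simp: dist_norm)
    also have "frame_map \<pi> ` UNIV = UNIV"
      using bij_frame_map[OF assms] by (simp add: bij_def)
    finally have "\<Union>?A = space M"
      by (simp add: M_def)
    moreover have "?A \<subseteq> sets M"
      unfolding sets_M by (intro image_subsetI frame_image_measurable[OF assms] borel_closed closed_cball)
    moreover have "\<forall>a\<in>?A. emeasure M a \<noteq> \<infinity>"
    proof clarify
      fix n :: nat
      have "emeasure M (frame_map \<pi> ` cball 0 (real n)) = emeasure lborel (cball (0::'a) (real n))"
        unfolding M_def by (intro emeasure_distr_frame_image[OF assms] borel_closed closed_cball)
      moreover assume "emeasure M (frame_map \<pi> ` cball 0 (real n)) = \<infinity>"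
      ultimately show False
        using emeasure_lborel_cball_finite[of "0::'a" "real n"] by simp
    qed
    ultimately show "\<exists>A. countable A \<and> A \<subseteq> sets M \<and> \<Union>A = space M \<and> (\<forall>a\<in>A. emeasure M a \<noteq> \<infinity>)"
      by (intro exI[of _ ?A]) simp
  qed
  then have eq: "emeasure M A = emeasure M (cbox 0 One) * emeasure lborel A" if "A \<in> sets borel" for A
    using that distr_frame_map_invariant[OF assms]
    by (intro translation_invariant_eq_lborel) (auto simp: M_def)
  let ?F = "fundamental_domain (\<pi> ` Basis)"
  have "emeasure M ?F = 1"
    unfolding fundamental_domain_eq[OF assms] M_def emeasure_distr_frame_image[OF assms unit_cell_measurable]
    by (rule emeasure_unit_cell)
  then have one: "emeasure M (cbox 0 One) * emeasure lborel ?F = 1"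
    using eq[of ?F] frame_image_measurable[OF assms unit_cell_measurable]
    by (simp add: fundamental_domain_eq[OF assms])
  \<comment> \<open>Cancellation in \<open>ennreal\<close> requires a factor that is neither
    \<open>0\<close> nor infinite; a product equal to \<open>1\<close> guarantees both.\<close>
  have c: "emeasure M (cbox 0 One) = 1 / emeasure lborel ?F"
  proof -
    have "emeasure lborel ?F \<noteq> 0"
      using one by auto
    moreover have "emeasure lborel ?F \<noteq> top"
      using one by (auto simp: ennreal_mult_top split: if_splits)
    ultimately show ?thesis
      using ennreal_mult_divide_eq[of "emeasure lborel ?F" "emeasure M (cbox 0 One)"] by (simp add: one)
  qed
  show ?thesis
    unfolding M_def[symmetric]
  proof (rule measure_eqI)
    fix A assume "A \<in> sets M"
    then show "emeasure M A = emeasure (scale_measure (1 / emeasure lborel ?F) lborel) A"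
      using eq[of A] by (simp add: sets_M c)
  qed (simp add: sets_M)
qed

text \<open>Rounding down the coordinates in the frame gives the lattice point, and a difference
  with coordinates in \<open>[0, 1)\<close> leaves no other choice.\<close>

lemma lattice_tiling:
  assumes "lattice_frame L \<pi>"
  shows "\<exists>!l. l \<in> L \<and> x - l \<in> frame_map \<pi> ` unit_cell"
proof -
  obtain \<psi> where \<psi>: "linear \<psi>" "\<And>x. frame_map \<pi> (\<psi> x) = x" "\<And>y. \<psi> (frame_map \<pi> y) = y"
    using frame_map_inverse[OF assms] by metis
  define l\<^sub>0 where "l\<^sub>0 = (\<Sum>b\<in>Basis. of_int \<lfloor>\<psi> x \<bullet> b\<rfloor> *\<^sub>R b)"
  have l\<^sub>0: "l\<^sub>0 \<bullet> b = of_int \<lfloor>\<psi> x \<bullet> b\<rfloor>" if "b \<in> Basis" for b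
    using that by (simp add: l\<^sub>0_def inner_sum_left_Basis)
  show ?thesis
  proof (rule ex1I[of _ "frame_map \<pi> l\<^sub>0"])
    have "\<psi> x - l\<^sub>0 \<in> unit_cell"
      unfolding unit_cell_def using floor_correct l\<^sub>0 by (auto simp: inner_diff_left) linarith
    moreover have "x - frame_map \<pi> l\<^sub>0 = frame_map \<pi> (\<psi> x - l\<^sub>0)"
      by (simp add: linear_diff[OF linear_frame_map] \<psi>(2))
    ultimately show "frame_map \<pi> l\<^sub>0 \<in> L \<and> x - frame_map \<pi> l\<^sub>0 \<in> frame_map \<pi> ` unit_cell"
      by (simp add: lattice_eq_frame_map[OF assms] l\<^sub>0)
  next
    fix l assume l: "l \<in> L \<and> x - l \<in> frame_map \<pi> ` unit_cell"
    then obtain y where y: "y \<in> unit_cell" "x - l = frame_map \<pi> y"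
      by auto
    have "\<psi> l = l\<^sub>0"
    proof (rule euclidean_eqI)
      fix b :: 'a assume b: "b \<in> Basis"
      have "\<psi> (x - l) = y"
        unfolding y(2) by (rule \<psi>(3))
      then have "\<psi> x \<bullet> b - \<psi> l \<bullet> b = y \<bullet> b"
        by (auto simp: linear_diff[OF \<psi>(1)] inner_diff_left)
      moreover have "\<psi> l \<bullet> b \<in> \<int>"
        using lattice_eq_frame_map[OF assms, of "\<psi> l"] l b by (simp add: \<psi>(2))
      then obtain k where k: "\<psi> l \<bullet> b = of_int k"
        by (auto elim: Ints_cases)
      moreover have "0 \<le> y \<bullet> b" "y \<bullet> b < 1"
        using y(1) b by (auto simp: unit_cell_def)
      ultimately have "\<lfloor>\<psi> x \<bullet> b\<rfloor> = k"
        by linarith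
      then show "\<psi> l \<bullet> b = l\<^sub>0 \<bullet> b"
        using k l\<^sub>0[OF b] by simp
    qed
    then show "l = frame_map \<pi> l\<^sub>0"
      using \<psi>(2) by metis
  qed
qed

text \<open>Together the two facts let \<open>from_nat_into\<close> enumerate \<open>L\<close>
  bijectively by \<open>nat\<close>.\<close>

lemma countable_lattice:
  assumes "lattice_frame L \<pi>"
  shows "countable L" "infinite L"
proof -
  have L: "L = int_span (\<pi> ` Basis)"
    using assms by (auto simp: lattice_frame_def lattice_basis_def)
  have "L \<subseteq> frame_map \<pi> ` (\<lambda>f. \<Sum>b\<in>Basis. of_int (f b) *\<^sub>R b) ` (Basis \<rightarrow>\<^sub>E (UNIV :: int set))"
  proof
    fix x assume x: "x \<in> L"
    obtain y where y: "x = frame_map \<pi> y"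
      using bij_frame_map[OF assms] by (metis bij_def surjE)
    then have "of_int \<lfloor>y \<bullet> b\<rfloor> = y \<bullet> b" if "b \<in> Basis" for b
      using x lattice_eq_frame_map[OF assms] that by auto
    then have "(\<Sum>b\<in>Basis. of_int (restrict (\<lambda>b. \<lfloor>y \<bullet> b\<rfloor>) Basis b) *\<^sub>R b) = (\<Sum>b\<in>Basis. (y \<bullet> b) *\<^sub>R b)"
      by (intro sum.cong refl) simp
    then have y': "y = (\<Sum>b\<in>Basis. of_int (restrict (\<lambda>b. \<lfloor>y \<bullet> b\<rfloor>) Basis b) *\<^sub>R b)"
      by (simp only: euclidean_representation)
    show "x \<in> frame_map \<pi> ` (\<lambda>f. \<Sum>b\<in>Basis. of_int (f b) *\<^sub>R b) ` (Basis \<rightarrow>\<^sub>E (UNIV :: int set))"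
      unfolding y
      by (rule imageI, rule image_eqI[where x = "restrict (\<lambda>b. \<lfloor>y \<bullet> b\<rfloor>) Basis"], rule y') simp
  qed
  then show "countable L"
    by (rule countable_subset) (rule countable_image, rule countable_image, rule countable_PiE, simp_all)
  have "inj (\<lambda>n::nat. frame_map \<pi> (real n *\<^sub>R One))"
  proof (rule injI)
    fix m n :: nat
    assume "frame_map \<pi> (real m *\<^sub>R One) = frame_map \<pi> (real n *\<^sub>R One)"
    then have "real m *\<^sub>R One = real n *\<^sub>R (One :: 'a)"
      using bij_frame_map[OF assms] by (simp add: bij_def inj_eq)
    then have "real m * (One \<bullet> b) = real n * (One \<bullet> b)" if "b \<in> Basis" for b :: 'a
      by (metis inner_scaleR_left)
    then show "m = n"
      using nonempty_Basis by fastforce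
  qed
  moreover have "range (\<lambda>n::nat. frame_map \<pi> (real n *\<^sub>R One)) \<subseteq> L"
    by (auto simp: lattice_eq_frame_map[OF assms])
  ultimately show "infinite L"
    using infinite_super range_inj_infinite by blast
qed

lemma lattice_uminus:
  assumes "lattice_frame L \<pi>" "l \<in> L"
  shows "- l \<in> L"
proof -
  obtain y where "l = frame_map \<pi> y"
    using bij_frame_map[OF assms(1)] by (metis bij_def surjE)
  then show ?thesis
    using assms(2) lattice_eq_frame_map[OF assms(1), of y] lattice_eq_frame_map[OF assms(1), of "- y"]
    by (simp add: linear_neg[OF linear_frame_map])
qed

text \<open>\<open>C\<close> is cut into the pieces lying in the translates of \<open>D\<close>;
  moving the pieces back by lattice vectors fills \<open>D\<close> exactly once, because
  \<open>C\<close> tiles the space too. Hence the covolume does not depend on the basis.\<close>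

lemma emeasure_cells_eq:
  assumes \<pi>: "lattice_frame L \<pi>" and \<rho>: "lattice_frame L \<rho>"
  shows "emeasure lborel (frame_map \<pi> ` unit_cell) = emeasure lborel (frame_map \<rho> ` unit_cell)"
proof -
  define C D where "C = frame_map \<pi> ` unit_cell" and "D = frame_map \<rho> ` unit_cell"
  have [measurable]: "C \<in> sets borel" "D \<in> sets borel"
    unfolding C_def D_def using frame_image_measurable[OF _ unit_cell_measurable] \<pi> \<rho> by auto
  define l where "l = from_nat_into L"
  have l: "bij_betw l UNIV L"
    unfolding l_def by (rule bij_betw_from_nat_into[OF countable_lattice[OF \<pi>]])
  \<comment> \<open>Moving the pieces back produces the translates of \<open>C\<close> by the
    vectors \<open>- l n\<close>, which must again run through \<open>L\<close> once.\<close>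
  have "bij_betw uminus L L"
    by (rule bij_betw_byWitness[of _ uminus]) (use lattice_uminus[OF \<pi>] in auto)
  then have l': "bij_betw (\<lambda>n. - l n) UNIV L"
    using bij_betw_trans[OF l] by (simp add: o_def)
  have sum1: "(suminf (\<lambda>n. indicator (frame_map \<tau> ` unit_cell) (x - k n))) = (1 :: ennreal)"
    if \<tau>: "lattice_frame L \<tau>" and k: "bij_betw k UNIV L" for \<tau> k x
  proof -
    obtain m where m: "m \<in> L" "x - m \<in> frame_map \<tau> ` unit_cell"
      "\<And>m'. m' \<in> L \<Longrightarrow> x - m' \<in> frame_map \<tau> ` unit_cell \<Longrightarrow> m' = m"
      using lattice_tiling[OF \<tau>, of x] by blast
    obtain n\<^sub>0 where n\<^sub>0: "k n\<^sub>0 = m"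
      using k m(1) by (metis bij_betw_def imageE)
    have "x - k n \<notin> frame_map \<tau> ` unit_cell" if "n \<noteq> n\<^sub>0" for n
    proof
      assume "x - k n \<in> frame_map \<tau> ` unit_cell"
      then have "k n = k n\<^sub>0"
        using m(3) n\<^sub>0 k by (metis bij_betwE UNIV_I)
      then show False
        using k that by (auto simp: bij_betw_def inj_eq)
    qed
    then have "(suminf (\<lambda>n. indicator (frame_map \<tau> ` unit_cell) (x - k n))) =
        (\<Sum>n\<in>{n\<^sub>0}. indicator (frame_map \<tau> ` unit_cell) (x - k n) :: ennreal)"
      by (intro suminf_finite) auto
    then show ?thesis
      using m(2) n\<^sub>0 by simp
  qed
  have "emeasure lborel C = (\<integral>\<^sup>+x. indicator C x * (suminf (\<lambda>n. indicator D (x - l n))) \<partial>lborel)"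
    unfolding D_def sum1[OF \<rho> l] by simp
  also have "\<dots> = (\<integral>\<^sup>+x. (suminf (\<lambda>n. indicator C x * indicator D (x - l n))) \<partial>lborel)"
    by simp
  also have "\<dots> = (suminf (\<lambda>n. \<integral>\<^sup>+x. indicator C x * indicator D (x - l n) \<partial>lborel))"
    by (rule nn_integral_suminf) measurable
  also have "\<dots> = (suminf (\<lambda>n. \<integral>\<^sup>+x. indicator D x * indicator C (x - - l n) \<partial>lborel))"
  proof (rule suminf_cong)
    fix n
    have "(\<integral>\<^sup>+x. indicator C x * indicator D (x - l n) \<partial>lborel) =
        (\<integral>\<^sup>+x. indicator C (l n + x) * indicator D (l n + x - l n) \<partial>lborel)"
      by (subst lborel_distr_plus[symmetric, of "l n"], subst nn_integral_distr) auto
    then show "(\<integral>\<^sup>+x. indicator C x * indicator D (x - l n) \<partial>lborel) =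
        (\<integral>\<^sup>+x. indicator D x * indicator C (x - - l n) \<partial>lborel)"
      by (simp add: mult.commute add.commute)
  qed
  also have "\<dots> = (\<integral>\<^sup>+x. (suminf (\<lambda>n. indicator D x * indicator C (x - - l n))) \<partial>lborel)"
    by (rule nn_integral_suminf[symmetric]) measurable
  also have "\<dots> = (\<integral>\<^sup>+x. indicator D x * (suminf (\<lambda>n. indicator C (x - - l n))) \<partial>lborel)"
    by simp
  also have "\<dots> = emeasure lborel D"
    unfolding C_def sum1[OF \<pi> l'] by simp
  finally show ?thesis
    by (simp add: C_def D_def)
qed

text \<open>The basis picked by \<open>SOME\<close> is unknown, but its cell has the same volume as
  that of the frame at hand.\<close>

theorem lattice_measure_eq_distr:
  assumes "lattice_frame L \<pi>"
  shows "lattice_measure L = distr lborel borel (frame_map \<pi>)"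
proof -
  have "lattice_basis L (\<pi> ` Basis)"
    using assms by (simp add: lattice_frame_def)
  then have "lattice_basis L (SOME B. lattice_basis L B)"
    by (rule someI)
  then obtain \<rho> where \<rho>: "lattice_frame L \<rho>" "\<rho> ` Basis = (SOME B. lattice_basis L B)"
    by (rule lattice_basis_imp_frame)
  have "emeasure lborel (fundamental_domain (\<pi> ` Basis)) =
      emeasure lborel (fundamental_domain (\<rho> ` Basis))"
    unfolding fundamental_domain_eq[OF assms] fundamental_domain_eq[OF \<rho>(1)]
    by (rule emeasure_cells_eq[OF assms \<rho>(1)])
  then show ?thesis
    unfolding lattice_measure_def distr_frame_map_eq[OF assms] \<rho>(2) by simp
qed

lemma sets_lattice_measure [simp, measurable_cong]: "sets (lattice_measure L) = sets borel"
  by (simp add: lattice_measure_def)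

section \<open>Exponential integrals and sums over unimodular cones\<close>

text \<open>The half-line is the one on which \<open>exp (c * t)\<close> decays; for
  \<open>c > 0\<close> it is the open negative one, matching the half-open cones.\<close>

lemma half_line_exp_integral:
  assumes "c \<noteq> 0"
  shows "has_bochner_integral lborel (\<lambda>t. indicator {t. t < 0 \<longleftrightarrow> c > 0} t * exp (c * t)) (1 / \<bar>c :: real\<bar>)"
proof -
  have neg: "has_bochner_integral lborel (\<lambda>t. indicator {0..} t * exp (c * t)) (- 1 / c)"
    if "c < 0" for c :: real
  proof (rule has_bochner_integral_nn_integral)
    have "(\<integral>\<^sup>+t. ennreal (exp (c * t)) * indicator {0..} t \<partial>lborel) = ennreal (0 - exp (c * 0) / c)"
    proof (rule nn_integral_FTC_atLeast)
      show "((\<lambda>t. exp (c * t) / c) \<longlongrightarrow> 0) at_top"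
        using that by real_asymp
    qed (use that in \<open>auto intro!: derivative_eq_intros\<close>)
    then show "(\<integral>\<^sup>+t. ennreal (indicator {0..} t * exp (c * t)) \<partial>lborel) = ennreal (- 1 / c)"
      by (simp add: mult.commute ennreal_mult'' ennreal_indicator)
  qed (use that in \<open>auto simp: divide_nonneg_neg\<close>)
  show ?thesis
  proof (cases "c > 0")
    case False
    then have "{t. t < 0 \<longleftrightarrow> c > 0} = {0::real..}"
      by auto
    then show ?thesis
      using False assms neg[of c] by simp
  next
    case True
    have "has_bochner_integral lborel (\<lambda>t. indicator {..0} (- t) * exp (c * - t)) (1 / c)"
      using neg[of "- c"] True by (simp add: indicator_def)
    then have "has_bochner_integral (distr lborel borel uminus) (\<lambda>t. indicator {..0} t * exp (c * t)) (1 / c)"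
      by (intro has_bochner_integral_distr) auto
    then have "has_bochner_integral lborel (\<lambda>t. indicator {..0} t * exp (c * t)) (1 / c)"
      by (simp add: lborel_distr_uminus)
    moreover have "AE t in lborel. indicator {..0} t * exp (c * t) = indicator {..<0} t * exp (c * t)"
      using AE_lborel_singleton[of "0::real"] by eventually_elim (auto simp: indicator_def)
    ultimately have "has_bochner_integral lborel (\<lambda>t. indicator {..<0} t * exp (c * t)) (1 / c)"
      by (subst (asm) has_bochner_integral_cong_AE) auto
    moreover have "{t. t < 0 \<longleftrightarrow> c > 0} = {..<0::real}"
      using True by auto
    ultimately show ?thesis
      using True by simp
  qed
qed

lemma has_bochner_integral_lborel_prod:
  fixes f :: "'a::euclidean_space \<Rightarrow> real \<Rightarrow> real"
  assumes f: "\<And>b. b \<in> Basis \<Longrightarrow> has_bochner_integral lborel (f b) (v b)"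
  shows "has_bochner_integral lborel (\<lambda>y. \<Prod>b\<in>Basis. f b (y \<bullet> b)) (\<Prod>b\<in>Basis. v b)"
proof -
  interpret product_sigma_finite "\<lambda>_::'a. lborel :: real measure" ..
  have [measurable]: "f b \<in> borel_measurable borel" if "b \<in> Basis" for b
    using borel_measurable_has_bochner_integral[OF f[OF that]] by simp
  have "has_bochner_integral (\<Pi>\<^sub>M b\<in>Basis. lborel) (\<lambda>x. \<Prod>b\<in>Basis. f b (x b)) (\<Prod>b\<in>Basis. v b)"
    using product_integrable_prod[of Basis f] product_integral_prod[of Basis f] f
    by (simp add: has_bochner_integral_iff)
  moreover have "(\<Prod>b\<in>Basis. f b (x b)) = (\<Prod>b\<in>Basis. f b ((\<Sum>b\<in>Basis. x b *\<^sub>R b) \<bullet> b))"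
    for x :: "'a \<Rightarrow> real"
    by (intro prod.cong refl) (simp add: inner_sum_left_Basis)
  ultimately show ?thesis
    by (subst lborel_eq, intro has_bochner_integral_distr) auto
qed

text \<open>The data of a cone up to flipping: apex, normals, and dual generators forming a lattice
  basis. Which inequalities are negated or strict is left to each statement.\<close>

locale unimodular_cone =
  fixes A :: "'i set"
    and u w :: "'i \<Rightarrow> 'a::euclidean_space"
    and \<kappa> :: "'i \<Rightarrow> real"
    and p :: 'a
    and L :: "'a set"
  assumes finite_A: "finite A"
    and dual: "\<And>i j. i \<in> A \<Longrightarrow> j \<in> A \<Longrightarrow> u i \<bullet> w j = (if i = j then 1 else 0)"
    and basis: "lattice_basis L (w ` A)"
    and apex: "\<And>i. i \<in> A \<Longrightarrow> u i \<bullet> p = - \<kappa> i"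
begin

lemma inj_w: "inj_on w A"
  using dual by (intro inj_onI) (metis zero_neq_one)

lemma inner_combination: "i \<in> A \<Longrightarrow> u i \<bullet> (\<Sum>j\<in>A. c j *\<^sub>R w j) = c i"
proof -
  assume i: "i \<in> A"
  then have "u i \<bullet> (\<Sum>j\<in>A. c j *\<^sub>R w j) = (\<Sum>j\<in>A. if i = j then c j else 0)"
    unfolding inner_sum_right by (intro sum.cong refl) (simp add: dual)
  then show ?thesis
    using i finite_A by simp
qed

lemma frame:
  obtains e where "bij_betw e (Basis :: 'a set) A" "lattice_frame L (w \<circ> e)"
proof -
  have "card (w ` A) = DIM('a)"
    using basis dim_span_eq_card_independent[of "w ` A"] by (auto simp: lattice_basis_def)
  then have "card A = DIM('a)"
    by (simp add: card_image[OF inj_w])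
  then obtain e where e: "bij_betw e (Basis :: 'a set) A"
    using finite_same_card_bij[OF finite_Basis finite_A] by metis
  then have "e ` Basis = A" "inj_on e Basis"
    by (auto simp: bij_betw_def)
  then have "(w \<circ> e) ` Basis = w ` A" "inj_on (w \<circ> e) Basis"
    using inj_w by (metis image_comp) (metis \<open>e ` Basis = A\<close> \<open>inj_on e Basis\<close> comp_inj_on inj_w)
  then have "lattice_frame L (w \<circ> e)"
    using basis by (simp add: lattice_frame_def)
  with e show thesis
    by (rule that)
qed

text \<open>In the coordinates given by the generators the cone is a product of half-lines and the
  exponential a product of one-variable exponentials; the normalization of the measure absorbs the
  change of coordinates.\<close>

lemma exp_integral:
  assumes "\<And>i. i \<in> A \<Longrightarrow> \<xi> \<bullet> w i \<noteq> 0"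
  shows "has_bochner_integral (lattice_measure L)
    (\<lambda>x. indicator {x. \<forall>i\<in>A. u i \<bullet> x + \<kappa> i < 0 \<longleftrightarrow> \<xi> \<bullet> w i > 0} x * exp (\<xi> \<bullet> x))
    (exp (\<xi> \<bullet> p) * (\<Prod>i\<in>A. 1 / \<bar>\<xi> \<bullet> w i\<bar>))"
proof -
  obtain e where e: "bij_betw e (Basis :: 'a set) A" and frame: "lattice_frame L (w \<circ> e)"
    using frame by metis
  define \<phi> where "\<phi> = frame_map (w \<circ> e)"
  have eA: "e b \<in> A" if "b \<in> Basis" for b
    using e that by (auto simp: bij_betw_def)
  have \<phi>_eq: "\<phi> y = (\<Sum>i\<in>A. (y \<bullet> inv_into Basis e i) *\<^sub>R w i)" for y
  proof -
    have "(\<Sum>i\<in>A. (y \<bullet> inv_into Basis e i) *\<^sub>R w i) =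
        (\<Sum>b\<in>Basis. (y \<bullet> inv_into Basis e (e b)) *\<^sub>R w (e b))"
      by (rule sum.reindex_bij_betw[OF e, symmetric])
    also have "\<dots> = \<phi> y"
      unfolding \<phi>_def frame_map_def using e
      by (intro sum.cong refl) (simp add: bij_betw_def inv_into_f_f)
    finally show ?thesis ..
  qed
  have u\<phi>: "u (e b) \<bullet> \<phi> y = y \<bullet> b" if "b \<in> Basis" for b y
    using inner_combination[OF eA[OF that], of "\<lambda>i. y \<bullet> inv_into Basis e i"] that e
    by (simp add: \<phi>_eq bij_betw_def inv_into_f_f)
  have \<xi>\<phi>: "\<xi> \<bullet> \<phi> y = (\<Sum>b\<in>Basis. (\<xi> \<bullet> w (e b)) * (y \<bullet> b))" for y
    by (simp add: \<phi>_def frame_map_def inner_sum_right mult.commute)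
  define I where "I i t = (indicator {t. t < 0 \<longleftrightarrow> \<xi> \<bullet> w i > 0} t :: real)" for i and t :: real
  have [measurable]: "I i \<in> borel_measurable borel" for i
    unfolding I_def by measurable
  define g where "g x = (\<Prod>i\<in>A. I i (u i \<bullet> x + \<kappa> i)) * exp (\<xi> \<bullet> x)" for x
  have g: "indicator {x. \<forall>i\<in>A. u i \<bullet> x + \<kappa> i < 0 \<longleftrightarrow> \<xi> \<bullet> w i > 0} x * exp (\<xi> \<bullet> x) = g x" for x
  proof (cases "\<forall>i\<in>A. u i \<bullet> x + \<kappa> i < 0 \<longleftrightarrow> \<xi> \<bullet> w i > 0")
    case True
    then show ?thesis
      by (simp add: g_def I_def)
  next
    case False
    then obtain i where i: "i \<in> A" "\<not> (u i \<bullet> x + \<kappa> i < 0 \<longleftrightarrow> \<xi> \<bullet> w i > 0)"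
      by blast
    then have "I i (u i \<bullet> x + \<kappa> i) = 0"
      by (simp add: I_def)
    with i(1) have "(\<Prod>i\<in>A. I i (u i \<bullet> x + \<kappa> i)) = 0"
      using finite_A by (intro prod_zero) auto
    then show ?thesis
      using False by (simp add: g_def)
  qed
  have [measurable]: "g \<in> borel_measurable borel"
    unfolding g_def by measurable
  have \<phi>_m [measurable]: "\<phi> \<in> borel_measurable borel"
    unfolding \<phi>_def by measurable
  have g\<phi>: "g (p + \<phi> y) =
      exp (\<xi> \<bullet> p) * (\<Prod>b\<in>Basis. I (e b) (y \<bullet> b) * exp ((\<xi> \<bullet> w (e b)) * (y \<bullet> b)))" for y
  proof -
    have "(\<Prod>i\<in>A. I i (u i \<bullet> (p + \<phi> y) + \<kappa> i)) =
        (\<Prod>b\<in>Basis. I (e b) (u (e b) \<bullet> (p + \<phi> y) + \<kappa> (e b)))"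
      by (rule prod.reindex_bij_betw[OF e, symmetric])
    also have "\<dots> = (\<Prod>b\<in>Basis. I (e b) (y \<bullet> b))"
      by (intro prod.cong refl) (simp add: inner_add_right apex[OF eA] u\<phi>)
    finally show ?thesis
      by (simp add: g_def inner_add_right \<xi>\<phi> exp_add exp_sum prod.distrib)
  qed
  have "has_bochner_integral lborel (\<lambda>y. g (p + \<phi> y))
      (exp (\<xi> \<bullet> p) * (\<Prod>b\<in>Basis. 1 / \<bar>\<xi> \<bullet> w (e b)\<bar>))"
    unfolding g\<phi> I_def using assms eA
    by (intro has_bochner_integral_mult_right has_bochner_integral_lborel_prod[where
          f = "\<lambda>b t. indicator {t. t < 0 \<longleftrightarrow> \<xi> \<bullet> w (e b) > 0} t * exp ((\<xi> \<bullet> w (e b)) * t)"]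
        half_line_exp_integral) auto
  also have "(\<Prod>b\<in>Basis. 1 / \<bar>\<xi> \<bullet> w (e b)\<bar>) = (\<Prod>i\<in>A. 1 / \<bar>\<xi> \<bullet> w i\<bar>)"
    by (rule prod.reindex_bij_betw[OF e])
  finally have *: "has_bochner_integral (distr lborel borel \<phi>) (\<lambda>x. g (p + x))
      (exp (\<xi> \<bullet> p) * (\<Prod>i\<in>A. 1 / \<bar>\<xi> \<bullet> w i\<bar>))"
    by (intro has_bochner_integral_distr) auto
  \<comment> \<open>The integral was computed relative to the apex; invariance of the measure undoes
    the translation by \<open>p\<close>.\<close>
  have "has_bochner_integral (distr (distr lborel borel \<phi>) borel (\<lambda>x. p + x)) g
      (exp (\<xi> \<bullet> p) * (\<Prod>i\<in>A. 1 / \<bar>\<xi> \<bullet> w i\<bar>))"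
    by (intro has_bochner_integral_distr *) auto
  then show ?thesis
    unfolding g \<phi>_def distr_frame_map_invariant[OF frame] lattice_measure_eq_distr[OF frame] .
qed

section \<open>Lattice points of a unimodular cone\<close>

lemma lattice_coordinates:
  assumes "p \<in> L" "x \<in> L"
  obtains r :: "'i \<Rightarrow> int" where "x = p + (\<Sum>i\<in>A. of_int (r i) *\<^sub>R w i)"
proof -
  have L: "L = {\<Sum>i\<in>A. of_int (r i) *\<^sub>R w i | r :: 'i \<Rightarrow> int. True}"
  proof -
    have "L = int_span (w ` A)"
      using basis by (simp add: lattice_basis_def)
    also have "\<dots> = {\<Sum>i\<in>A. of_int (r (w i)) *\<^sub>R w i | r :: 'a \<Rightarrow> int. True}"
      unfolding int_span_finite[OF finite_imageI[OF finite_A]] by (simp add: sum.reindex[OF inj_w])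
    also have "\<dots> = {\<Sum>i\<in>A. of_int (r i) *\<^sub>R w i | r :: 'i \<Rightarrow> int. True}"
    proof safe
      fix r :: "'i \<Rightarrow> int"
      show "\<exists>r'. (\<Sum>i\<in>A. real_of_int (r i) *\<^sub>R w i) = (\<Sum>i\<in>A. real_of_int (r' (w i)) *\<^sub>R w i) \<and> True"
        by (intro exI[of _ "\<lambda>a. r (inv_into A w a)"] conjI sum.cong refl TrueI)
          (simp add: inv_into_f_f[OF inj_w])
    qed auto
    finally show ?thesis .
  qed
  obtain r r' :: "'i \<Rightarrow> int" where "x = (\<Sum>i\<in>A. of_int (r i) *\<^sub>R w i)" "p = (\<Sum>i\<in>A. of_int (r' i) *\<^sub>R w i)"
    using assms L by blast
  then have "x = p + (\<Sum>i\<in>A. of_int (r i - r' i) *\<^sub>R w i)"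
    by (simp add: scaleR_diff_left sum_subtractf)
  then show thesis
    by (rule that)
qed

lemma lattice_points:
  assumes "p \<in> L"
  shows "p + (\<Sum>i\<in>A. of_int (r i) *\<^sub>R w i) \<in> L"
proof -
  have L: "L = int_span (w ` A)"
    using basis by (simp add: lattice_basis_def)
  then obtain r' :: "'a \<Rightarrow> int" where "p = (\<Sum>a\<in>w ` A. of_int (r' a) *\<^sub>R a)"
    using assms int_span_finite[OF finite_imageI[OF finite_A, of w]] by auto
  moreover have "(\<Sum>i\<in>A. of_int (r i) *\<^sub>R w i) = (\<Sum>a\<in>w ` A. of_int (r (inv_into A w a)) *\<^sub>R a)"
    unfolding sum.reindex[OF inj_w] o_def by (intro sum.cong refl) (simp add: inv_into_f_f[OF inj_w])
  ultimately have "p + (\<Sum>i\<in>A. of_int (r i) *\<^sub>R w i) =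
      (\<Sum>a\<in>w ` A. of_int (r' a + r (inv_into A w a)) *\<^sub>R a)"
    by (simp add: scaleR_add_left sum.distrib)
  then show ?thesis
    unfolding L int_span_finite[OF finite_imageI[OF finite_A]]
    by (intro CollectI exI[of _ "\<lambda>a. r' a + r (inv_into A w a)"] conjI TrueI)
qed

text \<open>On the lattice points of the cone each \<open>u i \<bullet> x + \<kappa> i\<close> runs
  through the progression \<open>a i\<close>, \<open>a i + s i\<close>, and so on; start and step
  encode strictness and flipping. The sum is a product of geometric series, whose ratios are below
  \<open>1\<close> by \<open>neg\<close>.\<close>

lemma exp_sum:
  fixes a s :: "'i \<Rightarrow> int"
  assumes "p \<in> L" and neg: "\<And>i. i \<in> A \<Longrightarrow> (\<xi> \<bullet> w i) * of_int (s i) < 0"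
    and C: "\<And>x. x \<in> L \<Longrightarrow> x \<in> C \<longleftrightarrow> (\<forall>i\<in>A. \<exists>n::nat. u i \<bullet> x + \<kappa> i = of_int (a i + s i * int n))"
  shows "has_bochner_integral (count_space L) (\<lambda>x. indicator C x * exp (\<xi> \<bullet> x))
    (exp (\<xi> \<bullet> p) * (\<Prod>i\<in>A. exp ((\<xi> \<bullet> w i) * of_int (a i)) / (1 - exp ((\<xi> \<bullet> w i) * of_int (s i)))))"
proof -
  define \<phi> where "\<phi> n = p + (\<Sum>i\<in>A. of_int (a i + s i * int (n i)) *\<^sub>R w i)" for n :: "'i \<Rightarrow> nat"
  let ?N = "A \<rightarrow>\<^sub>E (UNIV :: nat set)"
  define f where "f i n = exp ((\<xi> \<bullet> w i) * of_int (a i)) * exp ((\<xi> \<bullet> w i) * of_int (s i)) ^ n" for i and n :: nat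
  have u\<phi>: "u i \<bullet> \<phi> n + \<kappa> i = of_int (a i + s i * int (n i))" if "i \<in> A" for i n
    using inner_combination[OF that] apex[OF that] by (simp add: \<phi>_def inner_add_right)
  have s0: "s i \<noteq> 0" if "i \<in> A" for i
    using neg[OF that] by auto
  have inj: "inj_on \<phi> ?N"
  proof (rule inj_onI)
    fix m n assume mn: "m \<in> ?N" "n \<in> ?N" "\<phi> m = \<phi> n"
    have "m i = n i" if "i \<in> A" for i
      using u\<phi>[OF that, of m] u\<phi>[OF that, of n] mn(3) s0[OF that] by simp
    then show "m = n"
      using mn(1,2) by (auto intro: PiE_ext)
  qed
  have img: "\<phi> ` ?N = C \<inter> L"
  proof safe
    fix n
    show L: "\<phi> n \<in> L"
      unfolding \<phi>_def by (rule lattice_points[OF assms(1)])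
    show "\<phi> n \<in> C"
      using C[OF L] u\<phi> by blast
  next
    fix x assume x: "x \<in> C" "x \<in> L"
    obtain r :: "'i \<Rightarrow> int" where r: "x = p + (\<Sum>i\<in>A. of_int (r i) *\<^sub>R w i)"
      using lattice_coordinates[OF assms(1) x(2)] by metis
    obtain n where n: "\<And>i. i \<in> A \<Longrightarrow> u i \<bullet> x + \<kappa> i = of_int (a i + s i * int (n i))"
      using C[OF x(2)] x(1) by metis
    have "of_int (r i) = real_of_int (a i + s i * int (n i))" if "i \<in> A" for i
      using n[OF that] inner_combination[OF that, of "\<lambda>i. of_int (r i)"] apex[OF that]
      by (simp add: r inner_add_right)
    then have "x = \<phi> (restrict n A)"
      unfolding r \<phi>_def by simp
    then show "x \<in> \<phi> ` ?N"
      by simp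
  qed
  have f: "integrable (count_space UNIV) (f i)" "infsetsum (f i) UNIV =
      exp ((\<xi> \<bullet> w i) * of_int (a i)) / (1 - exp ((\<xi> \<bullet> w i) * of_int (s i)))" if "i \<in> A" for i
  proof -
    have q: "norm (exp ((\<xi> \<bullet> w i) * of_int (s i))) < 1"
      using neg[OF that] by simp
    then have "summable (\<lambda>n. norm (f i n))"
      unfolding f_def by (simp add: norm_mult norm_power)
    then show "integrable (count_space UNIV) (f i)"
      by (simp add: integrable_count_space_nat_iff)
    then have "f i sums infsetsum (f i) UNIV"
      unfolding infsetsum_def by (rule sums_integral_count_space_nat)
    moreover have "f i sums (exp ((\<xi> \<bullet> w i) * of_int (a i)) * (1 / (1 - exp ((\<xi> \<bullet> w i) * of_int (s i)))))"
      unfolding f_def by (intro sums_mult geometric_sums q)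
    ultimately show "infsetsum (f i) UNIV =
        exp ((\<xi> \<bullet> w i) * of_int (a i)) / (1 - exp ((\<xi> \<bullet> w i) * of_int (s i)))"
      using sums_unique2 by fastforce
  qed
  have exp\<phi>: "exp (\<xi> \<bullet> \<phi> n) = exp (\<xi> \<bullet> p) * (\<Prod>i\<in>A. f i (n i))" for n
  proof -
    have "\<xi> \<bullet> \<phi> n = \<xi> \<bullet> p + (\<Sum>i\<in>A. (\<xi> \<bullet> w i) * of_int (a i) + real (n i) * ((\<xi> \<bullet> w i) * of_int (s i)))"
      by (simp add: \<phi>_def inner_add_right inner_sum_right algebra_simps)
    then show ?thesis
      using finite_A by (simp add: exp_add exp_sum f_def exp_of_nat_mult)
  qed
  have "has_bochner_integral (count_space ?N) (\<lambda>n. \<Prod>i\<in>A. f i (n i)) (\<Prod>i\<in>A. infsetsum (f i) UNIV)"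
    using abs_summable_on_prod_PiE[OF finite_A, of "\<lambda>_. UNIV" f] infsetsum_prod_PiE[OF finite_A, of "\<lambda>_. UNIV" f] f(1)
    by (simp add: has_bochner_integral_iff Infinite_Set_Sum.abs_summable_on_def infsetsum_def)
  then have "has_bochner_integral (count_space ?N) (\<lambda>n. exp (\<xi> \<bullet> \<phi> n)) (exp (\<xi> \<bullet> p) * (\<Prod>i\<in>A. infsetsum (f i) UNIV))"
    unfolding exp\<phi> by (rule has_bochner_integral_mult_right)
  then have "has_bochner_integral (distr (count_space ?N) (count_space (C \<inter> L)) \<phi>) (\<lambda>x. exp (\<xi> \<bullet> x))
      (exp (\<xi> \<bullet> p) * (\<Prod>i\<in>A. infsetsum (f i) UNIV))"
    using img by (intro has_bochner_integral_distr) auto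
  also have "distr (count_space ?N) (count_space (C \<inter> L)) \<phi> = count_space (C \<inter> L)"
    using inj img by (intro distr_bij_count_space) (simp add: bij_betw_def)
  also have "\<dots> = restrict_space (count_space L) C"
    by (simp add: restrict_count_space)
  finally show ?thesis
    using f(2) by (subst (asm) has_bochner_integral_restrict_space) auto
qed

end

section \<open>Power sums over the lattice points and over the volume\<close>

text \<open>Integrability for both signs of \<open>t\<close> provides the majorant
  \<open>exp (t * y x) + exp (- t * y x)\<close> of \<open>exp \<bar>t * y x\<bar>\<close>, hence of
  all partial sums, so the exponential series may be integrated term by term.\<close>

lemma exp_integral_has_fps_expansion:
  fixes y :: "'b \<Rightarrow> real"
  assumes [measurable]: "y \<in> borel_measurable M"
    and int: "\<And>t. integrable M (\<lambda>x. indicator S x * exp (t * y x))"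
  shows "integrable M (\<lambda>x. indicator S x * y x ^ k)"
    and "(\<lambda>t. \<integral>x. indicator S x * exp (t * y x) \<partial>M) has_fps_expansion
      Abs_fps (\<lambda>k. (\<integral>x. indicator S x * y x ^ k \<partial>M) / fact k)"
proof -
  have [measurable]: "(indicator S :: 'b \<Rightarrow> real) \<in> borel_measurable M"
    using borel_measurable_integrable[OF int[of 0]] by simp
  define g where "g t x = indicator S x * (exp (t * y x) + exp (- t * y x))" for t x
  have g: "integrable M (g t)" for t
    using Bochner_Integration.integrable_add[OF int[of t] int[of "- t"]] by (simp add: g_def[abs_def] distrib_left)
  define f where "f t k x = indicator S x * ((t * y x) ^ k / fact k)" for t k x
  have f_sums: "(\<lambda>k. f t k x) sums (indicator S x * exp (t * y x))" for t x
    unfolding f_def using sums_mult[OF exp_converges[of "t * y x"]] by (simp add: scaleR_conv_of_real field_simps)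
  have norm_sums: "(\<lambda>k. norm (f t k x)) sums (indicator S x * exp \<bar>t * y x\<bar>)" for t x
  proof -
    have "(\<lambda>k. norm (f t k x)) = (\<lambda>k. indicator S x * (\<bar>t * y x\<bar> ^ k /\<^sub>R fact k))"
      by (simp add: f_def abs_mult power_abs divide_inverse mult.commute)
    then show ?thesis
      using sums_mult[OF exp_converges[of "\<bar>t * y x\<bar>"]] by simp
  qed
  have norm_le: "(\<Sum>k<n. norm (f t k x)) \<le> g t x" for t n x
  proof -
    have "(\<Sum>k<n. norm (f t k x)) \<le> indicator S x * exp \<bar>t * y x\<bar>"
      using norm_sums by (metis norm_ge_zero sum_le_suminf sums_iff finite_lessThan)
    also have "\<dots> \<le> g t x"
      unfolding g_def by (intro mult_left_mono) (auto simp: abs_if)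
    finally show ?thesis .
  qed
  have f_int: "integrable M (f t k)" for t k
  proof (rule Bochner_Integration.integrable_bound[OF g[of t]])
    show "AE x in M. norm (f t k x) \<le> norm (g t x)"
    proof (rule AE_I2)
      fix x
      have "norm (f t k x) \<le> (\<Sum>j<Suc k. norm (f t j x))"
        by (rule member_le_sum) simp_all
      also have "\<dots> \<le> g t x"
        by (rule norm_le)
      finally show "norm (f t k x) \<le> norm (g t x)"
        by simp
    qed
  qed (unfold f_def, measurable)
  have f_1: "f 1 k = (\<lambda>x. indicator S x * y x ^ k / fact k)" for k
    by (auto simp: f_def)
  have "integrable M (\<lambda>x. fact k * (indicator S x * y x ^ k / fact k))"
    using f_int[of 1 k] unfolding f_1 by (rule integrable_mult_right)
  then show int_k: "integrable M (\<lambda>x. indicator S x * y x ^ k)"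
    by simp
  show "(\<lambda>t. \<integral>x. indicator S x * exp (t * y x) \<partial>M) has_fps_expansion
      Abs_fps (\<lambda>k. (\<integral>x. indicator S x * y x ^ k \<partial>M) / fact k)"
  proof (rule has_fps_expansionI, rule always_eventually, rule allI)
    fix t
    have "summable (\<lambda>k. \<integral>x. norm (f t k x) \<partial>M)"
    proof (rule summableI_nonneg_bounded)
      fix n
      have "(\<Sum>k<n. \<integral>x. norm (f t k x) \<partial>M) = (\<integral>x. (\<Sum>k<n. norm (f t k x)) \<partial>M)"
        using f_int by simp
      also have "\<dots> \<le> (\<integral>x. g t x \<partial>M)"
        using f_int g norm_le by (intro integral_mono) auto
      finally show "(\<Sum>k<n. \<integral>x. norm (f t k x) \<partial>M) \<le> (\<integral>x. g t x \<partial>M)" .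
    qed simp
    moreover have "AE x in M. summable (\<lambda>k. norm (f t k x))"
      using norm_sums by (auto simp: sums_iff)
    ultimately have "(\<lambda>k. \<integral>x. f t k x \<partial>M) sums (\<integral>x. suminf (\<lambda>k. f t k x) \<partial>M)"
      using f_int by (intro sums_integral)
    moreover have "(\<integral>x. f t k x \<partial>M) = (\<integral>x. indicator S x * y x ^ k \<partial>M) / fact k * t ^ k" for k
    proof -
      have "f t k = (\<lambda>x. (indicator S x * y x ^ k) * (t ^ k / fact k))"
        by (auto simp: f_def power_mult_distrib)
      then show ?thesis
        by simp
    qed
    ultimately show "(\<lambda>k. fps_nth (Abs_fps (\<lambda>k. (\<integral>x. indicator S x * y x ^ k \<partial>M) / fact k)) k * t ^ k)
        sums (\<integral>x. indicator S x * exp (t * y x) \<partial>M)"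
      using f_sums by (simp add: sums_iff)
  qed
qed

text \<open>For \<open>s = 1\<close> and \<open>s = -1\<close> the expansions of \<open>bt / (1 - e\<^sup>-\<^sup>b\<^sup>t)\<close> and \<open>bt / (e\<^sup>b\<^sup>t - 1)\<close>.\<close>

definition todd_fps :: "real \<Rightarrow> real \<Rightarrow> real fps" where
  "todd_fps s b = fps_const (s * b / 2) * fps_X + Abs_fps (\<lambda>n. b ^ n * fps_nth half_over_tanh_fps n)"

lemma todd_fps_expansion:
  "(\<lambda>t. s * (b * t) / 2 + half_over_tanh (b * t)) has_fps_expansion todd_fps s b"
proof -
  have "(\<lambda>t. (s * b / 2) * t + half_over_tanh (b * t)) has_fps_expansion todd_fps s b"
    unfolding todd_fps_def
    by (intro has_fps_expansion_add has_fps_expansion_scale half_over_tanh_has_fps_expansion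
        has_fps_expansion_cmult_left has_fps_expansion_fps_X)
  then show ?thesis
    by (simp add: mult.assoc)
qed

locale simple_lattice_polytope = simple_polytope I u \<kappa> w P V active
  for I :: "'i set" and u :: "'i \<Rightarrow> 'a::euclidean_space" and \<kappa> w P V active +
  fixes L :: "'a set"
  assumes basis: "z \<in> V \<Longrightarrow> lattice_basis L (w z ` active z)"
    and V_lattice: "V \<subseteq> L"
begin

lemma vertex_cone:
  assumes "z \<in> V"
  shows "unimodular_cone (active z) u (w z) \<kappa> z L"
  by standard (use assms dual basis activeD in auto)

lemma shifted_vertex_cone:
  assumes "z \<in> V"
  shows "unimodular_cone (active z) u (w z) (\<lambda>i. \<kappa> i + h i) (shifted_vertex h z) L"
  by standard (use assms dual basis inner_shifted_vertex in auto)

section \<open>Vertex formulas for exponential integrals and sums\<close>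

lemma in_increasing_iff: "i \<in> active z \<Longrightarrow> i \<in> increasing \<xi> z \<longleftrightarrow> \<xi> \<bullet> w z i > 0"
  by (simp add: increasing_def)

text \<open>Spreads the sign of a flipped cone over its factors, one \<open>- 1\<close> per flipped
  edge. With \<open>c = \<xi> \<bullet> w z i\<close> the factor \<open>1 / \<bar>c\<bar>\<close>
  then becomes \<open>- 1 / c\<close> for either sign of \<open>c\<close>, so the vertex terms no
  longer remember which edges were flipped.\<close>

lemma sign_prod:
  "(- 1) ^ card (increasing \<xi> z) * (\<Prod>i\<in>active z. f i) =
    (\<Prod>i\<in>active z. if \<xi> \<bullet> w z i > 0 then - f i else f i :: real)"
proof -
  have "(\<Prod>i\<in>active z. if \<xi> \<bullet> w z i > 0 then - f i else f i) =
      (\<Prod>i\<in>active z. (if \<xi> \<bullet> w z i > 0 then - 1 else 1) * f i)"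
    by (intro prod.cong) auto
  also have "\<dots> = (\<Prod>i\<in>active z. if \<xi> \<bullet> w z i > 0 then - 1 else 1) * (\<Prod>i\<in>active z. f i)"
    by (rule prod.distrib)
  also have "(\<Prod>i\<in>active z. if \<xi> \<bullet> w z i > 0 then - 1 else 1) = (- 1 :: real) ^ card (increasing \<xi> z)"
    by (simp add: prod.If_cases increasing_def Int_def)
  finally show ?thesis ..
qed

theorem exp_integral_shifted:
  assumes \<xi>: "generic \<xi>" and h: "\<And>z. z \<in> V \<Longrightarrow> shifted_vertex h z \<in> shifted h"
  shows "has_bochner_integral (lattice_measure L) (\<lambda>x. indicator (shifted h) x * exp (\<xi> \<bullet> x))
    (\<Sum>z\<in>V. exp (\<xi> \<bullet> shifted_vertex h z) * (\<Prod>i\<in>active z. 1 / - (\<xi> \<bullet> w z i)))"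
proof -
  have "has_bochner_integral (lattice_measure L)
      (\<lambda>x. \<Sum>z\<in>V. (- 1) ^ card (increasing \<xi> z) *
        (indicator {x. \<forall>i\<in>active z. u i \<bullet> x + (\<kappa> i + h i) < 0 \<longleftrightarrow> \<xi> \<bullet> w z i > 0} x * exp (\<xi> \<bullet> x)))
      (\<Sum>z\<in>V. (- 1) ^ card (increasing \<xi> z) *
        (exp (\<xi> \<bullet> shifted_vertex h z) * (\<Prod>i\<in>active z. 1 / \<bar>\<xi> \<bullet> w z i\<bar>)))"
    using \<xi> by (intro has_bochner_integral_sum has_bochner_integral_mult_right
        unimodular_cone.exp_integral shifted_vertex_cone) (auto simp: generic_def)
  also have "(\<lambda>x. \<Sum>z\<in>V. (- 1) ^ card (increasing \<xi> z) *
        (indicator {x. \<forall>i\<in>active z. u i \<bullet> x + (\<kappa> i + h i) < 0 \<longleftrightarrow> \<xi> \<bullet> w z i > 0} x * exp (\<xi> \<bullet> x))) =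
      (\<lambda>x. indicator (shifted h) x * exp (\<xi> \<bullet> x))"
  proof (rule ext)
    fix x
    have set_eq: "{x. \<forall>i\<in>active z. u i \<bullet> x + (\<kappa> i + h i) < 0 \<longleftrightarrow> \<xi> \<bullet> w z i > 0} =
        {x. \<forall>i\<in>active z. u i \<bullet> x + \<kappa> i + h i < 0 \<longleftrightarrow> i \<in> increasing \<xi> z}" for z
      by (auto simp: in_increasing_iff add.assoc)
    show "(\<Sum>z\<in>V. (- 1) ^ card (increasing \<xi> z) *
        (indicator {x. \<forall>i\<in>active z. u i \<bullet> x + (\<kappa> i + h i) < 0 \<longleftrightarrow> \<xi> \<bullet> w z i > 0} x * exp (\<xi> \<bullet> x))) =
      indicator (shifted h) x * exp (\<xi> \<bullet> x)"
      unfolding set_eq by (subst signed_cones_shifted[OF \<xi> h], assumption)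
        (simp only: sum_distrib_right mult.assoc)
  qed
  also have "(\<Sum>z\<in>V. (- 1) ^ card (increasing \<xi> z) *
        (exp (\<xi> \<bullet> shifted_vertex h z) * (\<Prod>i\<in>active z. 1 / \<bar>\<xi> \<bullet> w z i\<bar>))) =
      (\<Sum>z\<in>V. exp (\<xi> \<bullet> shifted_vertex h z) * (\<Prod>i\<in>active z. 1 / - (\<xi> \<bullet> w z i)))"
    unfolding mult.left_commute[of "(- 1) ^ _"] sign_prod
    using \<xi> by (intro sum.cong arg_cong2[where f = "(*)"] prod.cong refl) auto
  finally show ?thesis .
qed

text \<open>The flag \<open>b\<close> treats the closed polytope (\<open>False\<close>) and the open
  one (\<open>True\<close>) together: they differ only in which side of each hyperplane is closed,
  that is, in where the geometric series start.\<close>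

lemma exp_sum_signed_cones:
  fixes b :: bool and S
  defines "side \<equiv> \<lambda>r :: real. if b then r \<le> 0 else r < 0"
  assumes \<xi>: "generic \<xi>"
    and S: "\<And>x. indicator S x = (\<Sum>z\<in>V. (- 1) ^ card (increasing \<xi> z) *
      indicator {x. \<forall>i\<in>active z. side (u i \<bullet> x + \<kappa> i) \<longleftrightarrow> i \<in> increasing \<xi> z} x :: real)"
  shows "has_bochner_integral (count_space L) (\<lambda>x. indicator S x * exp (\<xi> \<bullet> x))
    (\<Sum>z\<in>V. exp (\<xi> \<bullet> z) * (\<Prod>i\<in>active z.
      if b then 1 / (exp (- (\<xi> \<bullet> w z i)) - 1) else 1 / (1 - exp (\<xi> \<bullet> w z i))))"
proof -
  let ?C = "\<lambda>z. {x. \<forall>i\<in>active z. side (u i \<bullet> x + \<kappa> i) \<longleftrightarrow> i \<in> increasing \<xi> z}"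
  \<comment> \<open>The four cases for an integer \<open>r\<close>: \<open>r \<ge> 0\<close> starts
    at \<open>0\<close> and \<open>r > 0\<close> at \<open>1\<close>, both going up;
    \<open>r < 0\<close> starts at \<open>- 1\<close> and \<open>r \<le> 0\<close> at
    \<open>0\<close>, both going down.\<close>
  define a s where "a z i = (if b then 1 else 0) + (if \<xi> \<bullet> w z i > 0 then - 1 else 0 :: int)"
    and "s z i = (if \<xi> \<bullet> w z i > 0 then - 1 else 1 :: int)" for z i
  let ?g = "\<lambda>z i. exp ((\<xi> \<bullet> w z i) * of_int (a z i)) / (1 - exp ((\<xi> \<bullet> w z i) * of_int (s z i)))"
  have n: "r < 0 \<longleftrightarrow> (\<exists>n. r = - 1 - int n)" "\<not> r < 0 \<longleftrightarrow> (\<exists>n. r = int n)"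
    "r \<le> 0 \<longleftrightarrow> (\<exists>n. r = - int n)" "\<not> r \<le> 0 \<longleftrightarrow> (\<exists>n. r = 1 + int n)" for r
    by presburger+
  have cone: "x \<in> ?C z \<longleftrightarrow> (\<forall>i\<in>active z. \<exists>n::nat. u i \<bullet> x + \<kappa> i = of_int (a z i + s z i * int n))"
    if z: "z \<in> V" and x: "x \<in> L" for z x
  proof -
    interpret unimodular_cone "active z" u "w z" \<kappa> z L
      by (rule vertex_cone[OF z])
    obtain r :: "'i \<Rightarrow> int" where r: "x = z + (\<Sum>i\<in>active z. of_int (r i) *\<^sub>R w z i)"
      using lattice_coordinates[OF _ x] V_lattice z by blast
    have "(side (u i \<bullet> x + \<kappa> i) \<longleftrightarrow> i \<in> increasing \<xi> z) \<longleftrightarrow>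
        (\<exists>n::nat. u i \<bullet> x + \<kappa> i = of_int (a z i + s z i * int n))" if i: "i \<in> active z" for i
    proof -
      have eq: "u i \<bullet> x + \<kappa> i = of_int (r i)"
        using inner_combination[OF i, of "\<lambda>i. of_int (r i)"] apex[OF i] by (simp add: r inner_add_right)
      show ?thesis
        using n[of "r i"] unfolding side_def a_def s_def in_increasing_iff[OF i] eq of_int_eq_iff
        by (cases b; cases "\<xi> \<bullet> w z i > 0") simp_all
    qed
    then show ?thesis
      by simp
  qed
  have "has_bochner_integral (count_space L)
      (\<lambda>x. \<Sum>z\<in>V. (- 1) ^ card (increasing \<xi> z) * (indicator (?C z) x * exp (\<xi> \<bullet> x)))
      (\<Sum>z\<in>V. (- 1) ^ card (increasing \<xi> z) * (exp (\<xi> \<bullet> z) * (\<Prod>i\<in>active z. ?g z i)))"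
  proof (intro has_bochner_integral_sum has_bochner_integral_mult_right
        unimodular_cone.exp_sum[OF vertex_cone] cone)
    fix z i assume z: "z \<in> V"
    then show "z \<in> L"
      using V_lattice by auto
    assume "i \<in> active z"
    with z show "\<xi> \<bullet> w z i * real_of_int (s z i) < 0"
      using \<xi> by (auto simp: s_def generic_def not_less less_le)
  qed
  also have "(\<lambda>x. \<Sum>z\<in>V. (- 1) ^ card (increasing \<xi> z) * (indicator (?C z) x * exp (\<xi> \<bullet> x))) =
      (\<lambda>x. indicator S x * exp (\<xi> \<bullet> x))"
    by (simp only: S sum_distrib_right mult.assoc)
  \<comment> \<open>As rational functions, the geometric series over a half-line of integers and
    over its complement are negatives of each other, so the sign of a flip cancels.\<close>
  also have "(\<Sum>z\<in>V. (- 1) ^ card (increasing \<xi> z) * (exp (\<xi> \<bullet> z) * (\<Prod>i\<in>active z. ?g z i))) =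
      (\<Sum>z\<in>V. exp (\<xi> \<bullet> z) * (\<Prod>i\<in>active z.
        if b then 1 / (exp (- (\<xi> \<bullet> w z i)) - 1) else 1 / (1 - exp (\<xi> \<bullet> w z i))))"
    unfolding mult.left_commute[of "(- 1) ^ _"] sign_prod
  proof (intro sum.cong arg_cong2[where f = "(*)"] prod.cong refl)
    fix z i assume "z \<in> V" "i \<in> active z"
    then have "exp (\<xi> \<bullet> w z i) \<noteq> 1"
      using \<xi> by (simp add: generic_def)
    then show "(if 0 < \<xi> \<bullet> w z i then - ?g z i else ?g z i) =
        (if b then 1 / (exp (- (\<xi> \<bullet> w z i)) - 1) else 1 / (1 - exp (\<xi> \<bullet> w z i)))"
      by (auto simp: a_def s_def exp_minus divide_simps algebra_simps)
  qed
  finally show ?thesis .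
qed

theorem exp_sum_lattice:
  assumes "generic \<xi>"
  shows "has_bochner_integral (count_space L) (\<lambda>x. indicator P x * exp (\<xi> \<bullet> x))
    (\<Sum>z\<in>V. exp (\<xi> \<bullet> z) * (\<Prod>i\<in>active z. 1 / (1 - exp (\<xi> \<bullet> w z i))))"
proof -
  have "shifted_vertex (\<lambda>_. 0) z \<in> shifted (\<lambda>_. 0)" if "z \<in> V" for z
    using that V_subset by (auto simp: shifted_vertex_def in_shifted_iff in_P_iff)
  moreover have "shifted (\<lambda>_. 0) = P"
    by (simp add: shifted_def P_def)
  ultimately show ?thesis
    using exp_sum_signed_cones[OF assms, of P False] signed_cones_shifted[OF assms, of "\<lambda>_. 0"]
    by simp
qed

theorem exp_sum_lattice_interior:
  assumes "generic \<xi>"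
  shows "has_bochner_integral (count_space L)
    (\<lambda>x. indicator {x. \<forall>i\<in>I. 0 < u i \<bullet> x + \<kappa> i} x * exp (\<xi> \<bullet> x))
    (\<Sum>z\<in>V. exp (\<xi> \<bullet> z) * (\<Prod>i\<in>active z. 1 / (exp (- (\<xi> \<bullet> w z i)) - 1)))"
  by (rule exp_sum_signed_cones[OF assms, where b = True, unfolded if_True])
    (rule signed_cones_interior[OF assms])

end

context simple_lattice_polytope
begin

section \<open>From exponentials to powers of linear forms\<close>

lemma generic_scaleR:
  assumes "generic \<xi>" "t \<noteq> 0"
  shows "generic (t *\<^sub>R \<xi>)"
  using assms by (simp add: generic_def)

lemma finite_lattice_points: "finite (P \<inter> L)"
proof -
  obtain z where z: "z \<in> V"
    using V_nonempty by blast
  interpret unimodular_cone "active z" u "w z" \<kappa> z L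
    by (rule vertex_cone[OF z])
  obtain B where B: "\<And>x. x \<in> P \<Longrightarrow> norm x \<le> B"
    using bounded_P by (auto simp: bounded_iff)
  define R where "R i = \<lceil>norm (u i) * B + \<bar>\<kappa> i\<bar>\<rceil>" for i
  have "P \<inter> L \<subseteq> (\<lambda>r. z + (\<Sum>i\<in>active z. of_int (r i) *\<^sub>R w z i)) ` (\<Pi>\<^sub>E i\<in>active z. {- R i..R i})"
  proof
    fix x assume x: "x \<in> P \<inter> L"
    obtain r :: "'i \<Rightarrow> int" where r: "x = z + (\<Sum>i\<in>active z. of_int (r i) *\<^sub>R w z i)"
      using lattice_coordinates[of x] x V_lattice z by blast
    have "r i \<in> {- R i..R i}" if i: "i \<in> active z" for i
    proof -
      have "of_int (r i) = u i \<bullet> x + \<kappa> i"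
        using inner_combination[OF i, of "\<lambda>i. of_int (r i)"] apex[OF i] by (simp add: r inner_add_right)
      moreover have "\<bar>u i \<bullet> x\<bar> \<le> norm (u i) * B"
        using Cauchy_Schwarz_ineq2[of "u i" x] B[of x] x
        by (meson IntD1 mult_left_mono norm_ge_zero order_trans)
      ultimately have "\<bar>real_of_int (r i)\<bar> \<le> norm (u i) * B + \<bar>\<kappa> i\<bar>"
        by linarith
      also have "\<dots> \<le> of_int (R i)"
        by (simp add: R_def)
      finally show ?thesis
        by auto
    qed
    then show "x \<in> (\<lambda>r. z + (\<Sum>i\<in>active z. of_int (r i) *\<^sub>R w z i)) ` (\<Pi>\<^sub>E i\<in>active z. {- R i..R i})"
      unfolding r by (intro image_eqI[where x = "restrict r (active z)"]) auto
  qed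
  then show ?thesis
    by (rule finite_subset) (intro finite_imageI finite_PiE, auto)
qed

lemma sum_exp_lattice:
  assumes "S \<subseteq> P" "has_bochner_integral (count_space L) (\<lambda>x. indicator S x * exp (\<xi> \<bullet> x)) v"
  shows "(\<Sum>x\<in>S \<inter> L. exp (\<xi> \<bullet> x)) = v"
proof -
  have eq: "{x \<in> L. indicator S x * exp (\<xi> \<bullet> x) \<noteq> (0::real)} = S \<inter> L"
    by (auto simp: indicator_def)
  have "finite (S \<inter> L)"
    using finite_lattice_points assms(1) by (elim finite_subset[rotated]) auto
  then have "(\<integral>x. indicator S x * exp (\<xi> \<bullet> x) \<partial>count_space L) = (\<Sum>x\<in>S \<inter> L. indicator S x * exp (\<xi> \<bullet> x))"
    using lebesgue_integral_count_space_finite_support[of L "\<lambda>x. indicator S x * exp (\<xi> \<bullet> x)"]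
    unfolding eq by simp
  then show ?thesis
    using assms(2) by (simp add: has_bochner_integral_iff)
qed

text \<open>Replacing \<open>\<xi>\<close> by \<open>t *\<^sub>R \<xi>\<close> gives each of the
  \<open>DIM('a)\<close> factors at a vertex a simple pole at \<open>t = 0\<close>. Multiplying by
  \<open>t ^ DIM('a)\<close> leaves power series on both sides; \<open>s = 1\<close> serves the
  closed polytope and \<open>s = - 1\<close> the open one.\<close>

lemma power_sum_from_exp_sum:
  assumes "finite S" and \<xi>: "generic \<xi>"
    and g: "\<And>c. c \<noteq> 0 \<Longrightarrow> g c = (s * - c / 2 + half_over_tanh (- c)) / - c"
    and exp_sum: "\<And>\<xi>. generic \<xi> \<Longrightarrow>
      (\<Sum>x\<in>S. exp (\<xi> \<bullet> x)) = (\<Sum>z\<in>V. exp (\<xi> \<bullet> z) * (\<Prod>i\<in>active z. g (\<xi> \<bullet> w z i)))"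
  shows "(\<Sum>x\<in>S. (\<xi> \<bullet> x) ^ k) = (\<Sum>z\<in>V. fact k * (\<Prod>i\<in>active z. 1 / - (\<xi> \<bullet> w z i)) *
    fps_nth (fps_exp (\<xi> \<bullet> z) * (\<Prod>i\<in>active z. todd_fps s (- (\<xi> \<bullet> w z i)))) (k + DIM('a)))"
proof -
  define b where "b z i = - (\<xi> \<bullet> w z i)" for z i
  let ?F = "\<Sum>x\<in>S. fps_exp (\<xi> \<bullet> x)"
  let ?G = "\<Sum>z\<in>V. fps_const (\<Prod>i\<in>active z. 1 / b z i) *
    (fps_exp (\<xi> \<bullet> z) * (\<Prod>i\<in>active z. todd_fps s (b z i)))"
  have "fps_X ^ DIM('a) * ?F = ?G"
  proof (rule has_fps_expansion_unique_punctured)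
    show "(\<lambda>t. t ^ DIM('a) * (\<Sum>x\<in>S. exp ((\<xi> \<bullet> x) * t))) has_fps_expansion fps_X ^ DIM('a) * ?F"
      by (intro fps_expansion_intros)
    show "(\<lambda>t. \<Sum>z\<in>V. (\<Prod>i\<in>active z. 1 / b z i) * (exp ((\<xi> \<bullet> z) * t) *
        (\<Prod>i\<in>active z. s * (b z i * t) / 2 + half_over_tanh (b z i * t)))) has_fps_expansion ?G"
      by (intro has_fps_expansion_sum has_fps_expansion_cmult_left has_fps_expansion_mult
          has_fps_expansion_exp has_fps_expansion_prod todd_fps_expansion)
    fix t :: real assume t: "t \<noteq> 0"
    have "t ^ DIM('a) * (\<Sum>x\<in>S. exp ((\<xi> \<bullet> x) * t)) =
        t ^ DIM('a) * (\<Sum>z\<in>V. exp ((\<xi> \<bullet> z) * t) * (\<Prod>i\<in>active z. g (t * (\<xi> \<bullet> w z i))))"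
      using exp_sum[OF generic_scaleR[OF \<xi> t]] by (simp add: mult.commute)
    also have "\<dots> = (\<Sum>z\<in>V. exp ((\<xi> \<bullet> z) * t) * (\<Prod>i\<in>active z. t * g (t * (\<xi> \<bullet> w z i))))"
      by (simp add: sum_distrib_left prod.distrib card_active mult_ac)
    also have "\<dots> = (\<Sum>z\<in>V. (\<Prod>i\<in>active z. 1 / b z i) * (exp ((\<xi> \<bullet> z) * t) *
        (\<Prod>i\<in>active z. s * (b z i * t) / 2 + half_over_tanh (b z i * t))))"
    proof (rule sum.cong[OF refl])
      fix z assume z: "z \<in> V"
      have "(\<Prod>i\<in>active z. t * g (t * (\<xi> \<bullet> w z i))) =
          (\<Prod>i\<in>active z. 1 / b z i * (s * (b z i * t) / 2 + half_over_tanh (b z i * t)))"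
      proof (rule prod.cong[OF refl])
        fix i assume i: "i \<in> active z"
        then have "\<xi> \<bullet> w z i \<noteq> 0"
          using \<xi> z by (simp add: generic_def)
        then have c: "t * (\<xi> \<bullet> w z i) \<noteq> 0"
          using t by simp
        show "t * g (t * (\<xi> \<bullet> w z i)) =
            1 / b z i * (s * (b z i * t) / 2 + half_over_tanh (b z i * t))"
          using t c unfolding g[OF c] b_def by (simp add: mult.commute)
      qed
      then show "exp ((\<xi> \<bullet> z) * t) * (\<Prod>i\<in>active z. t * g (t * (\<xi> \<bullet> w z i))) =
          (\<Prod>i\<in>active z. 1 / b z i) * (exp ((\<xi> \<bullet> z) * t) *
          (\<Prod>i\<in>active z. s * (b z i * t) / 2 + half_over_tanh (b z i * t)))"
        by (simp only: prod.distrib mult.left_commute)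
    qed
    finally show "t ^ DIM('a) * (\<Sum>x\<in>S. exp ((\<xi> \<bullet> x) * t)) = \<dots>" .
  qed
  then have "fps_nth (fps_X ^ DIM('a) * ?F) (k + DIM('a)) = fps_nth ?G (k + DIM('a))"
    by simp
  then have "(\<Sum>x\<in>S. (\<xi> \<bullet> x) ^ k / fact k) = fps_nth ?G (k + DIM('a))"
    by (simp add: fps_X_power_mult_nth fps_sum_nth)
  then have "(\<Sum>x\<in>S. (\<xi> \<bullet> x) ^ k) = fact k * fps_nth ?G (k + DIM('a))"
    by (simp add: sum_divide_distrib[symmetric] field_simps)
  then show ?thesis
    by (simp add: b_def fps_sum_nth sum_distrib_left mult.assoc)
qed

theorem power_sum_lattice:
  assumes "generic \<xi>"
  shows "(\<Sum>x\<in>P \<inter> L. (\<xi> \<bullet> x) ^ k) = (\<Sum>z\<in>V. fact k * (\<Prod>i\<in>active z. 1 / - (\<xi> \<bullet> w z i)) *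
    fps_nth (fps_exp (\<xi> \<bullet> z) * (\<Prod>i\<in>active z. todd_fps 1 (- (\<xi> \<bullet> w z i)))) (k + DIM('a)))"
proof (rule power_sum_from_exp_sum[OF finite_lattice_points assms, where g = "\<lambda>c. 1 / (1 - exp c)"])
  fix c :: real assume "c \<noteq> 0"
  then show "1 / (1 - exp c) = (1 * - c / 2 + half_over_tanh (- c)) / - c"
    using todd_plus[of "- c"] by simp
qed (rule sum_exp_lattice[OF subset_refl exp_sum_lattice])

theorem power_sum_lattice_interior:
  assumes "generic \<xi>"
  shows "(\<Sum>x\<in>{x. \<forall>i\<in>I. 0 < u i \<bullet> x + \<kappa> i} \<inter> L. (\<xi> \<bullet> x) ^ k) =
    (\<Sum>z\<in>V. fact k * (\<Prod>i\<in>active z. 1 / - (\<xi> \<bullet> w z i)) *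
    fps_nth (fps_exp (\<xi> \<bullet> z) * (\<Prod>i\<in>active z. todd_fps (- 1) (- (\<xi> \<bullet> w z i)))) (k + DIM('a)))"
proof -
  have sub: "{x. \<forall>i\<in>I. 0 < u i \<bullet> x + \<kappa> i} \<subseteq> P"
    by (auto simp: in_P_iff less_imp_le)
  have "finite ({x. \<forall>i\<in>I. 0 < u i \<bullet> x + \<kappa> i} \<inter> L)"
    using finite_lattice_points by (rule finite_subset[rotated]) (use sub in auto)
  then show ?thesis
  proof (rule power_sum_from_exp_sum[OF _ assms, where g = "\<lambda>c. 1 / (exp (- c) - 1)"])
    fix c :: real assume "c \<noteq> 0"
    then show "1 / (exp (- c) - 1) = (- 1 * - c / 2 + half_over_tanh (- c)) / - c"
      using todd_minus[of "- c"] by simp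
  qed (rule sum_exp_lattice[OF sub exp_sum_lattice_interior])
qed

text \<open>Here the dependence on \<open>h\<close> must be kept: the coefficient of
  \<open>t ^ (k + DIM('a))\<close> is a combination of divided powers of functions affine in
  \<open>h\<close>, on which the derivatives are known.\<close>

theorem power_integral_shifted:
  assumes \<xi>: "generic \<xi>" and h: "\<And>z. z \<in> V \<Longrightarrow> shifted_vertex h z \<in> shifted h"
  shows "integrable (lattice_measure L) (\<lambda>x. indicator (shifted h) x * (\<xi> \<bullet> x) ^ k)"
    and "(\<integral>x. indicator (shifted h) x * (\<xi> \<bullet> x) ^ k \<partial>lattice_measure L) =
      (\<Sum>z\<in>V. fact k * (\<Prod>i\<in>active z. 1 / - (\<xi> \<bullet> w z i)) *
        divided_power (k + DIM('a)) 0 (\<xi> \<bullet> shifted_vertex h z))"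
proof -
  let ?M = "lattice_measure L"
  let ?c = "\<lambda>z. \<Prod>i\<in>active z. 1 / - (\<xi> \<bullet> w z i)"
  have exp_t: "has_bochner_integral ?M (\<lambda>x. indicator (shifted h) x * exp (t * (\<xi> \<bullet> x)))
      (\<Sum>z\<in>V. exp (t * (\<xi> \<bullet> shifted_vertex h z)) * (\<Prod>i\<in>active z. 1 / - (t * (\<xi> \<bullet> w z i))))"
    if "t \<noteq> 0" for t
    using exp_integral_shifted[OF generic_scaleR[OF \<xi> that] h] by simp
  have "closed (shifted h)"
    unfolding shifted_def by (intro polyhedron_imp_closed polyhedron_halfspace_polyhedron finite_I)
  then have [measurable]: "shifted h \<in> sets borel"
    by simp
  have int: "integrable ?M (\<lambda>x. indicator (shifted h) x * exp (t * (\<xi> \<bullet> x)))" for t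
  proof (cases "t = 0")
    case False
    then show ?thesis
      using exp_t by (simp add: has_bochner_integral_iff)
  next
    case True
    \<comment> \<open>At \<open>t = 0\<close> the scaled form is not generic, so finiteness of the
      volume is obtained from \<open>t = 1\<close> and \<open>t = - 1\<close> by means of
      \<open>1 \<le> exp y + exp (- y)\<close>.\<close>
    have "integrable ?M (\<lambda>x. indicator (shifted h) x * exp (1 * (\<xi> \<bullet> x)) +
        indicator (shifted h) x * exp (- 1 * (\<xi> \<bullet> x)))"
      using exp_t[of 1] exp_t[of "- 1"] by (intro Bochner_Integration.integrable_add) (auto simp: has_bochner_integral_iff)
    then show ?thesis
    proof (rule Bochner_Integration.integrable_bound)
      have "1 \<le> exp y + exp (- y)" for y :: real
        using one_le_exp_iff[of y] one_le_exp_iff[of "- y"] exp_gt_zero[of y] exp_gt_zero[of "- y"]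
        by linarith
      then show "AE x in ?M. norm (indicator (shifted h) x * exp (t * (\<xi> \<bullet> x))) \<le>
          norm (indicator (shifted h) x * exp (1 * (\<xi> \<bullet> x)) + indicator (shifted h) x * exp (- 1 * (\<xi> \<bullet> x)))"
        using True by (auto simp: indicator_def)
    qed measurable
  qed
  have meas: "(\<lambda>x. \<xi> \<bullet> x) \<in> borel_measurable ?M"
    by measurable
  note * = exp_integral_has_fps_expansion[OF meas int]
  show "integrable ?M (\<lambda>x. indicator (shifted h) x * (\<xi> \<bullet> x) ^ k)"
    by (rule *(1))
  let ?F = "Abs_fps (\<lambda>k. (\<integral>x. indicator (shifted h) x * (\<xi> \<bullet> x) ^ k \<partial>?M) / fact k)"
  let ?G = "\<Sum>z\<in>V. fps_const (?c z) * fps_exp (\<xi> \<bullet> shifted_vertex h z)"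
  have "fps_X ^ DIM('a) * ?F = ?G"
  proof (rule has_fps_expansion_unique_punctured)
    show "(\<lambda>t. t ^ DIM('a) * (\<integral>x. indicator (shifted h) x * exp (t * (\<xi> \<bullet> x)) \<partial>?M))
        has_fps_expansion fps_X ^ DIM('a) * ?F"
      by (intro has_fps_expansion_mult has_fps_expansion_fps_X_power *(2))
    show "(\<lambda>t. \<Sum>z\<in>V. ?c z * exp ((\<xi> \<bullet> shifted_vertex h z) * t)) has_fps_expansion ?G"
      by (intro fps_expansion_intros)
    fix t :: real assume t: "t \<noteq> 0"
    have c: "t ^ DIM('a) * (\<Prod>i\<in>active z. 1 / - (t * (\<xi> \<bullet> w z i))) = ?c z" if "z \<in> V" for z
    proof -
      have "t ^ DIM('a) * (\<Prod>i\<in>active z. 1 / - (t * (\<xi> \<bullet> w z i))) =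
          (\<Prod>i\<in>active z. t * (1 / - (t * (\<xi> \<bullet> w z i))))"
        using card_active[OF that] by (simp only: prod.distrib prod_constant)
      also have "\<dots> = ?c z"
        using t by (intro prod.cong refl) simp
      finally show ?thesis .
    qed
    have int_t: "(\<integral>x. indicator (shifted h) x * exp (t * (\<xi> \<bullet> x)) \<partial>?M) =
        (\<Sum>z\<in>V. exp (t * (\<xi> \<bullet> shifted_vertex h z)) * (\<Prod>i\<in>active z. 1 / - (t * (\<xi> \<bullet> w z i))))"
      using exp_t[OF t] by (rule has_bochner_integral_integral_eq)
    show "t ^ DIM('a) * (\<integral>x. indicator (shifted h) x * exp (t * (\<xi> \<bullet> x)) \<partial>?M) =
        (\<Sum>z\<in>V. ?c z * exp ((\<xi> \<bullet> shifted_vertex h z) * t))"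
      unfolding int_t sum_distrib_left mult.left_commute[of "t ^ _"]
      by (rule sum.cong[OF refl]) (simp only: c mult.commute)
  qed
  then have "fps_nth (fps_X ^ DIM('a) * ?F) (k + DIM('a)) = fps_nth ?G (k + DIM('a))"
    by simp
  then have "(\<integral>x. indicator (shifted h) x * (\<xi> \<bullet> x) ^ k \<partial>?M) / fact k =
      (\<Sum>z\<in>V. ?c z * divided_power (k + DIM('a)) 0 (\<xi> \<bullet> shifted_vertex h z))"
    by (simp add: fps_X_power_mult_nth fps_sum_nth divided_power_def)
  then have "(\<integral>x. indicator (shifted h) x * (\<xi> \<bullet> x) ^ k \<partial>?M) =
      fact k * (\<Sum>z\<in>V. ?c z * divided_power (k + DIM('a)) 0 (\<xi> \<bullet> shifted_vertex h z))"
    by (simp add: divide_eq_eq mult.commute)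
  then show "(\<integral>x. indicator (shifted h) x * (\<xi> \<bullet> x) ^ k \<partial>?M) =
      (\<Sum>z\<in>V. fact k * ?c z * divided_power (k + DIM('a)) 0 (\<xi> \<bullet> shifted_vertex h z))"
    by (simp only: sum_distrib_left mult.assoc)
qed

end

section \<open>The Todd operators at a vertex\<close>

lemma open_segment_opposite:
  fixes p y :: "'a::real_vector"
  assumes "0 < s" "0 < t" "y \<noteq> 0"
  shows "p \<in> open_segment (p + s *\<^sub>R y) (p - t *\<^sub>R y)"
  unfolding in_segment
\<comment> \<open>The weight \<open>c\<close> is the solution of
  \<open>(1 - c) * s = c * t\<close>.\<close>
proof (intro conjI exI[of _ "s / (s + t)"])
  have "(s + t) *\<^sub>R y \<noteq> 0"
    using assms by simp
  then show "p + s *\<^sub>R y \<noteq> p - t *\<^sub>R y"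
    by (auto simp: scaleR_add_left eq_diff_eq add.assoc)
  have "(1 - s / (s + t)) *\<^sub>R (p + s *\<^sub>R y) + (s / (s + t)) *\<^sub>R (p - t *\<^sub>R y) =
      p + ((1 - s / (s + t)) * s - s / (s + t) * t) *\<^sub>R y"
    by (simp add: algebra_simps)
  also have "(1 - s / (s + t)) * s - s / (s + t) * t = 0"
    using assms by (simp add: field_simps)
  finally show "p = (1 - s / (s + t)) *\<^sub>R (p + s *\<^sub>R y) + (s / (s + t)) *\<^sub>R (p - t *\<^sub>R y)"
    by simp
qed (use assms in auto)

locale facet_polytope = simple_lattice_polytope "{1..d}" u \<kappa> w P V active L
  for d :: nat and u :: "nat \<Rightarrow> 'a::euclidean_space" and \<kappa> w P V active L +
  fixes \<sigma> :: "nat \<Rightarrow> 'a set"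
  assumes facet: "i \<in> {1..d} \<Longrightarrow> \<sigma> i = {x \<in> P. u i \<bullet> x + \<kappa> i = 0}"
begin

\<comment> \<open>otherwise \<open>{1..d}\<close> in the locale parameters is rewritten to \<open>{Suc 0..d}\<close>\<close>
declare One_nat_def [simp del]

text \<open>The gradient of \<open>\<xi> \<bullet> shifted_vertex h z\<close> in \<open>h\<close>.
  Facets missing \<open>z\<close> do not move the vertex, so their variables are sent to
  \<open>0\<close>.\<close>

definition edge_weights :: "'a \<Rightarrow> 'a \<Rightarrow> nat \<Rightarrow> real" where
  "edge_weights \<xi> z i = (if i \<in> active z then - (\<xi> \<bullet> w z i) else 0)"

lemma shifted_polytope_eq: "shifted_polytope d u \<kappa> h = shifted h"
  by (auto simp: shifted_polytope_def in_shifted_iff)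

lemma affine_form_shifted_vertex:
  "affine_form {1..d} (\<xi> \<bullet> z) (edge_weights \<xi> z) h = \<xi> \<bullet> shifted_vertex h z"
proof -
  have "(\<Sum>i\<in>{1..d}. edge_weights \<xi> z i * h i) = (\<Sum>i\<in>active z. - (\<xi> \<bullet> w z i) * h i)"
    using active_subset by (intro sum.mono_neutral_cong_right) (auto simp: edge_weights_def)
  then show ?thesis
    by (simp add: affine_form_def shifted_vertex_def inner_diff_right inner_sum_right sum_negf mult.commute)
qed

text \<open>There is one divided power for each term of \<open>f\<close> and each vertex. The sum
  over \<open>M\<close> is treated as a whole because \<open>series_integral\<close> is built from
  \<open>deriv\<close> and an infinite sum, whose additivity becomes available only once the
  integrals are known to be polynomial near \<open>h = 0\<close>.\<close>

theorem series_integral_powers: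
  assumes "finite M" "\<And>m. m \<in> M \<Longrightarrow> generic (\<xi> m)"
  shows "series_integral L d u \<kappa> A (\<lambda>x. \<Sum>m\<in>M. c m * (\<xi> m \<bullet> x) ^ k m) =
    (\<Sum>m\<in>M. c m * (\<Sum>z\<in>V. fact (k m) * (\<Prod>i\<in>active z. 1 / - (\<xi> m \<bullet> w z i)) *
      fps_nth (fps_exp (\<xi> m \<bullet> z) * mfps_line {1..d} (edge_weights (\<xi> m) z) A) (k m + DIM('a))))"
proof -
  obtain \<epsilon> where \<epsilon>: "\<epsilon> > 0"
    "\<And>h z. (\<And>i. i \<in> {1..d} \<Longrightarrow> \<bar>h i\<bar> < \<epsilon>) \<Longrightarrow> z \<in> V \<Longrightarrow> shifted_vertex h z \<in> shifted h"
    using shifted_vertices_in_shifted by metis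
  let ?c = "\<lambda>(m, z). c m * (fact (k m) * (\<Prod>i\<in>active z. 1 / - (\<xi> m \<bullet> w z i)))"
  have "series_integral L d u \<kappa> A (\<lambda>x. \<Sum>m\<in>M. c m * (\<xi> m \<bullet> x) ^ k m) =
      (\<Sum>q\<in>M \<times> V. ?c q * fps_nth (mfps_line {1..d} (edge_weights (\<xi> (fst q)) (snd q)) A *
        fps_exp (\<xi> (fst q) \<bullet> snd q)) (k (fst q) + DIM('a)))"
  proof (rule series_integral_divided_powers[OF \<epsilon>(1)])
    show "finite (M \<times> V)"
      using assms(1) finite_V by simp
    fix h assume "h \<in> parameter_box d \<epsilon>"
    then have h: "shifted_vertex h z \<in> shifted h" if "z \<in> V" for z
      using \<epsilon>(2) that by (auto simp: parameter_box_def)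
    note power = power_integral_shifted[OF assms(2) h]
    have "(LINT x:shifted_polytope d u \<kappa> h|lattice_measure L. \<Sum>m\<in>M. c m * (\<xi> m \<bullet> x) ^ k m) =
        (\<integral>x. (\<Sum>m\<in>M. c m * (indicator (shifted h) x * (\<xi> m \<bullet> x) ^ k m)) \<partial>lattice_measure L)"
      unfolding set_lebesgue_integral_def shifted_polytope_eq
      by (simp add: sum_distrib_left mult_ac)
    also have "\<dots> = (\<Sum>m\<in>M. c m * (\<integral>x. indicator (shifted h) x * (\<xi> m \<bullet> x) ^ k m \<partial>lattice_measure L))"
      using power(1) by simp
    also have "\<dots> = (\<Sum>m\<in>M. \<Sum>z\<in>V. c m * (fact (k m) * (\<Prod>i\<in>active z. 1 / - (\<xi> m \<bullet> w z i)) *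
        divided_power (k m + DIM('a)) 0 (\<xi> m \<bullet> shifted_vertex h z)))"
      using power(2) by (simp add: sum_distrib_left)
    also have "\<dots> = (\<Sum>q\<in>M \<times> V. ?c q * divided_power (k (fst q) + DIM('a)) 0
        (affine_form {1..d} (\<xi> (fst q) \<bullet> snd q) (edge_weights (\<xi> (fst q)) (snd q)) h))"
      unfolding sum.cartesian_product affine_form_shifted_vertex
      by (intro sum.cong refl) (auto simp: mult.assoc)
    finally show "(LINT x:shifted_polytope d u \<kappa> h|lattice_measure L. \<Sum>m\<in>M. c m * (\<xi> m \<bullet> x) ^ k m) = \<dots>" .
  qed
  also have "\<dots> = (\<Sum>m\<in>M. c m * (\<Sum>z\<in>V. fact (k m) * (\<Prod>i\<in>active z. 1 / - (\<xi> m \<bullet> w z i)) *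
      fps_nth (fps_exp (\<xi> m \<bullet> z) * mfps_line {1..d} (edge_weights (\<xi> m) z) A) (k m + DIM('a))))"
    unfolding sum_distrib_left sum.cartesian_product
    by (intro sum.cong refl) (auto simp: mult.assoc mult.commute[of "mfps_line _ _ _"])
  finally show ?thesis .
qed

section \<open>Faces through a vertex as sets of tight inequalities\<close>

definition tight :: "nat set \<Rightarrow> 'a set" where
  "tight J = {x \<in> P. \<forall>j\<in>J. u j \<bullet> x + \<kappa> j = 0}"

text \<open>Only inequalities tight on all of \<open>F\<close> are tight at a relative interior
  point \<open>q\<close>. A segment from a point \<open>x\<close> of the tight set to
  \<open>q\<close> can therefore be prolonged beyond \<open>q\<close> inside \<open>P\<close>, and
  the face property puts \<open>x\<close> into \<open>F\<close>.\<close>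

lemma face_eq_tight:
  assumes "F \<in> faces P"
  shows "F = tight (facet_indices d \<sigma> F)"
proof
  have F: "F face_of P" "F \<noteq> {}"
    using assms by (auto simp: faces_def)
  show "F \<subseteq> tight (facet_indices d \<sigma> F)"
    using face_of_imp_subset[OF F(1)] facet by (auto simp: tight_def facet_indices_def)
  obtain q where q: "q \<in> rel_interior F"
    using F face_of_imp_convex rel_interior_eq_empty by blast
  then have "q \<in> F" "q \<in> P"
    using rel_interior_subset face_of_imp_subset[OF F(1)] by blast+
  have act: "active q \<subseteq> facet_indices d \<sigma> F"
  proof
    fix i assume i: "i \<in> active q"
    then have "i \<in> {1..d}"
      using active_subset by blast
    then have "\<sigma> i face_of P"
      using tight_face[of "{i}"] facet by simp
    moreover have "q \<in> \<sigma> i"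
      using i \<open>q \<in> P\<close> facet[OF \<open>i \<in> {1..d}\<close>] by (simp add: active_def)
    ultimately have "F \<subseteq> \<sigma> i"
      using subset_of_face_of[of "\<sigma> i" P F] face_of_imp_subset[OF F(1)] q by (auto simp: disjnt_iff)
    with \<open>i \<in> {1..d}\<close> show "i \<in> facet_indices d \<sigma> F"
      by (simp add: facet_indices_def)
  qed
  show "tight (facet_indices d \<sigma> F) \<subseteq> F"
  proof
    fix x assume x: "x \<in> tight (facet_indices d \<sigma> F)"
    show "x \<in> F"
    proof (cases "x = q")
      case True
      then show ?thesis
        using \<open>q \<in> F\<close> by simp
    next
      case False
      obtain \<epsilon> where \<epsilon>: "\<epsilon> > 0" "\<forall>i\<in>{1..d} - active q. 0 < u i \<bullet> (q + \<epsilon> *\<^sub>R (q - x)) + \<kappa> i"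
        using slack_direction[OF \<open>q \<in> P\<close>] by metis
      define y where "y = q + \<epsilon> *\<^sub>R (q - x)"
      have "0 \<le> u i \<bullet> y + \<kappa> i" if "i \<in> {1..d}" for i
      proof (cases "i \<in> active q")
        case True
        then have "u i \<bullet> q = - \<kappa> i" "u i \<bullet> x + \<kappa> i = 0"
          using x act activeD by (auto simp: tight_def)
        then have "u i \<bullet> q = u i \<bullet> x"
          by linarith
        then show ?thesis
          using \<open>u i \<bullet> x + \<kappa> i = 0\<close> by (simp add: y_def inner_add_right inner_diff_right)
      next
        case False
        then show ?thesis
          using \<epsilon>(2) that by (simp add: y_def less_imp_le)
      qed
      then have "y \<in> P"
        by (simp add: in_P_iff)
      moreover have "q \<in> open_segment y x"
        using open_segment_opposite[of \<epsilon> 1 "q - x" q] \<epsilon>(1) False by (simp add: y_def)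
      ultimately show ?thesis
        using face_ofD[OF F(1)] x \<open>q \<in> F\<close> by (auto simp: tight_def)
    qed
  qed
qed

context
  fixes z J
  assumes z: "z \<in> V" and J: "J \<subseteq> active z"
begin

lemma vertex_in_tight: "z \<in> tight J"
  using z J V_subset activeD by (fastforce simp: tight_def)

lemma edge_in_tight:
  assumes "i \<in> active z - J"
  obtains \<epsilon> where "\<epsilon> > 0" "z + \<epsilon> *\<^sub>R w z i \<in> tight J" "u i \<bullet> (z + \<epsilon> *\<^sub>R w z i) + \<kappa> i > 0"
proof -
  obtain \<epsilon> where \<epsilon>: "\<epsilon> > 0" "z + \<epsilon> *\<^sub>R w z i \<in> P"
    "\<And>j. j \<in> active z - {i} \<Longrightarrow> u j \<bullet> (z + \<epsilon> *\<^sub>R w z i) + \<kappa> j = 0"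
    "u i \<bullet> (z + \<epsilon> *\<^sub>R w z i) + \<kappa> i > 0"
    using edge_direction[OF z, of i] assms by blast
  then have "z + \<epsilon> *\<^sub>R w z i \<in> tight J"
    using J assms by (auto simp: tight_def)
  with \<epsilon> show thesis
    using that by blast
qed

lemma tight_in_faces: "tight J \<in> faces P"
  unfolding faces_def using tight_face[of J] J active_subset[of z] vertex_in_tight
  by (auto simp: tight_def)

text \<open>A facet containing \<open>tight J\<close> contains \<open>z\<close>, so its index is
  active; were the index outside \<open>J\<close>, the edge along \<open>w z i\<close> would stay in
  \<open>tight J\<close> and leave the facet. Thus faces through \<open>z\<close> correspond to
  subsets of \<open>active z\<close>.\<close>

lemma facet_indices_tight: "facet_indices d \<sigma> (tight J) = J"
proof
  show "J \<subseteq> facet_indices d \<sigma> (tight J)"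
    using J active_subset[of z] facet by (auto simp: facet_indices_def tight_def subset_iff)
  show "facet_indices d \<sigma> (tight J) \<subseteq> J"
  proof
    fix i assume i: "i \<in> facet_indices d \<sigma> (tight J)"
    then have id: "i \<in> {1..d}" and sub: "tight J \<subseteq> {x \<in> P. u i \<bullet> x + \<kappa> i = 0}"
      using facet by (auto simp: facet_indices_def)
    have "z \<in> {x \<in> P. u i \<bullet> x + \<kappa> i = 0}"
      using sub vertex_in_tight by (rule subsetD)
    then have "i \<in> active z"
      using id by (simp add: active_def)
    show "i \<in> J"
    proof (rule ccontr)
      assume "i \<notin> J"
      with \<open>i \<in> active z\<close> have "i \<in> active z - J"
        by simp
      then obtain \<epsilon> where \<epsilon>: "z + \<epsilon> *\<^sub>R w z i \<in> tight J" "u i \<bullet> (z + \<epsilon> *\<^sub>R w z i) + \<kappa> i > 0"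
        by (rule edge_in_tight)
      have "z + \<epsilon> *\<^sub>R w z i \<in> {x \<in> P. u i \<bullet> x + \<kappa> i = 0}"
        using sub \<epsilon>(1) by (rule subsetD)
      then show False
        using \<epsilon>(2) by simp
    qed
  qed
qed

text \<open>The edges \<open>w z i\<close> with \<open>i\<close> outside \<open>J\<close> start
  inside the face, and by \<open>expand\<close> they span its directions.\<close>

lemma codim_tight: "codim (tight J) = card J"
proof -
  let ?W = "w z ` (active z - J)"
  have "aff_dim (tight J) = int (dim ((\<lambda>x. x - z) ` tight J))"
    by (rule aff_dim_eq_dim_subtract) (rule hull_inc[OF vertex_in_tight])
  also have "dim ((\<lambda>x. x - z) ` tight J) = card ?W"
  proof (rule dim_eq_card)
    show "independent ?W"
      by (rule independent_mono[OF w_basis(1)[OF z]]) auto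
    show "span ?W = span ((\<lambda>x. x - z) ` tight J)"
    proof (rule span_eq[THEN iffD2], intro conjI)
      show "?W \<subseteq> span ((\<lambda>x. x - z) ` tight J)"
      proof
        fix a assume "a \<in> ?W"
        then obtain i where i: "i \<in> active z - J" "a = w z i"
          by auto
        obtain \<epsilon> where \<epsilon>: "\<epsilon> > 0" "z + \<epsilon> *\<^sub>R w z i \<in> tight J"
          using edge_in_tight[OF i(1)] by metis
        then have "\<epsilon> *\<^sub>R a \<in> (\<lambda>x. x - z) ` tight J"
          by (force simp: i(2))
        then have "(1 / \<epsilon>) *\<^sub>R \<epsilon> *\<^sub>R a \<in> span ((\<lambda>x. x - z) ` tight J)"
          by (intro span_scale span_base)
        then show "a \<in> span ((\<lambda>x. x - z) ` tight J)"
          using \<epsilon>(1) by simp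
      qed
      show "(\<lambda>x. x - z) ` tight J \<subseteq> span ?W"
      proof safe
        fix x assume x: "x \<in> tight J"
        have "x - z = (\<Sum>i\<in>active z. (u i \<bullet> (x - z)) *\<^sub>R w z i)"
          by (rule expand[OF z])
        also have "\<dots> = (\<Sum>i\<in>active z - J. (u i \<bullet> (x - z)) *\<^sub>R w z i)"
        proof (rule sum.mono_neutral_right)
          show "\<forall>i\<in>active z - (active z - J). (u i \<bullet> (x - z)) *\<^sub>R w z i = 0"
            using x activeD[of _ z] by (auto simp: tight_def inner_diff_right)
        qed auto
        also have "\<dots> \<in> span ?W"
          by (intro span_sum span_scale span_base) auto
        finally show "x - z \<in> span ?W" .
      qed
    qed
  qed
  also have "card ?W = DIM('a) - card J"
    using card_image[OF inj_on_subset[OF inj_on_w[OF z]], of "active z - J"] card_active[OF z] J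
    by (simp add: card_Diff_subset finite_subset)
  finally show ?thesis
    using card_mono[OF finite_active J] card_active[OF z] by (simp add: codim_def)
qed

end

text \<open>A variable of weight \<open>0\<close> annihilates the product when it occurs as a linear
  factor, and turns the tanh factor into its constant term \<open>1\<close>. Hence faces missing
  \<open>z\<close> disappear, and from the other products so do the facets missing
  \<open>z\<close>.\<close>

lemma mfps_line_face_series:
  assumes "z \<in> V"
  shows "mfps_line {1..d} (edge_weights \<xi> z) (face_series d \<sigma> F) =
    (if facet_indices d \<sigma> F \<subseteq> active z
     then (\<Prod>i\<in>facet_indices d \<sigma> F. fps_const (edge_weights \<xi> z i / 2) * fps_X) *
       (\<Prod>i\<in>active z - facet_indices d \<sigma> F. Abs_fps (\<lambda>n. edge_weights \<xi> z i ^ n * fps_nth half_over_tanh_fps n))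
     else 0)"
proof -
  let ?b = "edge_weights \<xi> z"
  let ?K = "facet_indices d \<sigma> F"
  let ?H = "\<lambda>i. Abs_fps (\<lambda>n. ?b i ^ n * fps_nth half_over_tanh_fps n)"
  have K: "?K \<subseteq> {1..d}"
    by (auto simp: facet_indices_def)
  have const: "fps_const (1 / 2) * (fps_const c * fps_X) = fps_const (c / 2) * fps_X" for c :: real
    by (simp add: mult.assoc[symmetric])
  have "mfps_line {1..d} ?b (face_series d \<sigma> F) =
      (\<Prod>i\<in>?K. mfps_line {1..d} ?b (mfps_const (1 / 2) * mfps_var i)) *
      (\<Prod>i\<in>{1..d} - ?K. mfps_line {1..d} ?b (mfps_of_fps i half_over_tanh_fps))"
    unfolding face_series_def by (simp add: mfps_line_mult mfps_line_prod)
  also have "(\<Prod>i\<in>?K. mfps_line {1..d} ?b (mfps_const (1 / 2) * mfps_var i)) =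
      (\<Prod>i\<in>?K. fps_const (?b i / 2) * fps_X)"
    using K by (intro prod.cong refl) (auto simp: mfps_line_mult mfps_line_const mfps_line_var const)
  also have "(\<Prod>i\<in>{1..d} - ?K. mfps_line {1..d} ?b (mfps_of_fps i half_over_tanh_fps)) =
      (\<Prod>i\<in>{1..d} - ?K. ?H i)"
    by (intro prod.cong refl mfps_line_of_fps) auto
  finally have eq: "mfps_line {1..d} ?b (face_series d \<sigma> F) =
      (\<Prod>i\<in>?K. fps_const (?b i / 2) * fps_X) * (\<Prod>i\<in>{1..d} - ?K. ?H i)" .
  show ?thesis
  proof (cases "?K \<subseteq> active z")
    case True
    have "fps_nth half_over_tanh_fps 0 = 1"
      using fps_nth_eq_higher_deriv[OF half_over_tanh_has_fps_expansion, of 0] by (simp add: half_over_tanh_def)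
    then have "?H i = 1" if "i \<notin> active z" for i
      using that by (intro fps_ext) (auto simp: edge_weights_def power_0_left)
    then have "(\<Prod>i\<in>{1..d} - ?K. ?H i) = (\<Prod>i\<in>active z - ?K. ?H i)"
      using active_subset by (intro prod.mono_neutral_right) auto
    then show ?thesis
      using True eq by simp
  next
    case False
    then obtain i where "i \<in> ?K" "i \<notin> active z"
      by blast
    moreover from this have "?b i = 0"
      by (simp add: edge_weights_def)
    ultimately have "(\<Prod>i\<in>?K. fps_const (?b i / 2) * fps_X) = 0"
      using finite_subset[OF K] by (intro prod_zero) auto
    then show ?thesis
      using False eq by simp
  qed
qed

text \<open>Under the correspondence with subsets of \<open>active z\<close> this is the expansion
  of a product of binomials; \<open>s ^ codim F\<close> is absorbed by giving each linear term the
  factor \<open>s\<close>.\<close>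

lemma sum_face_series_line:
  assumes z: "z \<in> V"
  shows "(\<Sum>F\<in>faces P. fps_const s ^ codim F * mfps_line {1..d} (edge_weights \<xi> z) (face_series d \<sigma> F)) =
    (\<Prod>i\<in>active z. todd_fps s (- (\<xi> \<bullet> w z i)))"
proof -
  let ?b = "edge_weights \<xi> z"
  let ?I = "facet_indices d \<sigma>"
  let ?H = "\<lambda>i. Abs_fps (\<lambda>n. ?b i ^ n * fps_nth half_over_tanh_fps n)"
  have fin: "finite (faces P)"
    using finite_polyhedron_faces[OF polyhedron_P] by (auto simp: faces_def intro: finite_subset[rotated])
  have "(\<Sum>F\<in>faces P. fps_const s ^ codim F * mfps_line {1..d} ?b (face_series d \<sigma> F)) =
      (\<Sum>F | F \<in> faces P \<and> ?I F \<subseteq> active z. fps_const s ^ codim F *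
        ((\<Prod>i\<in>?I F. fps_const (?b i / 2) * fps_X) * (\<Prod>i\<in>active z - ?I F. ?H i)))"
    using fin by (intro sum.mono_neutral_cong_right) (auto simp: mfps_line_face_series[OF z])
  also have "\<dots> = (\<Sum>J\<in>Pow (active z). fps_const s ^ card J *
        ((\<Prod>i\<in>J. fps_const (?b i / 2) * fps_X) * (\<Prod>i\<in>active z - J. ?H i)))"
  proof (rule sum.reindex_bij_witness[where i = tight and j = ?I])
    fix J assume "J \<in> Pow (active z)"
    then have J: "J \<subseteq> active z"
      by simp
    show "?I (tight J) = J"
      by (rule facet_indices_tight[OF z J])
    show "tight J \<in> {F \<in> faces P. ?I F \<subseteq> active z}"
      using tight_in_faces[OF z J] facet_indices_tight[OF z J] J by simp
  next
    fix F assume "F \<in> {F \<in> faces P. ?I F \<subseteq> active z}"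
    then have F: "F \<in> faces P" "?I F \<subseteq> active z"
      by auto
    show "tight (?I F) = F"
      by (rule face_eq_tight[OF F(1), symmetric])
    then have "codim F = card (?I F)"
      using codim_tight[OF z F(2)] by simp
    then show "fps_const s ^ card (?I F) *
        ((\<Prod>i\<in>?I F. fps_const (?b i / 2) * fps_X) * (\<Prod>i\<in>active z - ?I F. ?H i)) =
        fps_const s ^ codim F *
        ((\<Prod>i\<in>?I F. fps_const (?b i / 2) * fps_X) * (\<Prod>i\<in>active z - ?I F. ?H i))"
      by simp
    show "?I F \<in> Pow (active z)"
      using F(2) by simp
  qed
  also have "\<dots> = (\<Sum>J\<in>Pow (active z). (\<Prod>i\<in>J. fps_const (s * ?b i / 2) * fps_X) * (\<Prod>i\<in>active z - J. ?H i))"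
  proof (rule sum.cong[OF refl])
    fix J
    have "(\<Prod>i\<in>J. fps_const (s * ?b i / 2) * fps_X) = (\<Prod>i\<in>J. fps_const s * (fps_const (?b i / 2) * fps_X))"
      by (simp add: mult.assoc[symmetric])
    also have "\<dots> = fps_const s ^ card J * (\<Prod>i\<in>J. fps_const (?b i / 2) * fps_X)"
      by (simp only: prod.distrib prod_constant)
    finally show "fps_const s ^ card J *
        ((\<Prod>i\<in>J. fps_const (?b i / 2) * fps_X) * (\<Prod>i\<in>active z - J. ?H i)) =
        (\<Prod>i\<in>J. fps_const (s * ?b i / 2) * fps_X) * (\<Prod>i\<in>active z - J. ?H i)"
      by (simp only: mult.assoc)
  qed
  also have "\<dots> = (\<Prod>i\<in>active z. fps_const (s * ?b i / 2) * fps_X + ?H i)"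
    by (rule prod_add[OF finite_active, symmetric])
  also have "\<dots> = (\<Prod>i\<in>active z. todd_fps s (- (\<xi> \<bullet> w z i)))"
    by (intro prod.cong refl) (simp add: todd_fps_def edge_weights_def)
  finally show ?thesis .
qed

lemma mfps_line_T_series:
  assumes "z \<in> V"
  shows "mfps_line {1..d} (edge_weights \<xi> z) (T_series d \<sigma> P) =
    (\<Prod>i\<in>active z. todd_fps 1 (- (\<xi> \<bullet> w z i)))"
  using sum_face_series_line[OF assms, of 1] by (simp add: T_series_def mfps_line_sum)

lemma mfps_line_T_hat_series:
  assumes "z \<in> V"
  shows "mfps_line {1..d} (edge_weights \<xi> z) (T_hat_series d \<sigma> P) =
    (\<Prod>i\<in>active z. todd_fps (- 1) (- (\<xi> \<bullet> w z i)))"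
  using sum_face_series_line[OF assms, of "- 1"]
  by (simp add: T_hat_series_def mfps_line_sum mfps_line_mult mfps_line_power mfps_line_uminus
      mfps_line_1 fps_const_neg[symmetric] del: fps_const_neg)

theorem euler_maclaurin_powers:
  assumes "finite M" "\<And>m. m \<in> M \<Longrightarrow> generic (\<xi> m)"
    and f: "f = (\<lambda>x. \<Sum>m\<in>M. c m * (\<xi> m \<bullet> x) ^ k m)"
  shows "(\<Sum>x\<in>P \<inter> L. f x) = series_integral L d u \<kappa> (T_series d \<sigma> P) f"
    and "(\<Sum>x\<in>{x. \<forall>i\<in>{1..d}. 0 < u i \<bullet> x + \<kappa> i} \<inter> L. f x) =
      series_integral L d u \<kappa> (T_hat_series d \<sigma> P) f"
    and "series_integral L d u \<kappa> (mfps_const a * (A + B)) f =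
      a * (series_integral L d u \<kappa> A f + series_integral L d u \<kappa> B f)"
proof -
  have sum: "(\<Sum>x\<in>S. f x) = (\<Sum>m\<in>M. c m * (\<Sum>x\<in>S. (\<xi> m \<bullet> x) ^ k m))" for S
    unfolding f by (subst sum.swap) (simp add: sum_distrib_left)
  have series: "series_integral L d u \<kappa> A f =
    (\<Sum>m\<in>M. c m * (\<Sum>z\<in>V. fact (k m) * (\<Prod>i\<in>active z. 1 / - (\<xi> m \<bullet> w z i)) *
      fps_nth (fps_exp (\<xi> m \<bullet> z) * mfps_line {1..d} (edge_weights (\<xi> m) z) A) (k m + DIM('a))))" for A
    unfolding f using assms(1,2) by (rule series_integral_powers)
  show "(\<Sum>x\<in>P \<inter> L. f x) = series_integral L d u \<kappa> (T_series d \<sigma> P) f"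
    unfolding sum series
    by (rule sum.cong[OF refl])
      (simp only: power_sum_lattice assms(2) mfps_line_T_series cong: sum.cong)
  show "(\<Sum>x\<in>{x. \<forall>i\<in>{1..d}. 0 < u i \<bullet> x + \<kappa> i} \<inter> L. f x) =
      series_integral L d u \<kappa> (T_hat_series d \<sigma> P) f"
    unfolding sum series
    by (rule sum.cong[OF refl])
      (simp only: power_sum_lattice_interior assms(2) mfps_line_T_hat_series cong: sum.cong)
  \<comment> \<open>Linearity in the series is read off from the vertex formula, where the series
    enters only through the ring homomorphism \<open>mfps_line\<close>.\<close>
  show "series_integral L d u \<kappa> (mfps_const a * (A + B)) f =
      a * (series_integral L d u \<kappa> A f + series_integral L d u \<kappa> B f)"
    unfolding series
    by (simp add: mfps_line_mult mfps_line_const mfps_line_add distrib_left mult.left_commute[of _ "fps_const a"]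
        sum.distrib sum_distrib_left mult_ac)
qed

end

section \<open>Polynomials as sums of powers of generic linear forms\<close>

text \<open>The linear span of the powers of forms in \<open>G\<close>, generated one term at a time
  so that closure properties follow by induction.\<close>

inductive_set power_sums :: "'a::euclidean_space set \<Rightarrow> ('a \<Rightarrow> real) set" for G where
  zero: "(\<lambda>_. 0) \<in> power_sums G"
| add_power: "f \<in> power_sums G \<Longrightarrow> \<xi> \<in> G \<Longrightarrow> (\<lambda>x. f x + c * (\<xi> \<bullet> x) ^ k) \<in> power_sums G"

lemma power_sums_add:
  assumes "f \<in> power_sums G" "g \<in> power_sums G"
  shows "(\<lambda>x. f x + g x) \<in> power_sums G"
  using assms(2)
proof induction
  case (add_power g \<xi> c k)
  then show ?case
    using power_sums.add_power[of "\<lambda>x. f x + g x" G \<xi> c k] by (simp add: add.assoc)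
qed (use assms(1) in simp)

lemma power_sums_cmult: "f \<in> power_sums G \<Longrightarrow> (\<lambda>x. a * f x) \<in> power_sums G"
proof (induction rule: power_sums.induct)
  case (add_power f \<xi> c k)
  then show ?case
    using power_sums.add_power[of "\<lambda>x. a * f x" G \<xi> "a * c" k] by (simp add: distrib_left mult.assoc)
qed (simp add: power_sums.zero)

lemma power_sums_power: "\<xi> \<in> G \<Longrightarrow> (\<lambda>x. (\<xi> \<bullet> x) ^ k) \<in> power_sums G"
  using power_sums.add_power[OF power_sums.zero, of \<xi> G 1 k] by simp

lemma power_sums_sum:
  assumes "finite S" "\<And>s. s \<in> S \<Longrightarrow> f s \<in> power_sums G"
  shows "(\<lambda>x. \<Sum>s\<in>S. f s x) \<in> power_sums G"
  using assms by (induction S) (auto intro: power_sums.zero power_sums_add)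

lemma power_sums_representation:
  assumes "f \<in> power_sums G"
  obtains n :: nat and c \<xi> k
  where "f = (\<lambda>x. \<Sum>m<n. c m * (\<xi> m \<bullet> x) ^ k m)" "\<And>m. m < n \<Longrightarrow> \<xi> m \<in> G"
proof -
  have "\<exists>(n::nat) c \<xi> k. f = (\<lambda>x. \<Sum>m<n. c m * (\<xi> m \<bullet> x) ^ k m) \<and> (\<forall>m<n. \<xi> m \<in> G)"
    using assms
  proof induction
    case zero
    show ?case
      by (rule exI[of _ 0]) simp
  next
    case (add_power f \<eta> a j)
    then obtain n :: nat and c \<xi> k
      where IH: "f = (\<lambda>x. \<Sum>m<n. c m * (\<xi> m \<bullet> x) ^ k m)" "\<forall>m<n. \<xi> m \<in> G"
      by blast
    let ?c = "c(n := a)" and ?\<xi> = "\<xi>(n := \<eta>)" and ?k = "k(n := j)"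
    have "(\<lambda>x. f x + a * (\<eta> \<bullet> x) ^ j) = (\<lambda>x. \<Sum>m<Suc n. ?c m * (?\<xi> m \<bullet> x) ^ ?k m)"
      unfolding IH(1) by simp
    moreover have "\<forall>m<Suc n. ?\<xi> m \<in> G"
      using IH(2) add_power.hyps by (simp add: less_Suc_eq)
    ultimately show ?case
      by blast
  qed
  then show thesis
    using that by blast
qed

text \<open>The basis polynomials do not depend on \<open>p\<close>, so each coefficient of
  \<open>p\<close> is a fixed linear combination of the values of \<open>p\<close> on
  \<open>S\<close>.\<close>

lemma lagrange_interpolation:
  fixes p :: "real poly"
  assumes "finite S" "degree p < card S"
  shows "p = (\<Sum>s\<in>S. smult (poly p s)
    (smult (1 / (\<Prod>r\<in>S - {s}. s - r)) (\<Prod>r\<in>S - {s}. [:- r, 1:])))"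
    (is "p = ?q")
proof (rule poly_eqI_degree)
  let ?l = "\<lambda>s. smult (1 / (\<Prod>r\<in>S - {s}. s - r)) (\<Prod>r\<in>S - {s}. [:- r, 1:])"
  have l: "poly (?l s) t = (if s = t then 1 else 0)" if "s \<in> S" "t \<in> S" for s t
  proof (cases "s = t")
    case True
    have "(\<Prod>r\<in>S - {s}. s - r) \<noteq> 0"
      using assms(1) by (auto simp: prod_zero_iff)
    then show ?thesis
      using True by (simp add: poly_prod)
  next
    case False
    then have "(\<Prod>r\<in>S - {s}. t - r) = 0"
      using assms(1) that by (intro prod_zero) auto
    then show ?thesis
      using False by (simp add: poly_prod)
  qed
  show "poly p t = poly ?q t" if "t \<in> S" for t
  proof -
    have "poly ?q t = (\<Sum>s\<in>S. poly p s * (if s = t then 1 else 0))"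
      unfolding poly_sum poly_smult[of "poly p _"] using l[OF _ that] by (intro sum.cong refl) simp
    also have "\<dots> = (\<Sum>s\<in>S. if s = t then poly p s else 0)"
      by (intro sum.cong refl) simp
    also have "\<dots> = poly p t"
      using assms(1) that by simp
    finally show ?thesis ..
  qed
  show "card S > degree p"
    by (rule assms(2))
  have "card S > 0"
    using assms(2) by simp
  have "degree ?q \<le> card S - 1"
  proof (rule degree_sum_le[OF assms(1)])
    fix s assume "s \<in> S"
    have "degree (\<Prod>r\<in>S - {s}. [:- r, 1:]) \<le> (\<Sum>r\<in>S - {s}. degree [:- r, 1:])"
      using degree_prod_sum_le[of "S - {s}" "\<lambda>r. [:- r, 1:]"] assms(1) by (simp add: o_def)
    also have "\<dots> \<le> card S - 1"
      using \<open>s \<in> S\<close> assms(1) by (simp add: card_Diff_singleton)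
    finally show "degree (smult (poly p s) (?l s)) \<le> card S - 1"
      by (meson degree_smult_le order_trans)
  qed
  then show "card S > degree ?q"
    using \<open>card S > 0\<close> by linarith
qed

lemma coeff_linear_power_1: "coeff ([:a, b:] ^ n) 1 = of_nat n * a ^ (n - 1) * (b :: real)"
proof (induction n)
  case (Suc n)
  have "coeff ([:a, b:] ^ m) 0 = a ^ m" for m
    by (simp add: coeff_0_power)
  then show ?case
    using Suc by (cases n) (simp_all add: algebra_simps)
qed simp

text \<open>\<open>(\<eta>\<sqdot>x) (\<xi>\<sqdot>x)\<^sup>k\<close> is, up to a factor, the coefficient of \<open>s\<close> in \<open>((\<xi> + s\<eta>)\<sqdot>x)\<^sup>k\<^sup>+\<^sup>1\<close>, hence a
  linear combination of the values of this polynomial at \<open>k + 2\<close> generic parameters \<open>s\<close>.\<close>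

lemma power_sums_times_linear:
  fixes W :: "'a::euclidean_space set"
  defines "G \<equiv> {\<xi>. \<forall>a\<in>W. \<xi> \<bullet> a \<noteq> 0}"
  assumes W: "finite W" and f: "f \<in> power_sums G"
  shows "(\<lambda>x. (\<eta> \<bullet> x) * f x) \<in> power_sums G"
  using f
proof induction
  case zero
  then show ?case
    by (simp add: power_sums.zero)
next
  case (add_power f \<xi> c k)
  \<comment> \<open>The parameters for which the moved form leaves \<open>G\<close>: at most one for
    each \<open>a\<close>, because \<open>\<xi> \<bullet> a \<noteq> 0\<close>.\<close>
  define bad where "bad = (\<Union>a\<in>W. {s :: real. (\<xi> + s *\<^sub>R \<eta>) \<bullet> a = 0})"
  have "finite {s :: real. (\<xi> + s *\<^sub>R \<eta>) \<bullet> a = 0}" if "a \<in> W" for a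
  proof (rule finite_subset)
    show "{s :: real. (\<xi> + s *\<^sub>R \<eta>) \<bullet> a = 0} \<subseteq> {- (\<xi> \<bullet> a) / (\<eta> \<bullet> a)}"
    proof safe
      fix s :: real assume s: "(\<xi> + s *\<^sub>R \<eta>) \<bullet> a = 0"
      have "\<xi> \<bullet> a \<noteq> 0"
        using add_power.hyps that by (simp add: G_def)
      then have "\<eta> \<bullet> a \<noteq> 0"
        using s by (auto simp: inner_add_left)
      then show "s = - (\<xi> \<bullet> a) / (\<eta> \<bullet> a)"
        using s by (simp add: inner_add_left field_simps)
    qed
  qed simp
  then have "finite bad"
    using W by (simp add: bad_def)
  then have "infinite (UNIV - bad)"
    by (simp add: infinite_UNIV_char_0)
  then obtain S where S: "finite S" "card S = k + 2" "S \<subseteq> UNIV - bad"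
    using infinite_arbitrarily_large by blast
  have S_G: "\<xi> + s *\<^sub>R \<eta> \<in> G" if "s \<in> S" for s
    using S(3) that by (auto simp: bad_def G_def)
  \<comment> \<open>The linear coefficient of the Lagrange basis polynomial at \<open>s\<close>,
    independent of \<open>x\<close>.\<close>
  define l where "l s = coeff (smult (1 / (\<Prod>r\<in>S - {s}. s - r)) (\<Prod>r\<in>S - {s}. [:- r, 1:])) 1" for s
  have key: "(\<eta> \<bullet> x) * (\<xi> \<bullet> x) ^ k = (\<Sum>s\<in>S. l s / (k + 1) * ((\<xi> + s *\<^sub>R \<eta>) \<bullet> x) ^ (k + 1))" for x
  proof -
    let ?p = "[:\<xi> \<bullet> x, \<eta> \<bullet> x:] ^ (k + 1)"
    have "degree ?p \<le> degree [:\<xi> \<bullet> x, \<eta> \<bullet> x:] * (k + 1)"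
      by (rule degree_power_le)
    also have "\<dots> \<le> 1 * (k + 1)"
      by (intro mult_right_mono) auto
    finally have "degree ?p < card S"
      using S(2) by simp
    then have "coeff ?p 1 = (\<Sum>s\<in>S. poly ?p s * l s)"
      by (subst lagrange_interpolation[OF S(1)]) (simp_all only: coeff_sum coeff_smult[of "poly _ _"] l_def)
    also have "\<dots> = (\<Sum>s\<in>S. ((\<xi> + s *\<^sub>R \<eta>) \<bullet> x) ^ (k + 1) * l s)"
      by (intro sum.cong refl) (simp add: inner_add_left algebra_simps del: power_Suc)
    finally have "(k + 1) * ((\<xi> \<bullet> x) ^ k * (\<eta> \<bullet> x)) = (\<Sum>s\<in>S. ((\<xi> + s *\<^sub>R \<eta>) \<bullet> x) ^ (k + 1) * l s)"
      unfolding coeff_linear_power_1 by (simp add: mult.assoc del: power_Suc)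
    then have "(\<xi> \<bullet> x) ^ k * (\<eta> \<bullet> x) = (\<Sum>s\<in>S. ((\<xi> + s *\<^sub>R \<eta>) \<bullet> x) ^ (k + 1) * l s) / (k + 1)"
      by (simp add: nonzero_eq_divide_eq mult.commute del: power_Suc)
    then show ?thesis
      by (simp add: sum_divide_distrib mult.commute del: power_Suc)
  qed
  have "(\<lambda>x. (\<eta> \<bullet> x) * (\<xi> \<bullet> x) ^ k) \<in> power_sums G"
    unfolding key using S(1) S_G by (intro power_sums_sum power_sums_cmult power_sums_power)
  then have "(\<lambda>x. (\<eta> \<bullet> x) * f x + c * ((\<eta> \<bullet> x) * (\<xi> \<bullet> x) ^ k)) \<in> power_sums G"
    using add_power.IH by (intro power_sums_add power_sums_cmult)
  then show ?case
    by (simp add: distrib_left mult.left_commute)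
qed

theorem real_polynomial_function_power_sums:
  fixes W :: "'a::euclidean_space set"
  assumes "finite W" "0 \<notin> W" "real_polynomial_function f"
  shows "f \<in> power_sums {\<xi>. \<forall>a\<in>W. \<xi> \<bullet> a \<noteq> 0}" (is "f \<in> power_sums ?G")
proof -
  \<comment> \<open>Multiplication operators compose, so with an arbitrary \<open>g\<close> the
    product case of the induction is immediate; the claim itself is \<open>g = 1\<close>, the zeroth
    power of any generic form.\<close>
  have "(\<lambda>x. f x * g x) \<in> power_sums ?G" if "g \<in> power_sums ?G" for g
    using assms(3) that
  proof (induction arbitrary: g)
    case (linear f)
    have f: "f x = (\<Sum>b\<in>Basis. f b *\<^sub>R b) \<bullet> x" for x
    proof -
      have "f x = f (\<Sum>b\<in>Basis. (x \<bullet> b) *\<^sub>R b)"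
        by (simp add: euclidean_representation)
      also have "\<dots> = (\<Sum>b\<in>Basis. (x \<bullet> b) * f b)"
        using linear.hyps by (simp add: bounded_linear.linear linear_sum linear_scale)
      also have "\<dots> = (\<Sum>b\<in>Basis. f b *\<^sub>R b) \<bullet> x"
        unfolding inner_sum_left inner_scaleR_left
        by (intro sum.cong refl) (simp add: inner_commute mult.commute)
      finally show ?thesis .
    qed
    show ?case
      by (subst f) (rule power_sums_times_linear[OF assms(1) linear.prems])
  next
    case (const c)
    then show ?case
      by (rule power_sums_cmult)
  next
    case (add f f')
    then show ?case
      by (simp add: distrib_right power_sums_add)
  next
    case (mult f f')
    then show ?case
      by (simp add: mult.assoc)
  qed
  moreover obtain \<xi> where "\<xi> \<in> ?G"
    using exists_nonorthogonal[OF assms(1,2) open_UNIV] by auto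
  then have "(\<lambda>_. 1) \<in> power_sums ?G"
    using power_sums_power[of \<xi> ?G 0] by simp
  ultimately have "(\<lambda>x. f x * 1) \<in> power_sums ?G" .
  then show ?thesis
    by simp
qed

section \<open>Vertex cones of a polytope\<close>

text \<open>Intersect all faces containing \<open>q\<close>. On the relative boundary of the
  intersection, \<open>q\<close> would lie in one of its facets, a strictly smaller face of
  \<open>P\<close>.\<close>

lemma polytope_minimal_face:
  fixes P :: "'a::euclidean_space set"
  assumes P: "polytope P" and q: "q \<in> P"
  obtains F where "F face_of P" "q \<in> rel_interior F"
proof -
  define F where "F = \<Inter>{F. F face_of P \<and> q \<in> F}"
  have "P face_of P"
    using P by (simp add: face_of_refl polytope_imp_convex)
  then have F: "F face_of P" "q \<in> F"
    unfolding F_def using q by (auto intro!: face_of_Inter)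
  have "q \<in> rel_interior F"
  proof (rule ccontr)
    assume "q \<notin> rel_interior F"
    moreover have "polyhedron F"
      using face_of_polytope_polytope[OF P F(1)] polytope_imp_polyhedron by blast
    ultimately obtain F' where F': "F' facet_of F" "q \<in> F'"
      using rel_boundary_of_polyhedron F(2) by blast
    then have "F' face_of P"
      using F(1) face_of_trans facet_of_imp_face_of by blast
    then have "F \<subseteq> F'"
      using F'(2) by (auto simp: F_def)
    then show False
      using F'(1) facet_of_imp_subset facet_of_irrefl by (metis subset_antisym)
  qed
  with F(1) show thesis
    by (rule that)
qed

text \<open>The minimal face \<open>F\<close> of \<open>q\<close> contains \<open>v\<close>, since
  otherwise all its vertices lie strictly above the hyperplane. It has dimension \<open>1\<close>: a
  larger one would meet the hyperplane in a segment around \<open>q\<close>, against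
  extremality.\<close>

lemma vertex_figure_extreme_point:
  fixes P :: "'a::euclidean_space set"
  assumes P: "polytope P" and v: "v extreme_point_of P"
    and a: "a \<bullet> v < b" "\<And>y. y extreme_point_of P \<Longrightarrow> y \<noteq> v \<Longrightarrow> b < a \<bullet> y"
    and q: "q extreme_point_of (P \<inter> {x. a \<bullet> x = b})"
  shows "\<exists>e \<in> edges_at P v. q \<in> e"
proof -
  have qP: "q \<in> P" "a \<bullet> q = b"
    using q by (auto simp: extreme_point_of_def)
  obtain F where F: "F face_of P" "q \<in> rel_interior F"
    using polytope_minimal_face[OF P qP(1)] by blast
  then have "q \<in> F"
    using rel_interior_subset by blast
  have "v \<in> F"
  proof (rule ccontr)
    assume "v \<notin> F"
    have "compact F" "convex F"
      using face_of_imp_compact[OF polytope_imp_convex[OF P] polytope_imp_compact[OF P] F(1)]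
        face_of_imp_convex[OF F(1)] by auto
    then have "F = convex hull {x. x extreme_point_of F}"
      by (rule Krein_Milman_Minkowski)
    also have "\<dots> \<subseteq> {x. a \<bullet> x > b}"
    proof (rule hull_minimal)
      show "{x. x extreme_point_of F} \<subseteq> {x. a \<bullet> x > b}"
        using a(2) extreme_point_of_face[OF F(1)] \<open>v \<notin> F\<close> by auto
      show "convex {x. a \<bullet> x > b}"
        by (rule convex_halfspace_gt)
    qed
    finally show False
      using \<open>q \<in> F\<close> qP(2) by auto
  qed
  have "aff_dim F \<noteq> 0"
  proof
    assume "aff_dim F = 0"
    then obtain c where "F = {c}"
      by (auto simp: aff_dim_eq_0)
    then have "q = v"
      using \<open>v \<in> F\<close> \<open>q \<in> F\<close> by auto
    then show False
      using a(1) qP(2) by simp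
  qed
  moreover have "\<not> 2 \<le> aff_dim F"
  proof
    assume dim: "2 \<le> aff_dim F"
    let ?A = "affine hull F \<inter> {x. a \<bullet> x = b}"
    have q_hull: "q \<in> affine hull F"
      using \<open>q \<in> F\<close> by (rule hull_inc)
    then have "aff_dim ?A \<ge> aff_dim F - 1"
      using aff_dim_affine_Int_hyperplane[of "affine hull F" a b] qP(2) affine_affine_hull[of F] by auto
    then have "aff_dim ?A \<noteq> 0"
      using dim by simp
    then have "?A \<noteq> {q}"
      by (metis aff_dim_sing)
    then obtain q' where q': "q' \<in> ?A" "q' \<noteq> q"
      using q_hull qP(2) by auto
    obtain r where r: "r > 0" "ball q r \<inter> affine hull F \<subseteq> F"
      using F(2) by (auto simp: mem_rel_interior_ball)
    define t where "t = r / (2 * norm (q' - q))"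
    have t: "t > 0" "norm (t *\<^sub>R (q' - q)) < r"
      using r(1) q'(2) by (auto simp: t_def)
    have in_Q: "q + s *\<^sub>R (q' - q) \<in> P \<inter> {x. a \<bullet> x = b}" if "s = t \<or> s = - t" for s
    proof -
      have "q + s *\<^sub>R (q' - q) = (1 - s) *\<^sub>R q + s *\<^sub>R q'"
        by (simp add: algebra_simps)
      then have "q + s *\<^sub>R (q' - q) \<in> affine hull F"
        using q_hull q' affine_affine_hull[of F] by (auto intro!: mem_affine)
      moreover have "q + s *\<^sub>R (q' - q) \<in> ball q r"
        using t that by (auto simp: dist_norm)
      ultimately have "q + s *\<^sub>R (q' - q) \<in> P"
        using r(2) face_of_imp_subset[OF F(1)] by blast
      moreover have "a \<bullet> (q + s *\<^sub>R (q' - q)) = b"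
        using q' qP(2) by (simp add: inner_add_right inner_diff_right)
      ultimately show ?thesis
        by simp
    qed
    have "q \<in> open_segment (q + t *\<^sub>R (q' - q)) (q - t *\<^sub>R (q' - q))"
      using t(1) q'(2) by (intro open_segment_opposite) auto
    then show False
      using q in_Q[of t] in_Q[of "- t"] by (auto simp: extreme_point_of_def)
  qed
  moreover have "aff_dim F \<noteq> - 1"
    using \<open>q \<in> F\<close> aff_dim_empty[of F] by auto
  ultimately have "aff_dim F = 1"
    using aff_dim_geq[of F] by linarith
  then have "F edge_of P"
    using F(1) by (simp add: edge_of_def)
  then show ?thesis
    using \<open>v \<in> F\<close> \<open>q \<in> F\<close> by (auto simp: edges_at_def)
qed

lemma finite_edges_at:
  assumes "polytope P"
  shows "finite (edges_at P v)"
  using finite_polytope_faces[OF assms] by (auto simp: edges_at_def edge_of_def intro: finite_subset[rotated])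

text \<open>A hyperplane separating \<open>v\<close> from the other vertices cuts \<open>P\<close>
  in a section whose vertices lie on edges at \<open>v\<close>, hence inside the cone. Every other
  vertex of \<open>P\<close> lies on a ray from \<open>v\<close> through this section.\<close>

theorem polytope_subset_edge_cone:
  fixes P :: "'a::euclidean_space set"
  assumes P: "polytope P" and v: "v extreme_point_of P"
    and w: "\<And>e. e \<in> edges_at P v \<Longrightarrow> e \<subseteq> {v + t *\<^sub>R w e | t. 0 \<le> t}"
  shows "P \<subseteq> {v + (\<Sum>e\<in>edges_at P v. c e *\<^sub>R w e) | c. \<forall>e\<in>edges_at P v. 0 \<le> c e}" (is "P \<subseteq> ?C")
proof -
  let ?E = "edges_at P v"
  have fin: "finite ?E"
    by (rule finite_edges_at[OF P])
  have "convex ?C"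
  proof (rule convexI)
    fix x y and s t :: real
    assume "x \<in> ?C" "y \<in> ?C" and st: "0 \<le> s" "0 \<le> t" "s + t = 1"
    then obtain c c' where c: "x = v + (\<Sum>e\<in>?E. c e *\<^sub>R w e)" "\<forall>e\<in>?E. 0 \<le> c e"
      and c': "y = v + (\<Sum>e\<in>?E. c' e *\<^sub>R w e)" "\<forall>e\<in>?E. 0 \<le> c' e"
      by auto
    have "s *\<^sub>R x + t *\<^sub>R y = (s + t) *\<^sub>R v + (\<Sum>e\<in>?E. (s * c e + t * c' e) *\<^sub>R w e)"
      by (simp add: c(1) c'(1) scaleR_add_right scaleR_add_left scaleR_sum_right sum.distrib)
    moreover have "\<forall>e\<in>?E. 0 \<le> s * c e + t * c' e"
      using c(2) c'(2) st by simp
    ultimately show "s *\<^sub>R x + t *\<^sub>R y \<in> ?C"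
      using st(3) by (intro CollectI exI[of _ "\<lambda>e. s * c e + t * c' e"]) simp
  qed
  let ?X = "{x. x extreme_point_of P}"
  have hull_X: "P = convex hull ?X"
    using P by (intro Krein_Milman_Minkowski polytope_imp_compact polytope_imp_convex)
  have "finite ?X"
    by (rule finite_polyhedron_extreme_points[OF polytope_imp_polyhedron[OF P]])
  then have "closed (convex hull (?X - {v}))"
    by (intro compact_imp_closed finite_imp_compact_convex_hull) simp
  moreover have "v \<notin> convex hull (?X - {v})"
  proof
    assume "v \<in> convex hull (?X - {v})"
    then have "convex hull (?X - {v}) = convex hull (insert v (?X - {v}))"
      by (rule hull_redundant[symmetric])
    also have "\<dots> = P"
      using v hull_X by (simp add: insert_absorb)
    finally have "v extreme_point_of (convex hull (?X - {v}))"
      using v by simp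
    then show False
      using extreme_point_of_convex_hull by blast
  qed
  ultimately obtain a b where a: "a \<bullet> v < b" "\<forall>y\<in>convex hull (?X - {v}). b < a \<bullet> y"
    using separating_hyperplane_closed_point[OF convex_convex_hull] by blast
  have a': "b < a \<bullet> y" if "y extreme_point_of P" "y \<noteq> v" for y
    using a(2) that by (auto intro: hull_inc)
  let ?Q = "P \<inter> {x. a \<bullet> x = b}"
  have "polytope ?Q"
    using P polyhedron_hyperplane by (intro polytope_Int_polyhedron)
  then have "?Q = convex hull {x. x extreme_point_of ?Q}"
    by (intro Krein_Milman_Minkowski polytope_imp_compact polytope_imp_convex)
  also have "\<dots> \<subseteq> ?C"
  proof (rule hull_minimal)
    show "convex ?C"
      by fact
    show "{x. x extreme_point_of ?Q} \<subseteq> ?C"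
    proof
      fix q assume "q \<in> {x. x extreme_point_of ?Q}"
      then obtain e where e: "e \<in> ?E" "q \<in> e"
        using vertex_figure_extreme_point[OF P v a(1) a'] by blast
      then obtain t where t: "q = v + t *\<^sub>R w e" "0 \<le> t"
        using w by blast
      have "(\<Sum>e'\<in>?E. (if e' = e then t else 0) *\<^sub>R w e') = (\<Sum>e'\<in>?E. if e' = e then t *\<^sub>R w e' else 0)"
        by (intro sum.cong) auto
      also have "\<dots> = t *\<^sub>R w e"
        using fin e(1) by simp
      finally show "q \<in> ?C"
        using t by (intro CollectI exI[of _ "\<lambda>e'. if e' = e then t else 0"]) simp
    qed
  qed
  finally have Q: "?Q \<subseteq> ?C" .
  have "x \<in> ?C" if x: "x extreme_point_of P" for x
  proof (cases "x = v")
    case True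
    then show ?thesis
      by (intro CollectI exI[of _ "\<lambda>_. 0"]) simp
  next
    case False
    \<comment> \<open>The parameter at which the segment from \<open>v\<close> to \<open>x\<close>
      crosses the hyperplane.\<close>
    define s where "s = (b - a \<bullet> v) / (a \<bullet> x - a \<bullet> v)"
    have "b < a \<bullet> x"
      by (rule a'[OF x False])
    then have s: "0 < s" "s < 1" "s * (a \<bullet> x - a \<bullet> v) = b - a \<bullet> v"
      using a(1) by (auto simp: s_def)
    define q where "q = v + s *\<^sub>R (x - v)"
    have "q = (1 - s) *\<^sub>R v + s *\<^sub>R x"
      by (simp add: q_def algebra_simps)
    then have "q \<in> P"
      using convexD[OF polytope_imp_convex[OF P], of v x "1 - s" s] v x s by (simp add: extreme_point_of_def)
    moreover have "a \<bullet> q = b"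
      using s(3) by (simp add: q_def inner_add_right inner_diff_right)
    ultimately obtain c where c: "q = v + (\<Sum>e\<in>?E. c e *\<^sub>R w e)" "\<forall>e\<in>?E. 0 \<le> c e"
      using Q by blast
    have "x - v = (1 / s) *\<^sub>R (s *\<^sub>R (x - v))"
      using s(1) by simp
    also have "s *\<^sub>R (x - v) = (\<Sum>e\<in>?E. c e *\<^sub>R w e)"
      using c(1) by (simp add: q_def)
    finally have "x = v + (\<Sum>e\<in>?E. (1 / s * c e) *\<^sub>R w e)"
      by (simp add: scaleR_sum_right algebra_simps)
    then show ?thesis
      using c(2) s(1) by (intro CollectI exI[of _ "\<lambda>e. 1 / s * c e"]) simp
  qed
  then have "?X \<subseteq> ?C"
    by blast
  then have "convex hull ?X \<subseteq> ?C"
    using \<open>convex ?C\<close> by (rule hull_minimal)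
  then show ?thesis
    using hull_X by simp
qed

section \<open>Facet normals of a polytope with a non-singular fan\<close>

lemma inner_zero_span:
  assumes "\<And>a. a \<in> S \<Longrightarrow> c \<bullet> a = 0" "x \<in> span S"
  shows "c \<bullet> x = 0"
proof -
  have "span S \<subseteq> {x. c \<bullet> x = 0}"
    using assms(1) by (intro span_minimal subspace_hyperplane) auto
  with assms(2) show ?thesis
    by auto
qed

lemma span_int_span: "span (int_span S) = span S"
proof (rule span_eq[THEN iffD2], intro conjI)
  show "int_span S \<subseteq> span S"
    by (auto simp: int_span_def intro!: span_sum span_scale intro: span_base)
  have "x \<in> int_span S" if "x \<in> S" for x
    unfolding int_span_def using that
    by (intro CollectI exI[of _ "{x}"] exI[of _ "\<lambda>_. 1"]) simp
  then show "S \<subseteq> span (int_span S)"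
    using span_superset by blast
qed

locale lattice_polytope_data =
  fixes \<Delta> L :: "'a::euclidean_space set"
    and d :: nat
    and \<sigma> :: "nat \<Rightarrow> 'a set"
    and u :: "nat \<Rightarrow> 'a"
    and \<kappa> :: "nat \<Rightarrow> real"
  assumes lattice: "is_lattice L"
    and integral: "integral_polytope L \<Delta>"
    and nonsingular: "nonsingular_fan L \<Delta>"
    and facets: "bij_betw \<sigma> {1..d} {F. F facet_of \<Delta>}"
    and normals: "\<And>i. i \<in> {1..d} \<Longrightarrow>
      primitive_in (dual_lattice L) (u i) \<and> inward_normal \<Delta> (\<sigma> i) (u i)"
    and halfspaces: "\<Delta> = (\<Inter>i\<in>{1..d}. {x. u i \<bullet> x + \<kappa> i \<ge> 0})"
begin

lemma in_iff: "x \<in> \<Delta> \<longleftrightarrow> (\<forall>i\<in>{1..d}. 0 \<le> u i \<bullet> x + \<kappa> i)"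
  using halfspaces by blast

lemma eq_halfspace_polyhedron: "\<Delta> = halfspace_polyhedron {1..d} u \<kappa>"
  using in_iff by (auto simp: halfspace_polyhedron_def)

lemma polytope: "polytope \<Delta>" and interior_nonempty: "interior \<Delta> \<noteq> {}"
  using integral by (auto simp: integral_polytope_def)

lemma convex: "convex \<Delta>"
  by (rule polytope_imp_convex[OF polytope])

lemma facet_of: "i \<in> {1..d} \<Longrightarrow> \<sigma> i facet_of \<Delta>"
  using facets by (auto simp: bij_betw_def)

lemma u_nonzero: "i \<in> {1..d} \<Longrightarrow> u i \<noteq> 0"
  using normals by (auto simp: inward_normal_def)

text \<open>The minimum set of \<open>u i\<close> is a face containing \<open>\<sigma> i\<close>,
  and a proper one because \<open>u i \<noteq> 0\<close> and the interior is nonempty. Dimension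
  leaves no room for a proper face strictly larger than a facet.\<close>

lemma facet_eq_minimum:
  assumes i: "i \<in> {1..d}" and y: "y \<in> \<sigma> i"
  shows "\<sigma> i = \<Delta> \<inter> {x. u i \<bullet> x = u i \<bullet> y}"
proof (rule ccontr)
  let ?G = "\<Delta> \<inter> {x. u i \<bullet> x = u i \<bullet> y}"
  have \<sigma>: "\<sigma> i face_of \<Delta>" "aff_dim (\<sigma> i) = aff_dim \<Delta> - 1" "\<sigma> i \<subseteq> \<Delta>"
    using facet_of[OF i] by (auto simp: facet_of_def dest: face_of_imp_subset)
  have min: "u i \<bullet> x \<le> u i \<bullet> z" if "x \<in> \<sigma> i" "z \<in> \<Delta>" for x z
    using normals[OF i] that by (auto simp: inward_normal_def)
  have G: "?G face_of \<Delta>"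
    using min[OF y] by (intro face_of_Int_supporting_hyperplane_ge convex) auto
  have "\<sigma> i \<subseteq> ?G"
    using min \<sigma>(3) y by (auto intro: antisym)
  then have "\<sigma> i face_of ?G"
    by (rule face_of_subset[OF \<sigma>(1)]) auto
  moreover assume "\<sigma> i \<noteq> ?G"
  ultimately have "aff_dim (\<sigma> i) < aff_dim ?G"
    using G face_of_imp_convex by (intro face_of_aff_dim_lt) auto
  moreover have "?G \<noteq> \<Delta>"
  proof
    assume "?G = \<Delta>"
    then have "interior \<Delta> \<subseteq> interior {x. u i \<bullet> x = u i \<bullet> y}"
      by (intro interior_mono) auto
    then show False
      using interior_nonempty u_nonzero[OF i] by (auto simp: interior_hyperplane)
  qed
  then have "aff_dim ?G < aff_dim \<Delta>"
    using G by (intro face_of_aff_dim_lt convex) auto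
  ultimately show False
    using \<sigma>(2) by simp
qed

lemma strict_subset_interior: "{x. \<forall>i\<in>{1..d}. 0 < u i \<bullet> x + \<kappa> i} \<subseteq> interior \<Delta>"
proof -
  have "open (\<Inter>j\<in>{1..d}. {x. 0 < u j \<bullet> x + \<kappa> j})"
    by (intro open_INT ballI open_Collect_less continuous_intros) simp
  then have "(\<Inter>j\<in>{1..d}. {x. 0 < u j \<bullet> x + \<kappa> j}) \<subseteq> interior \<Delta>"
    by (intro interior_maximal) (auto simp: in_iff less_imp_le)
  then show ?thesis
    by auto
qed

text \<open>Which inequality is tight on \<open>\<sigma> i\<close> is not given. At a relative
  interior point \<open>p\<close> of \<open>\<sigma> i\<close> some inequality \<open>j\<close> is
  tight; its facet contains \<open>p\<close>, hence all of \<open>\<sigma> i\<close>, and equal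
  dimensions together with injectivity of \<open>\<sigma>\<close> give \<open>i = j\<close>.\<close>

lemma facet_eq:
  assumes i: "i \<in> {1..d}"
  shows "\<sigma> i = {x \<in> \<Delta>. u i \<bullet> x + \<kappa> i = 0}"
proof -
  have \<sigma>: "\<sigma> i face_of \<Delta>" "\<sigma> i \<noteq> {}" "aff_dim (\<sigma> i) = aff_dim \<Delta> - 1" "\<sigma> i \<subseteq> \<Delta>"
    using facet_of[OF i] by (auto simp: facet_of_def dest: face_of_imp_subset)
  obtain p where p: "p \<in> rel_interior (\<sigma> i)"
    using \<sigma> face_of_imp_convex rel_interior_eq_empty by blast
  then have "p \<in> \<sigma> i" "p \<in> \<Delta>"
    using rel_interior_subset \<sigma>(4) by blast+
  have "\<sigma> i \<noteq> \<Delta>"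
    using \<sigma>(3) by auto
  then have "p \<notin> interior \<Delta>"
    using face_of_disjoint_interior[OF \<sigma>(1)] \<open>p \<in> \<sigma> i\<close> by blast
  then obtain j where j: "j \<in> {1..d}" "\<not> 0 < u j \<bullet> p + \<kappa> j"
    using strict_subset_interior by blast
  then have pj: "u j \<bullet> p + \<kappa> j = 0"
    using \<open>p \<in> \<Delta>\<close> in_iff by (meson antisym not_less)
  obtain y where y: "y \<in> \<sigma> j"
    using facet_of[OF j(1)] by (auto simp: facet_of_def)
  then have "u j \<bullet> y \<le> u j \<bullet> p"
    using normals[OF j(1)] \<open>p \<in> \<Delta>\<close> by (auto simp: inward_normal_def)
  moreover have "y \<in> \<Delta>"
    using facet_of_imp_subset[OF facet_of[OF j(1)]] y by blast
  then have "0 \<le> u j \<bullet> y + \<kappa> j"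
    using in_iff j(1) by blast
  \<comment> \<open>The minimum of \<open>u j\<close> over \<open>\<Delta>\<close>, attained at
    \<open>y\<close>, is at least \<open>- \<kappa> j\<close>, and \<open>p\<close> attains this
    bound.\<close>
  ultimately have yj: "u j \<bullet> y = u j \<bullet> p" "u j \<bullet> y = - \<kappa> j"
    using pj by auto
  then have "p \<in> \<sigma> j"
    using facet_eq_minimum[OF j(1) y] \<open>p \<in> \<Delta>\<close> by auto
  then have "\<sigma> i \<subseteq> \<sigma> j"
    using subset_of_face_of[of "\<sigma> j" \<Delta> "\<sigma> i"] facet_of_imp_face_of[OF facet_of[OF j(1)]] p \<sigma>(4) by blast
  then have "\<sigma> i face_of \<sigma> j"
    using face_of_subset[OF \<sigma>(1)] facet_of_imp_subset[OF facet_of[OF j(1)]] by blast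
  moreover have "aff_dim (\<sigma> j) = aff_dim (\<sigma> i)"
    using facet_of[OF j(1)] \<sigma>(3) by (simp add: facet_of_def)
  ultimately have "\<sigma> i = \<sigma> j"
    using face_of_aff_dim_lt[of "\<sigma> j" "\<sigma> i"] face_of_imp_convex[OF facet_of_imp_face_of[OF facet_of[OF j(1)]]]
    by auto
  then have "i = j"
    using facets i j(1) by (auto simp: bij_betw_def dest: inj_onD)
  with facet_eq_minimum[OF j(1) y] have "\<sigma> i = \<Delta> \<inter> {x. u i \<bullet> x = - \<kappa> i}"
    unfolding yj(2) by simp
  moreover have "u i \<bullet> x = - \<kappa> i \<longleftrightarrow> u i \<bullet> x + \<kappa> i = 0" for x
    by linarith
  ultimately show ?thesis
    by blast
qed

lemma interior_eq: "interior \<Delta> = {x. \<forall>i\<in>{1..d}. 0 < u i \<bullet> x + \<kappa> i}"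
proof
  show "{x. \<forall>i\<in>{1..d}. 0 < u i \<bullet> x + \<kappa> i} \<subseteq> interior \<Delta>"
    by (rule strict_subset_interior)
  show "interior \<Delta> \<subseteq> {x. \<forall>i\<in>{1..d}. 0 < u i \<bullet> x + \<kappa> i}"
  proof safe
    fix x i assume x: "x \<in> interior \<Delta>" and i: "i \<in> {1..d}"
    then have "x \<in> \<Delta>"
      using interior_subset by blast
    then have "0 \<le> u i \<bullet> x + \<kappa> i"
      using in_iff i by blast
    moreover have "\<sigma> i \<inter> interior \<Delta> = {}"
      using facet_of[OF i] by (intro face_of_disjoint_interior) (auto simp: facet_of_def)
    then have "u i \<bullet> x + \<kappa> i \<noteq> 0"
      using facet_eq[OF i] x \<open>x \<in> \<Delta>\<close> by auto
    ultimately show "0 < u i \<bullet> x + \<kappa> i"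
      by simp
  qed
qed

definition active :: "'a \<Rightarrow> nat set" where
  "active v = {i \<in> {1..d}. u i \<bullet> v + \<kappa> i = 0}"

lemma span_lattice: "span L = UNIV"
proof -
  obtain B where "span B = UNIV" "L = int_span B"
    using lattice by (auto simp: is_lattice_def lattice_basis_def)
  then show ?thesis
    by (simp add: span_int_span)
qed

text \<open>The edge generators form a lattice basis, being \<open>DIM('a)\<close> vectors that
  generate \<open>L\<close>. A facet through \<open>v\<close> has codimension one, so its normal
  vanishes on all generators but one, and primitivity forces the value \<open>1\<close> there.
  \<open>W\<close> indexes each generator by the facet that it leaves.\<close>

lemma vertex_frame:
  assumes v: "v extreme_point_of \<Delta>"
  obtains W where "inj_on W (active v)" "lattice_basis L (W ` active v)" "card (active v) = DIM('a)"
    "\<And>i j. i \<in> active v \<Longrightarrow> j \<in> active v \<Longrightarrow> u i \<bullet> W j = (if i = j then 1 else 0)"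
proof -
  let ?E = "edges_at \<Delta> v"
  obtain w where cardE: "card ?E = DIM('a)"
    and rays: "\<And>e. e \<in> ?E \<Longrightarrow> e \<subseteq> {v + t *\<^sub>R w e | t. 0 \<le> t}"
    and gen: "int_span (w ` ?E) = L"
    using nonsingular v unfolding nonsingular_fan_def by blast
  have finE: "finite ?E"
    by (rule finite_edges_at[OF polytope])
  have vD: "v \<in> \<Delta>"
    using v by (simp add: extreme_point_of_def)
  have span_w: "span (w ` ?E) = UNIV"
    using span_lattice span_int_span[of "w ` ?E"] gen by simp
  have ind: "independent (w ` ?E)"
    using card_image_le[OF finE, of w] cardE span_w finE by (intro card_le_dim_spanning[of _ UNIV]) auto
  then have "card (w ` ?E) = card ?E"
    using dim_span_eq_card_independent[OF ind] span_w cardE by simp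
  then have inj_w: "inj_on w ?E"
    by (rule eq_card_imp_inj_on[OF finE])
  have w_in_L: "w e \<in> L" if "e \<in> ?E" for e
    unfolding gen[symmetric] int_span_def using that
    by (intro CollectI exI[of _ "{w e}"] exI[of _ "\<lambda>_. 1"]) simp
  have cone: "\<exists>c. (\<forall>e\<in>?E. 0 \<le> c e) \<and> x = v + (\<Sum>e\<in>?E. c e *\<^sub>R w e)" if "x \<in> \<Delta>" for x
    using polytope_subset_edge_cone[OF polytope v rays] that by blast
  have nonneg: "0 \<le> u i \<bullet> w e" if i: "i \<in> active v" and e: "e \<in> ?E" for i e
  proof -
    have "e \<noteq> {v}" "v \<in> e" "e \<subseteq> \<Delta>"
      using e by (auto simp: edges_at_def edge_of_def dest: face_of_imp_subset)
    then obtain x where x: "x \<in> e" "x \<noteq> v" "x \<in> \<Delta>"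
      by blast
    then obtain t where t: "x = v + t *\<^sub>R w e" "0 \<le> t"
      using rays[OF e] by blast
    then have "t > 0"
      using x(2) by (cases "t = 0") auto
    have "0 \<le> u i \<bullet> x + \<kappa> i" "u i \<bullet> v + \<kappa> i = 0"
      using x(3) i in_iff by (auto simp: active_def)
    then have "0 \<le> t * (u i \<bullet> w e)"
      by (simp add: t(1) inner_add_right)
    then show ?thesis
      using \<open>t > 0\<close> by (simp add: zero_le_mult_iff)
  qed
  have ints: "u i \<bullet> w e \<in> \<int>" if "i \<in> {1..d}" "e \<in> ?E" for i e
    using normals[OF that(1)] w_in_L[OF that(2)] by (auto simp: primitive_in_def dual_lattice_def)
  have "\<exists>e\<in>?E. \<forall>e'\<in>?E. u i \<bullet> w e' = (if e' = e then 1 else 0)" if i: "i \<in> active v" for i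
  proof -
    have id: "i \<in> {1..d}" and iv: "u i \<bullet> v + \<kappa> i = 0"
      using i by (auto simp: active_def)
    define E\<^sub>0 where "E\<^sub>0 = {e \<in> ?E. u i \<bullet> w e = 0}"
    \<comment> \<open>Points of \<open>\<Delta>\<close> are nonnegative combinations of the
      generators, on which \<open>u i\<close> is nonnegative; on the facet all contributions must
      vanish, so only generators in the facet occur, and by dimension there are at least
      \<open>DIM('a) - 1\<close> of them.\<close>
    have "(\<lambda>x. x - v) ` \<sigma> i \<subseteq> span (w ` E\<^sub>0)"
    proof safe
      fix x assume "x \<in> \<sigma> i"
      then have x: "x \<in> \<Delta>" "u i \<bullet> x + \<kappa> i = 0"
        using facet_eq[OF id] by auto
      obtain c where c: "\<forall>e\<in>?E. 0 \<le> c e" "x = v + (\<Sum>e\<in>?E. c e *\<^sub>R w e)"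
        using cone[OF x(1)] by blast
      have "(\<Sum>e\<in>?E. c e * (u i \<bullet> w e)) = 0"
        using x(2) iv by (simp add: c(2) inner_add_right inner_sum_right)
      then have zero: "\<forall>e\<in>?E. c e * (u i \<bullet> w e) = 0"
        using c(1) nonneg[OF i] finE by (subst (asm) sum_nonneg_eq_0_iff) auto
      have "x - v = (\<Sum>e\<in>?E. c e *\<^sub>R w e)"
        by (simp add: c(2))
      also have "\<dots> = (\<Sum>e\<in>E\<^sub>0. c e *\<^sub>R w e)"
        using finE zero by (intro sum.mono_neutral_right) (auto simp: E\<^sub>0_def)
      also have "\<dots> \<in> span (w ` E\<^sub>0)"
        by (intro span_sum span_scale span_base) auto
      finally show "x - v \<in> span (w ` E\<^sub>0)" .
    qed
    moreover have "v \<in> \<sigma> i"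
      using facet_eq[OF id] vD iv by simp
    then have "aff_dim (\<sigma> i) = int (dim ((\<lambda>x. x - v) ` \<sigma> i))"
      by (intro aff_dim_eq_dim_subtract hull_inc)
    moreover have "aff_dim (\<sigma> i) = int DIM('a) - 1"
      using facet_of[OF id] interior_nonempty by (simp add: facet_of_def aff_dim_nonempty_interior)
    ultimately have "DIM('a) - 1 \<le> dim (span (w ` E\<^sub>0))"
      using dim_subset[of "(\<lambda>x. x - v) ` \<sigma> i" "span (w ` E\<^sub>0)"] by linarith
    also have "\<dots> \<le> card (w ` E\<^sub>0)"
      using finE by (simp add: dim_le_card' E\<^sub>0_def)
    also have "\<dots> \<le> card E\<^sub>0"
      using finE by (intro card_image_le) (simp add: E\<^sub>0_def)
    finally have "DIM('a) - 1 \<le> card E\<^sub>0" .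
    moreover have "E\<^sub>0 \<subseteq> ?E"
      by (auto simp: E\<^sub>0_def)
    then have "card (?E - E\<^sub>0) = DIM('a) - card E\<^sub>0"
      using finE cardE by (simp add: card_Diff_subset finite_subset)
    moreover have "?E - E\<^sub>0 \<noteq> {}"
    proof
      assume "?E - E\<^sub>0 = {}"
      then have zero: "u i \<bullet> a = 0" if "a \<in> w ` ?E" for a
        using that by (auto simp: E\<^sub>0_def)
      have "u i \<bullet> u i = 0"
        by (rule inner_zero_span[of "w ` ?E"], rule zero, assumption, simp add: span_w)
      then show False
        using u_nonzero[OF id] by simp
    qed
    then have "card (?E - E\<^sub>0) > 0"
      using finE by (simp add: card_gt_0_iff)
    ultimately have "card (?E - E\<^sub>0) = 1"
      by linarith
    then obtain e where e: "?E - E\<^sub>0 = {e}"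
      by (auto simp: card_1_singleton_iff)
    then have eE: "e \<in> ?E" and ue: "u i \<bullet> w e \<noteq> 0"
      by (auto simp: E\<^sub>0_def)
    have others: "u i \<bullet> w e' = 0" if "e' \<in> ?E" "e' \<noteq> e" for e'
      using e that by (auto simp: E\<^sub>0_def)
    obtain k :: int where k: "u i \<bullet> w e = of_int k"
      using ints[OF id eE] by (auto elim: Ints_cases)
    \<comment> \<open>On the generators \<open>u i\<close> takes only the values \<open>0\<close>
      and \<open>k\<close>, so division by \<open>k\<close> keeps it integral on \<open>L\<close>.
      Primitivity leaves \<open>k = 1\<close> or \<open>k = - 1\<close>, and \<open>nonneg\<close>
      excludes the latter.\<close>
    have "(1 / of_int k) *\<^sub>R u i \<in> dual_lattice L"
      unfolding dual_lattice_def
    proof safe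
      fix x assume "x \<in> L"
      then obtain r :: "'a \<Rightarrow> int" where "x = (\<Sum>a\<in>w ` ?E. of_int (r a) *\<^sub>R a)"
        using gen int_span_finite[of "w ` ?E"] finE by auto
      then have "(1 / of_int k) *\<^sub>R u i \<bullet> x = (\<Sum>e'\<in>?E. of_int (r (w e')) * (u i \<bullet> w e') / of_int k)"
        by (simp add: sum.reindex[OF inj_w] inner_sum_right sum_divide_distrib)
      also have "\<dots> \<in> \<int>"
      proof (rule Ints_sum)
        fix e' assume "e' \<in> ?E"
        then show "of_int (r (w e')) * (u i \<bullet> w e') / of_int k \<in> \<int>"
          using others[of e'] k ue by (cases "e' = e") auto
      qed
      finally show "(1 / of_int k) *\<^sub>R u i \<bullet> x \<in> \<int>" .
    qed
    moreover have "u i = of_int k *\<^sub>R ((1 / of_int k) *\<^sub>R u i)"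
      using k ue by simp
    ultimately have "\<bar>k\<bar> = 1"
      using normals[OF id] unfolding primitive_in_def by blast
    then have "u i \<bullet> w e = 1"
      using nonneg[OF i eE] k by auto
    then show ?thesis
      using eE others by (intro bexI[of _ e]) auto
  qed
  then obtain \<epsilon> where \<epsilon>: "\<And>i. i \<in> active v \<Longrightarrow> \<epsilon> i \<in> ?E"
    "\<And>i e'. i \<in> active v \<Longrightarrow> e' \<in> ?E \<Longrightarrow> u i \<bullet> w e' = (if e' = \<epsilon> i then 1 else 0)"
    by metis
  \<comment> \<open>Two normals with the same exceptional edge agree on a basis, hence are equal;
    both are tight at \<open>v\<close>, so the constants agree and the facets coincide.\<close>
  have inj_\<epsilon>: "inj_on \<epsilon> (active v)"
  proof (rule inj_onI)
    fix i j assume ij: "i \<in> active v" "j \<in> active v" "\<epsilon> i = \<epsilon> j"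
    have zero: "(u i - u j) \<bullet> a = 0" if "a \<in> w ` ?E" for a
      using that \<epsilon>(2)[OF ij(1)] \<epsilon>(2)[OF ij(2)] ij(3) by (auto simp: inner_diff_left)
    have "(u i - u j) \<bullet> (u i - u j) = 0"
      by (rule inner_zero_span[of "w ` ?E"], rule zero, assumption, simp add: span_w)
    then have uij: "u i = u j"
      by simp
    have "i \<in> {1..d}" "j \<in> {1..d}" "\<kappa> i = \<kappa> j"
      using ij uij by (auto simp: active_def)
    then have "\<sigma> i = \<sigma> j"
      using facet_eq[of i] facet_eq[of j] uij by simp
    then show "i = j"
      using facets \<open>i \<in> {1..d}\<close> \<open>j \<in> {1..d}\<close> by (auto simp: bij_betw_def dest: inj_onD)
  qed
  have surj: "\<epsilon> ` active v = ?E"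
  proof
    show "\<epsilon> ` active v \<subseteq> ?E"
      using \<epsilon>(1) by auto
    show "?E \<subseteq> \<epsilon> ` active v"
    proof (rule ccontr)
      \<comment> \<open>A generator annihilated by all normals active at \<open>v\<close> could be
        followed from \<open>v\<close> both ways inside \<open>\<Delta>\<close>, against
        extremality.\<close>
      assume "\<not> ?E \<subseteq> \<epsilon> ` active v"
      then obtain e where e: "e \<in> ?E" "e \<notin> \<epsilon> ` active v"
        by blast
      have zero: "u i \<bullet> w e = 0" if "i \<in> active v" for i
        using \<epsilon>(2)[OF that e(1)] e(2) that by auto
      have "w e \<noteq> 0"
        using ind e(1) by (metis dependent_zero imageI)
      have line: "\<exists>s>0. v + s *\<^sub>R y \<in> \<Delta>" if y: "y = w e \<or> y = - w e" for y
      proof -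
        obtain s where s: "s > 0" "\<forall>i\<in>{1..d} - {i. u i \<bullet> v + \<kappa> i = 0}. 0 < u i \<bullet> (v + s *\<^sub>R y) + \<kappa> i"
          using halfspace_slack_direction[of "{1..d}" v u \<kappa> y] vD eq_halfspace_polyhedron by auto
        have "0 \<le> u i \<bullet> (v + s *\<^sub>R y) + \<kappa> i" if i: "i \<in> {1..d}" for i
        proof (cases "i \<in> active v")
          case True
          then have "u i \<bullet> y = 0" "u i \<bullet> v + \<kappa> i = 0"
            using zero y by (auto simp: active_def)
          then show ?thesis
            by (simp add: inner_add_right)
        next
          case False
          then show ?thesis
            using s(2) i by (auto simp: active_def less_imp_le)
        qed
        then show ?thesis
          using s(1) in_iff by blast
      qed
      obtain s t where st: "s > 0" "v + s *\<^sub>R w e \<in> \<Delta>" "t > 0" "v + t *\<^sub>R - w e \<in> \<Delta>"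
        using line[of "w e"] line[of "- w e"] by blast
      have "v \<in> open_segment (v + s *\<^sub>R w e) (v - t *\<^sub>R w e)"
        using st \<open>w e \<noteq> 0\<close> by (intro open_segment_opposite)
      then show False
        using v st by (auto simp: extreme_point_of_def)
    qed
  qed
  show thesis
  proof (rule that[of "w \<circ> \<epsilon>"])
    show "inj_on (w \<circ> \<epsilon>) (active v)"
      using inj_\<epsilon> inj_w surj by (intro comp_inj_on) auto
    have "(w \<circ> \<epsilon>) ` active v = w ` ?E"
      using surj by (metis image_comp)
    then show "lattice_basis L ((w \<circ> \<epsilon>) ` active v)"
      using ind span_w gen by (simp add: lattice_basis_def)
    show "card (active v) = DIM('a)"
      using card_image[OF inj_\<epsilon>] surj cardE by simp
    show "u i \<bullet> (w \<circ> \<epsilon>) j = (if i = j then 1 else 0)" if "i \<in> active v" "j \<in> active v" for i j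
      using \<epsilon>(2)[OF that(1) \<epsilon>(1)[OF that(2)]] inj_onD[OF inj_\<epsilon>] that by auto
  qed
qed

lemma facet_polytope:
  obtains w where "facet_polytope d u \<kappa> w L \<sigma>"
proof -
  have "\<exists>W. lattice_basis L (W ` active v) \<and> card (active v) = DIM('a) \<and>
      (\<forall>i\<in>active v. \<forall>j\<in>active v. u i \<bullet> W j = (if i = j then 1 else 0))"
    if "v extreme_point_of \<Delta>" for v
    using vertex_frame[OF that] by metis
  then obtain w where w: "\<And>v. v extreme_point_of \<Delta> \<Longrightarrow> lattice_basis L (w v ` active v) \<and>
      card (active v) = DIM('a) \<and> (\<forall>i\<in>active v. \<forall>j\<in>active v. u i \<bullet> w v j = (if i = j then 1 else 0))"
    by metis
  have bounded: "bounded \<Delta>" "\<Delta> \<noteq> {}"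
    using polytope polytope_imp_bounded interior_nonempty by auto
  have "facet_polytope d u \<kappa> w L \<sigma>"
    unfolding facet_polytope_def facet_polytope_axioms_def simple_lattice_polytope_def
      simple_lattice_polytope_axioms_def simple_polytope_def eq_halfspace_polyhedron[symmetric]
    using bounded w integral facet_eq by (auto simp: integral_polytope_def active_def)
  then show thesis
    by (rule that)
qed

end

theorem theorem2:
  fixes \<Delta> L :: "'a::euclidean_space set"
    and d :: nat
    and \<sigma> :: "nat \<Rightarrow> 'a set"
    and u :: "nat \<Rightarrow> 'a"
    and \<kappa> :: "nat \<Rightarrow> real"
    and f :: "'a \<Rightarrow> real"
  assumes "is_lattice L"
    and "integral_polytope L \<Delta>"
    and "nonsingular_fan L \<Delta>"
    and "bij_betw \<sigma> {1..d} {F. F facet_of \<Delta>}"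
    and "\<And>i. i \<in> {1..d} \<Longrightarrow> primitive_in (dual_lattice L) (u i) \<and> inward_normal \<Delta> (\<sigma> i) (u i)"
    and "\<Delta> = (\<Inter>i\<in>{1..d}. {x. u i \<bullet> x + \<kappa> i \<ge> 0})"
    and "real_polynomial_function f"
  shows "(\<Sum>x\<in>\<Delta> \<inter> L. f x) = series_integral L d u \<kappa> (T_series d \<sigma> \<Delta>) f \<and>
    (\<Sum>x\<in>interior \<Delta> \<inter> L. f x) = series_integral L d u \<kappa> (T_hat_series d \<sigma> \<Delta>) f \<and>
    (\<Sum>x\<in>\<Delta> \<inter> L. f x) - 1 / 2 * (\<Sum>x\<in>frontier \<Delta> \<inter> L. f x) =
           series_integral L d u \<kappa> (mfps_const (1 / 2) * (T_series d \<sigma> \<Delta> + T_hat_series d \<sigma> \<Delta>)) f"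
proof -
  interpret data: lattice_polytope_data \<Delta> L d \<sigma> u \<kappa>
    using assms by unfold_locales
  obtain w where "facet_polytope d u \<kappa> w L \<sigma>"
    using data.facet_polytope by blast
  then interpret facet_polytope d u \<kappa> w "halfspace_polyhedron {1..d} u \<kappa>"
    "{z. z extreme_point_of halfspace_polyhedron {1..d} u \<kappa>}"
    "\<lambda>z. {i \<in> {1..d}. u i \<bullet> z + \<kappa> i = 0}" L \<sigma> .
  note P_eq = data.eq_halfspace_polyhedron[symmetric]
  \<comment> \<open>The edge directions at all vertices; \<open>generic\<close> means not orthogonal
    to any of them.\<close>
  let ?W = "\<Union>z\<in>{z. z extreme_point_of halfspace_polyhedron {1..d} u \<kappa>}.
    w z ` {i \<in> {1..d}. u i \<bullet> z + \<kappa> i = 0}"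
  have "finite ?W" "0 \<notin> ?W"
    using finite_V w_nonzero by auto
  then have "f \<in> power_sums {\<xi>. \<forall>a\<in>?W. \<xi> \<bullet> a \<noteq> 0}"
    using assms(7) by (rule real_polynomial_function_power_sums)
  then obtain n :: nat and c \<xi> k where f: "f = (\<lambda>x. \<Sum>m<n. c m * (\<xi> m \<bullet> x) ^ k m)"
    and \<xi>: "\<And>m. m < n \<Longrightarrow> \<xi> m \<in> {\<xi>. \<forall>a\<in>?W. \<xi> \<bullet> a \<noteq> 0}"
    by (rule power_sums_representation) (rule that)
  have "generic (\<xi> m)" if "m \<in> {..<n}" for m
    using \<xi>[of m] that by (auto simp: generic_def)
  note em = euler_maclaurin_powers[OF finite_lessThan this f, unfolded P_eq]
  have closed: "(\<Sum>x\<in>\<Delta> \<inter> L. f x) = series_integral L d u \<kappa> (T_series d \<sigma> \<Delta>) f"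
    by (rule em(1))
  have int: "(\<Sum>x\<in>interior \<Delta> \<inter> L. f x) = series_integral L d u \<kappa> (T_hat_series d \<sigma> \<Delta>) f"
    unfolding data.interior_eq by (rule em(2))
  \<comment> \<open>The boundary sum is the difference of the closed and the open sum, so the third
    left-hand side is their mean.\<close>
  have "frontier \<Delta> \<inter> L = \<Delta> \<inter> L - interior \<Delta> \<inter> L"
    using polytope_imp_closed[OF data.polytope] by (auto simp: frontier_def)
  moreover have "interior \<Delta> \<inter> L \<subseteq> \<Delta> \<inter> L"
    using interior_subset by blast
  ultimately have "(\<Sum>x\<in>frontier \<Delta> \<inter> L. f x) = (\<Sum>x\<in>\<Delta> \<inter> L. f x) - (\<Sum>x\<in>interior \<Delta> \<inter> L. f x)"
    using finite_lattice_points[unfolded P_eq] by (simp add: sum_diff)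
  moreover have "series_integral L d u \<kappa> (mfps_const (1 / 2) * (T_series d \<sigma> \<Delta> + T_hat_series d \<sigma> \<Delta>)) f =
      1 / 2 * (series_integral L d u \<kappa> (T_series d \<sigma> \<Delta>) f + series_integral L d u \<kappa> (T_hat_series d \<sigma> \<Delta>) f)"
    by (rule em(3))
  ultimately show ?thesis
    using closed int by (simp add: field_simps)
qed

end
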